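(* Let $n\ge1$, $\hbar>0$ and $p\in\mathbb{C}^n$. The translation group $\mathbb{C}^n$ acts on $\mathcal{A}_{p,\hbar}$, equipped with the product $\star^\hbar_{\mathrm{Wick}}$, via pull-backs by continuous inner $^*$-automorphisms: for every $w\in\mathbb{C}^n$, the pull-back $T_w^*$, $(T_w^*f)(z)=f(z+w)$, maps $\mathcal{A}_{p,\hbar}$ to itself, is a continuous $^*$-automorphism, and $$T_w^*f=\mathrm{Ad}_{\mathrm{Wick}}(u_w)f=u_w\star^\hbar_{\mathrm{Wick}}f\star^\hbar_{\mathrm{Wick}}u_w^{-1}\qquad(f\in\mathcal{A}_{p,\hbar}),$$ where $u_w\in\mathcal{A}_{p,\hbar}$ is the unitary element $u_w(z,\overline z)=\mathrm{e}^{-\frac{\overline{w}w}{4\hbar}}\,\mathrm{e}^{\frac{1}{2\hbar}(\overline{w}z-w\overline{z})}$.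
   Context: Conventions: $\mathbb{N}=\{0,1,2,\dots\}$; $z=(z^1,\dots,z^n)$ are the standard holomorphic coordinates on $\mathbb{C}^n$; $\overline{w}z=\sum_k\overline{w}^kz^k$ etc.; multiindex notation is the usual componentwise one; $\sum_{N=0}^\infty$ means summation over $N\in\mathbb{N}^n$ and $\sum_{I=0}^R$ summation over $I\in\mathbb{N}^n$ with $I\le R$. For $f\in C^\infty(\mathbb{C}^n)$, $m\in\mathbb{N}$, $\ell\in\{0,\dots,2^m-1\}$, $R,S\in\mathbb{N}^n$ define recursively, with values in $[0,+\infty]$, $$h^{p,\hbar}_{0,0,R,S}(f)=\sum_{N=0}^\infty\frac{(2\hbar)^{|R|+|S|+|N|}}{N!}\left|\frac{\partial^{|R|+|S|+|N|}f}{\partial z^R\partial\overline{z}^{N+S}}(p)\right|^2,$$ and for $m\ge1$ $$h^{p,\hbar}_{m,\ell,R,S}(f)=\sum_{N=0}^\infty\frac1{N!}\Big(\sum_{I=0}^R\sum_{J=0}^{N+S}\tbinom{R}{I}\tbinom{N+S}{J}h^{p,\hbar}_{m-1,\ell/2,I,J}(f)\Big)^2\quad(\ell\text{ even}),$$ $$h^{p,\hbar}_{m,\ell,R,S}(f)=\sum_{N=0}^\infty\frac1{N!}\Big(\sum_{I=0}^R\sum_{J=0}^{N+S}\tbinom{R}{I}\tbinom{N+S}{J}h^{p,\hbar}_{m-1,(\ell-1)/2,J,I}(f)\Big)^2\quad(\ell\text{ odd}).$$ Put $\|f\|^{p,\hbar}_{m,\ell,R,S}=\big(h^{p,\hbar}_{m,\ell,R,S}(f)\big)^{1/2^{m+1}}$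 and $\widetilde{\mathcal{A}}_{p,\hbar}=\{f\in C^\infty(\mathbb{C}^n)\mid \|f\|^{p,\hbar}_{m,\ell,R,S}<\infty\text{ for all }m,\ell,R,S\}$, a vector space on which these are seminorms. Define $\mathcal{A}_{p,\hbar}=\widetilde{\mathcal{A}}_{p,\hbar}/\{f\in C^\infty(\mathbb{C}^n)\mid \mathsf{j}^\infty_pf=0\}$ (quotient by the functions with vanishing $\infty$-jet at $p$), with the topology induced by all the seminorms; it is a Fréchet space. Every class has a unique real-analytic representative, so $\mathcal{A}_{p,\hbar}$ is identified with a subspace of $C^\omega(\mathbb{C}^n)$. The product $f\star^\hbar_{\mathrm{Wick}}g=\sum_{N=0}^\infty\frac{(2\hbar)^{|N|}}{N!}\frac{\partial^{|N|}f}{\partial z^N}\frac{\partial^{|N|}g}{\partial\overline{z}^N}$ converges absolutely in $\mathcal{A}_{p,\hbar}$ and makes it a Fréchet $^*$-algebra with complex conjugation as involution. An element $u$ is unitary if $\overline{u}$ is its $\star^\hbar_{\mathrm{Wick}}$-inverse. *)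

theory Defs
  imports "HOL-Analysis.Analysis"
begin

subsection \<open>Smooth and real-analytic functions\<close>

primrec C_k :: "nat \<Rightarrow> ('a::euclidean_space \<Rightarrow> 'b::real_normed_vector) \<Rightarrow> bool" where
  "C_k 0 f \<longleftrightarrow> continuous_on UNIV f"
| "C_k (Suc k) f \<longleftrightarrow>
     (\<forall>x. f differentiable (at x)) \<and> (\<forall>v. C_k k (\<lambda>x. frechet_derivative f (at x) v))"

definition smooth :: "('a::euclidean_space \<Rightarrow> 'b::real_normed_vector) \<Rightarrow> bool" where
  "smooth f \<longleftrightarrow> (\<forall>k. C_k k f)"

text \<open>Multiindices in \<open>\<nat>\<^sup>n\<close> are vectors \<open>nat ^ 'n\<close>; the library order and addition on
  vectors are the componentwise ones, so \<open>{..R}\<close> is the finite set of all \<open>I\<close> with \<open>0 \<le> I \<le> R\<close>.\<close>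

definition mabs :: "nat ^ 'n \<Rightarrow> nat" where
  "mabs N = (\<Sum>k\<in>UNIV. N $ k)"

definition mfact :: "nat ^ 'n \<Rightarrow> nat" where
  "mfact N = (\<Prod>k\<in>UNIV. fact (N $ k))"

definition mbinom :: "nat ^ 'n \<Rightarrow> nat ^ 'n \<Rightarrow> nat" where
  "mbinom R I = (\<Prod>k\<in>UNIV. (R $ k) choose (I $ k))"

text \<open>Local expansion into a power series in the \<open>2n\<close> real coordinates around every point.\<close>

definition real_analytic :: "(complex ^ 'n \<Rightarrow> complex) \<Rightarrow> bool" where
  "real_analytic f \<longleftrightarrow>
     (\<forall>a. \<exists>(c :: nat ^ 'n \<Rightarrow> nat ^ 'n \<Rightarrow> complex) r. r > 0 \<and>
        (\<forall>z\<in>ball a r.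
           ((\<lambda>(K, L). c K L * of_real (\<Prod>k\<in>UNIV. Re ((z - a) $ k) ^ (K $ k))
                            * of_real (\<Prod>k\<in>UNIV. Im ((z - a) $ k) ^ (L $ k))) has_sum f z) UNIV))"


subsection \<open>Wirtinger derivatives\<close>

definition dz :: "'n \<Rightarrow> (complex ^ 'n \<Rightarrow> complex) \<Rightarrow> complex ^ 'n \<Rightarrow> complex" where
  "dz k f z = (frechet_derivative f (at z) (axis k 1)
               - \<i> * frechet_derivative f (at z) (axis k \<i>)) / 2"

definition dzbar :: "'n \<Rightarrow> (complex ^ 'n \<Rightarrow> complex) \<Rightarrow> complex ^ 'n \<Rightarrow> complex" where
  "dzbar k f z = (frechet_derivative f (at z) (axis k 1)
                  + \<i> * frechet_derivative f (at z) (axis k \<i>)) / 2"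

text \<open>The coordinate derivatives are applied in some fixed order of the coordinates; the
  order is immaterial for smooth functions.\<close>

definition multi_deriv ::
  "('n::finite \<Rightarrow> (complex ^ 'n \<Rightarrow> complex) \<Rightarrow> complex ^ 'n \<Rightarrow> complex) \<Rightarrow> nat ^ 'n
    \<Rightarrow> (complex ^ 'n \<Rightarrow> complex) \<Rightarrow> complex ^ 'n \<Rightarrow> complex" where
  "multi_deriv D N f =
     foldr (\<lambda>k g. (D k ^^ (N $ k)) g) (SOME ks. distinct ks \<and> set ks = UNIV) f"

abbreviation dz_multi ::
  "nat ^ 'n \<Rightarrow> (complex ^ 'n \<Rightarrow> complex) \<Rightarrow> complex ^ 'n \<Rightarrow> complex" where
  "dz_multi \<equiv> multi_deriv dz"

abbreviation dzbar_multi ::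
  "nat ^ 'n \<Rightarrow> (complex ^ 'n \<Rightarrow> complex) \<Rightarrow> complex ^ 'n \<Rightarrow> complex" where
  "dzbar_multi \<equiv> multi_deriv dzbar"


subsection \<open>The Frechet space\<close>

text \<open>The index \<open>l\<close> is meant to range over \<open>l < 2 ^ m\<close>; \<open>l div 2\<close> is \<open>l / 2\<close> for even and
  \<open>(l - 1) / 2\<close> for odd \<open>l\<close>. Note that \<open>I\<close> and \<open>J\<close> are swapped in the odd case.\<close>

primrec wick_h ::
  "real \<Rightarrow> complex ^ 'n \<Rightarrow> (complex ^ 'n \<Rightarrow> complex) \<Rightarrow> nat \<Rightarrow> nat \<Rightarrow> nat ^ 'n \<Rightarrow> nat ^ 'n \<Rightarrow> ennreal"
where
  "wick_h hbar p f 0 = (\<lambda>l R S.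
     \<Sum>\<^sub>\<infinity>N. ennreal ((2 * hbar) ^ (mabs R + mabs S + mabs N) / mfact N
                 * (cmod (dz_multi R (dzbar_multi (N + S) f) p))\<^sup>2))"
| "wick_h hbar p f (Suc m) = (\<lambda>l R S.
     \<Sum>\<^sub>\<infinity>N. ennreal (1 / mfact N) *
       (\<Sum>I\<in>{..R}. \<Sum>J\<in>{..N + S}. of_nat (mbinom R I * mbinom (N + S) J) *
          (if even l then wick_h hbar p f m (l div 2) I J
           else wick_h hbar p f m (l div 2) J I))\<^sup>2)"

definition wick_seminorm ::
  "real \<Rightarrow> complex ^ 'n \<Rightarrow> nat \<Rightarrow> nat \<Rightarrow> nat ^ 'n \<Rightarrow> nat ^ 'n \<Rightarrow> (complex ^ 'n \<Rightarrow> complex) \<Rightarrow> ennreal"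
where
  "wick_seminorm hbar p m l R S f =
     (if wick_h hbar p f m l R S = \<infinity> then \<infinity>
      else ennreal (root (2 ^ (m + 1)) (enn2real (wick_h hbar p f m l R S))))"

definition wick_tilde :: "real \<Rightarrow> complex ^ 'n \<Rightarrow> (complex ^ 'n \<Rightarrow> complex) set" where
  "wick_tilde hbar p =
     {f. smooth f \<and> (\<forall>m l R S. l < 2 ^ m \<longrightarrow> wick_seminorm hbar p m l R S f < \<infinity>)}"

text \<open>Every class of \<open>wick_tilde hbar p\<close> modulo the functions with vanishing infinite jet
  at \<open>p\<close> has exactly one real-analytic representative. The quotient is represented by these;
  the seminorms only depend on the infinite jet at \<open>p\<close>, hence only on the class.\<close>

definition wick_space :: "real \<Rightarrow> complex ^ 'n \<Rightarrow> (complex ^ 'n \<Rightarrow> complex) set" where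
  "wick_space hbar p = {f \<in> wick_tilde hbar p. real_analytic f}"

definition wick_topology :: "real \<Rightarrow> complex ^ 'n \<Rightarrow> (complex ^ 'n \<Rightarrow> complex) topology" where
  "wick_topology hbar p = topology_generated_by
     {{g \<in> wick_space hbar p. wick_seminorm hbar p m l R S (\<lambda>z. g z - f z) < ennreal e} | f m l R S e.
        f \<in> wick_space hbar p \<and> l < 2 ^ m \<and> 0 < e}"


subsection \<open>The Wick star product\<close>

text \<open>The sum over all multiindices is taken in the topology of \<open>wick_space hbar p\<close>, as
  the limit of the net of finite partial sums.\<close>

definition wick_star ::
  "real \<Rightarrow> complex ^ 'n \<Rightarrow> (complex ^ 'n \<Rightarrow> complex) \<Rightarrow> (complex ^ 'n \<Rightarrow> complex) \<Rightarrow> (complex ^ 'n \<Rightarrow> complex)"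
where
  "wick_star hbar p f g = (THE h.
     limitin (wick_topology hbar p)
       (\<lambda>F z. \<Sum>N\<in>F. of_real ((2 * hbar) ^ mabs N / mfact N) * dz_multi N f z * dzbar_multi N g z)
       h (finite_subsets_at_top UNIV))"

definition wick_is_inverse ::
  "real \<Rightarrow> complex ^ 'n \<Rightarrow> (complex ^ 'n \<Rightarrow> complex) \<Rightarrow> (complex ^ 'n \<Rightarrow> complex) \<Rightarrow> bool" where
  "wick_is_inverse hbar p u v \<longleftrightarrow>
     u \<in> wick_space hbar p \<and> v \<in> wick_space hbar p \<and>
     wick_star hbar p u v = (\<lambda>z. 1) \<and> wick_star hbar p v u = (\<lambda>z. 1)"

definition wick_inverse ::
  "real \<Rightarrow> complex ^ 'n \<Rightarrow> (complex ^ 'n \<Rightarrow> complex) \<Rightarrow> (complex ^ 'n \<Rightarrow> complex)" where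
  "wick_inverse hbar p u = (THE v. wick_is_inverse hbar p u v)"

definition wick_unitary :: "real \<Rightarrow> complex ^ 'n \<Rightarrow> (complex ^ 'n \<Rightarrow> complex) \<Rightarrow> bool" where
  "wick_unitary hbar p u \<longleftrightarrow> wick_is_inverse hbar p u (\<lambda>z. cnj (u z))"

definition Ad_Wick ::
  "real \<Rightarrow> complex ^ 'n \<Rightarrow> (complex ^ 'n \<Rightarrow> complex) \<Rightarrow> (complex ^ 'n \<Rightarrow> complex) \<Rightarrow> (complex ^ 'n \<Rightarrow> complex)"
where
  "Ad_Wick hbar p u f = wick_star hbar p (wick_star hbar p u f) (wick_inverse hbar p u)"

definition wick_star_automorphism ::
  "real \<Rightarrow> complex ^ 'n \<Rightarrow> ((complex ^ 'n \<Rightarrow> complex) \<Rightarrow> (complex ^ 'n \<Rightarrow> complex)) \<Rightarrow> bool" where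
  "wick_star_automorphism hbar p T \<longleftrightarrow>
     bij_betw T (wick_space hbar p) (wick_space hbar p) \<and>
     (\<forall>f\<in>wick_space hbar p. \<forall>g\<in>wick_space hbar p. T (\<lambda>z. f z + g z) = (\<lambda>z. T f z + T g z)) \<and>
     (\<forall>c. \<forall>f\<in>wick_space hbar p. T (\<lambda>z. c * f z) = (\<lambda>z. c * T f z)) \<and>
     (\<forall>f\<in>wick_space hbar p. \<forall>g\<in>wick_space hbar p.
        T (wick_star hbar p f g) = wick_star hbar p (T f) (T g)) \<and>
     (\<forall>f\<in>wick_space hbar p. T (\<lambda>z. cnj (f z)) = (\<lambda>z. cnj (T f z)))"


subsection \<open>Translations\<close>

definition pull_back ::
  "complex ^ 'n \<Rightarrow> (complex ^ 'n \<Rightarrow> complex) \<Rightarrow> (complex ^ 'n \<Rightarrow> complex)" where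
  "pull_back w f = (\<lambda>z. f (z + w))"

definition u_trans :: "real \<Rightarrow> complex ^ 'n \<Rightarrow> complex ^ 'n \<Rightarrow> complex" where
  "u_trans hbar w z =
     exp (- (\<Sum>k\<in>UNIV. cnj (w $ k) * w $ k) / of_real (4 * hbar)) *
     exp (1 / of_real (2 * hbar) *
          ((\<Sum>k\<in>UNIV. cnj (w $ k) * z $ k) - (\<Sum>k\<in>UNIV. w $ k * cnj (z $ k))))"

end

theory Submission
  imports Defs "HOL-Complex_Analysis.Cauchy_Integral_Formula"
begin

text \<open>
  After the rescaling \<open>z = p + \<surd>(2\<hbar>) \<zeta>\<close> an element of the algebra is encoded by the array of its
  Taylor coefficients \<open>a (R, S)\<close> at \<open>p\<close>, and \<open>\<hbar>\<close> disappears. Finiteness of \<open>h\<^sub>1\<close> makes the Taylor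
  series entire in \<open>(\<zeta>, \<zeta>')\<close>, where \<open>\<zeta>'\<close> replaces the conjugate of \<open>\<zeta>\<close>, and a real-analytic function
  with that jet equals this series everywhere, by uniqueness along real lines through \<open>p\<close>.

  The functionals \<open>h\<close> are convex and homogeneous in the array; this gives the triangle inequality for
  the seminorms and lets \<open>2xy \<le> x\<^sup>2 + y\<^sup>2\<close> replace every use of Cauchy--Schwarz: conjugation and the star
  product are estimated by the functionals one level up, and so are the tails of the star series, which
  therefore converges in the algebra and in particular pointwise. For \<open>u = exp (\<alpha>\<zeta> + \<beta>\<zeta>')\<close> the star series
  is a Taylor series: \<open>u \<star> f = u \<cdot> f (\<zeta>, \<zeta>' + \<alpha>)\<close> and \<open>f \<star> u = f (\<zeta> + \<beta>, \<zeta>') \<cdot> u\<close>. Hence conjugation with \<open>u\<^sub>w\<close>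
  is the translation by \<open>w\<close>, which is thereby seen to be defined and bounded on the algebra.
\<close>

section \<open>Sums of extended nonnegative reals\<close>

text \<open>All seminorms are taken at the one point \<open>p\<close>, and a translation mixes
  infinitely many Taylor coefficients, so a direct estimate of the translated array is out of reach.
  Reading it as a twofold star product leaves only conjugation and the star product to be estimated.

  Both estimates are made for \<open>h\<close> of level 0 and cost a new level there, at the inner
  end. They reach the outer levels because each of these is monotone and convex. For this reason the
  pair of \<open>m\<close> and \<open>l\<close> is unfolded into a list of bits, to which levels can
  be appended.

  Trading Cauchy--Schwarz for squares leads to bounds of the form \<open>C + h a\<close>, which are
  inhomogeneous and compare functionals of different degrees. Continuity is recovered from them by
  rescaling the argument.

  Sums of absolute values are taken in \<open>ennreal\<close>, where they may be regrouped freely;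
  finiteness is checked afterwards.

  Multiplicativity of the pull-back comes from the constant coefficients of the star series, and
  uniqueness of the inverse of \<open>u_w\<close> from the absence of zeros.\<close>

lemma summable_ennreal [simp]: "f summable_on A" for f :: "'a \<Rightarrow> ennreal"
  by (rule nonneg_summable_on_complete) simp

lemma finite_sum_le_infsum_ennreal:
  fixes f :: "'a \<Rightarrow> ennreal"
  assumes "finite F" "F \<subseteq> A"
  shows "sum f F \<le> infsum f A"
proof -
  have "infsum f F \<le> infsum f A"
    by (rule infsum_mono_neutral) (use assms in auto)
  then show ?thesis using assms by simp
qed

lemma infsum_mono_ennreal:
  fixes f g :: "'a \<Rightarrow> ennreal"
  assumes "\<And>x. x \<in> A \<Longrightarrow> f x \<le> g x"
  shows "infsum f A \<le> infsum g A"
  by (rule infsum_mono) (use assms in auto)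

lemma infsum_cmult_ennreal:
  fixes f :: "'a \<Rightarrow> ennreal"
  shows "infsum (\<lambda>x. c * f x) A = c * infsum f A"
proof -
  have "{F. finite F \<and> F \<subseteq> A} \<noteq> {}" by blast
  then show ?thesis
    by (simp add: nonneg_infsum_complete SUP_mult_left_ennreal sum_distrib_left)
qed

lemma infsum_ge_term_ennreal:
  fixes f :: "'a \<Rightarrow> ennreal"
  assumes "x \<in> A"
  shows "f x \<le> infsum f A"
  using finite_sum_le_infsum_ennreal[of "{x}" A f] assms by simp

text \<open>Tonelli's theorem: a finite subset of the \<open>Sigma\<close> set meets only finitely
  many fibres, and sums over finitely many fibres are additive.\<close>

lemma infsum_Sigma_ennreal:
  fixes f :: "'a \<times> 'b \<Rightarrow> ennreal"
  shows "infsum f (Sigma A B) = infsum (\<lambda>x. infsum (\<lambda>y. f (x, y)) (B x)) A"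
proof -
  have fib: "infsum f (Sigma G B) = (\<Sum>x\<in>G. infsum (\<lambda>y. f (x, y)) (B x))" if "finite G" for G
    using that
  proof (induction G rule: finite_induct)
    case (insert x G)
    have "infsum f (Sigma (insert x G) B) = infsum f (Pair x ` B x \<union> Sigma G B)"
      by (rule arg_cong[where f = "infsum f"]) auto
    also have "\<dots> = infsum f (Pair x ` B x) + infsum f (Sigma G B)"
      using insert by (intro infsum_Un_disjoint) auto
    also have "infsum f (Pair x ` B x) = infsum (\<lambda>y. f (x, y)) (B x)"
      by (subst infsum_reindex) (auto simp: inj_on_def o_def)
    finally show ?case using insert by simp
  qed simp
  show ?thesis
  proof (rule antisym)
    show "infsum f (Sigma A B) \<le> infsum (\<lambda>x. infsum (\<lambda>y. f (x, y)) (B x)) A"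
      unfolding nonneg_infsum_complete[of "Sigma A B" f, simplified]
    proof (rule SUP_least)
      fix F assume "F \<in> {F. finite F \<and> F \<subseteq> Sigma A B}"
      then have F: "finite F" "F \<subseteq> Sigma A B" by auto
      have "sum f F \<le> infsum f (Sigma (fst ` F) B)"
        using F by (intro finite_sum_le_infsum_ennreal) force+
      also have "\<dots> = (\<Sum>x\<in>fst ` F. infsum (\<lambda>y. f (x, y)) (B x))"
        using F by (intro fib) auto
      also have "\<dots> \<le> infsum (\<lambda>x. infsum (\<lambda>y. f (x, y)) (B x)) A"
        using F by (intro finite_sum_le_infsum_ennreal) auto
      finally show "sum f F \<le> infsum (\<lambda>x. infsum (\<lambda>y. f (x, y)) (B x)) A" .
    qed
    show "infsum (\<lambda>x. infsum (\<lambda>y. f (x, y)) (B x)) A \<le> infsum f (Sigma A B)"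
      unfolding nonneg_infsum_complete[of A "\<lambda>x. infsum (\<lambda>y. f (x, y)) (B x)", simplified]
    proof (rule SUP_least)
      fix G assume "G \<in> {F. finite F \<and> F \<subseteq> A}"
      then have G: "finite G" "G \<subseteq> A" by auto
      show "(\<Sum>x\<in>G. infsum (\<lambda>y. f (x, y)) (B x)) \<le> infsum f (Sigma A B)"
        unfolding fib[OF G(1), symmetric]
        by (rule infsum_mono_neutral) (use G in auto)
    qed
  qed
qed

lemma has_sum_finite_sum:
  fixes f :: "'i \<Rightarrow> 'a \<Rightarrow> 'b::topological_comm_monoid_add"
  assumes "finite I" "\<And>i. i \<in> I \<Longrightarrow> (f i has_sum s i) A"
  shows "((\<lambda>x. \<Sum>i\<in>I. f i x) has_sum (\<Sum>i\<in>I. s i)) A"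
  using assms by (induction I rule: finite_induct) (auto intro: has_sum_add)

lemma infsum_sum_ennreal:
  fixes f :: "'i \<Rightarrow> 'a \<Rightarrow> ennreal"
  assumes "finite I"
  shows "infsum (\<lambda>x. \<Sum>i\<in>I. f i x) A = (\<Sum>i\<in>I. infsum (f i) A)"
  by (intro infsumI has_sum_finite_sum assms) simp

lemma infsum_ennreal:
  fixes f :: "'a \<Rightarrow> real"
  assumes "f summable_on A" "\<And>x. x \<in> A \<Longrightarrow> 0 \<le> f x"
  shows "infsum (\<lambda>x. ennreal (f x)) A = ennreal (infsum f A)"
proof (rule infsumI, rule has_sum_comm_additive_general[where f = ennreal, unfolded o_def])
  show "sum (\<lambda>x. ennreal (f x)) F = ennreal (sum f F)" if "finite F" "F \<subseteq> A" for F
    using that assms(2) by (auto intro!: sum_ennreal)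
qed (use assms(1) in \<open>auto simp: isCont_def intro!: tendsto_ennrealI continuous_ident\<close>)

text \<open>The bridge by which a finiteness computed in \<open>ennreal\<close> becomes convergence
  of a complex series, since unconditional and absolute summability agree there.\<close>

lemma summable_on_iff_infsum_ennreal_cmod:
  fixes f :: "'a \<Rightarrow> complex"
  shows "f summable_on A \<longleftrightarrow> infsum (\<lambda>x. ennreal (cmod (f x))) A < \<infinity>"
proof
  assume "f summable_on A"
  then have "(\<lambda>x. cmod (f x)) summable_on A"
    by (simp add: summable_on_iff_abs_summable_on_complex)
  then show "infsum (\<lambda>x. ennreal (cmod (f x))) A < \<infinity>"
    by (simp add: infsum_ennreal)
next
  assume fin: "infsum (\<lambda>x. ennreal (cmod (f x))) A < \<infinity>"
  have "(\<Sum>x\<in>F. cmod (f x)) \<le> enn2real (infsum (\<lambda>x. ennreal (cmod (f x))) A)"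
    if "finite F" "F \<subseteq> A" for F
  proof -
    have "(\<Sum>x\<in>F. ennreal (cmod (f x))) \<le> infsum (\<lambda>x. ennreal (cmod (f x))) A"
      using that by (intro finite_sum_le_infsum_ennreal) auto
    then have "ennreal (\<Sum>x\<in>F. cmod (f x)) \<le> infsum (\<lambda>x. ennreal (cmod (f x))) A"
      by (simp add: sum_ennreal)
    then have "enn2real (ennreal (\<Sum>x\<in>F. cmod (f x))) \<le> enn2real (infsum (\<lambda>x. ennreal (cmod (f x))) A)"
      using fin by (intro enn2real_mono) auto
    then show ?thesis by (simp add: sum_nonneg)
  qed
  then have "(\<lambda>x. cmod (f x)) summable_on A"
    by (intro nonneg_bdd_above_summable_on) (auto simp: bdd_above_def)
  then show "f summable_on A"
    by (simp add: summable_on_iff_abs_summable_on_complex)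
qed

lemma cmod_infsum_le_ennreal:
  fixes f :: "'a \<Rightarrow> complex"
  shows "ennreal (cmod (infsum f A)) \<le> infsum (\<lambda>x. ennreal (cmod (f x))) A"
proof (cases "f summable_on A")
  case True
  then have abs: "(\<lambda>x. cmod (f x)) summable_on A"
    by (simp add: summable_on_iff_abs_summable_on_complex)
  then have "infsum (\<lambda>x. ennreal (cmod (f x))) A = ennreal (infsum (\<lambda>x. cmod (f x)) A)"
    by (simp add: infsum_ennreal)
  moreover have "cmod (infsum f A) \<le> infsum (\<lambda>x. cmod (f x)) A"
    using abs by (rule norm_infsum_bound)
  ultimately show ?thesis by (simp add: ennreal_leI)
\<comment> \<open>A family that is not summable has \<open>infsum\<close> equal to 0, so the bound
  is trivial.\<close>
qed (simp add: infsum_not_exists)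

lemma infsum_tail_tendsto_0_ennreal:
  fixes f :: "'a \<Rightarrow> ennreal"
  assumes "infsum f A < \<infinity>"
  shows "((\<lambda>F. infsum f (A - F)) \<longlongrightarrow> 0) (finite_subsets_at_top A)"
proof -
  have lim: "(sum f \<longlongrightarrow> infsum f A) (finite_subsets_at_top A)"
    by (simp add: infsum_tendsto)
  have eq: "infsum f (A - F) = infsum f A - sum f F" if "finite F" "F \<subseteq> A" for F
  proof -
    have "infsum f A = infsum f (F \<union> (A - F))" using that by (simp add: Un_absorb1)
    also have "\<dots> = sum f F + infsum f (A - F)"
      using that by (subst infsum_Un_disjoint) auto
    finally have e: "infsum f A = sum f F + infsum f (A - F)" .
    \<comment> \<open>Finiteness of the partial sum is what makes cancellation in
      \<open>ennreal\<close> legitimate.\<close>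
    moreover have "sum f F < top" using assms e by (auto simp: less_top[symmetric])
    ultimately show ?thesis by (simp add: ennreal_add_diff_cancel_left)
  qed
  have "((\<lambda>F. infsum f A - sum f F) \<longlongrightarrow> infsum f A - infsum f A) (finite_subsets_at_top A)"
    using assms by (intro tendsto_diff_ennreal lim tendsto_const) auto
  moreover have "infsum f A - infsum f A = 0"
    using assms by (simp add: ennreal_minus_eq_0)
  ultimately have "((\<lambda>F. infsum f A - sum f F) \<longlongrightarrow> 0) (finite_subsets_at_top A)" by simp
  then show ?thesis
    by (rule Lim_transform_eventually)
       (use eq in \<open>auto simp: eventually_finite_subsets_at_top intro!: exI[of _ "{}"]\<close>)
qed

text \<open>Dominated convergence along an arbitrary filter: outside a finite set the majorant makes
  the sum small uniformly in \<open>i\<close>, and inside it the pointwise limits suffice.\<close>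

lemma tendsto_infsum_dominated_ennreal:
  fixes f :: "'a \<Rightarrow> 'b \<Rightarrow> ennreal" and G :: "'a filter"
  assumes lim: "\<And>x. ((\<lambda>i. f i x) \<longlongrightarrow> 0) G"
    and le: "\<And>i x. f i x \<le> g x" and fin: "infsum g UNIV < \<infinity>"
  shows "((\<lambda>i. infsum (f i) UNIV) \<longlongrightarrow> 0) G"
proof (rule order_tendstoI)
  fix e :: ennreal assume "0 < e"
  then obtain d where d: "0 < d" "d < e" using dense by blast
  have "eventually (\<lambda>F. infsum g (UNIV - F) < d) (finite_subsets_at_top UNIV)"
    using order_tendstoD(2)[OF infsum_tail_tendsto_0_ennreal[OF fin] d(1)] .
  then obtain F where F: "finite F" "infsum g (UNIV - F) < d"
    by (auto simp: eventually_finite_subsets_at_top)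
  have "((\<lambda>i. (\<Sum>x\<in>F. f i x) + infsum g (UNIV - F)) \<longlongrightarrow> (\<Sum>x\<in>F. 0) + infsum g (UNIV - F)) G"
    by (intro tendsto_intros lim)
  then have "eventually (\<lambda>i. (\<Sum>x\<in>F. f i x) + infsum g (UNIV - F) < e) G"
    using F d by (intro order_tendstoD(2)[of _ "infsum g (UNIV - F)"]) auto
  then show "eventually (\<lambda>i. infsum (f i) UNIV < e) G"
  proof eventually_elim
    case (elim i)
    have "infsum (f i) UNIV = infsum (f i) (F \<union> (UNIV - F))" by simp
    also have "\<dots> = sum (f i) F + infsum (f i) (UNIV - F)"
      using F by (subst infsum_Un_disjoint) auto
    also have "\<dots> \<le> sum (f i) F + infsum g (UNIV - F)"
      by (intro add_left_mono infsum_mono_ennreal le)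
    finally show ?case using elim by simp
  qed
qed auto

lemma power2_convex_ennreal:
  fixes u v s t :: ennreal
  assumes "s + t = 1"
  shows "(s * u + t * v)\<^sup>2 \<le> s * u\<^sup>2 + t * v\<^sup>2"
proof -
  have top: "x\<^sup>2 = top" if "x = top" for x :: ennreal using that by (simp add: power2_eq_square)
  \<comment> \<open>If one weight is 0, the other is 1; if both are nonzero, an infinite argument
    makes the right-hand side infinite. Only the last case calls for real arithmetic.\<close>
  consider "s = 0" | "t = 0" | "s \<noteq> 0" "t \<noteq> 0" "u = top \<or> v = top" | "u \<noteq> top" "v \<noteq> top" by blast
  then show ?thesis
  proof cases
    case 4
    obtain s' t' u' v' where r: "s = ennreal s'" "t = ennreal t'" "u = ennreal u'" "v = ennreal v'"
      "s' \<ge> 0" "t' \<ge> 0" "u' \<ge> 0" "v' \<ge> 0"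
    proof -
      have "s \<noteq> top" "t \<noteq> top" using assms by (auto simp: ennreal_add_eq_top)
      with 4 show ?thesis by (cases s; cases t; cases u; cases v) (auto intro: that)
    qed
    have st: "s' + t' = 1"
      using assms r by (simp add: ennreal_plus[symmetric] del: ennreal_plus)
    have "s' * u'\<^sup>2 + t' * v'\<^sup>2 - (s' * u' + t' * v')\<^sup>2 = s' * t' * (u' - v')\<^sup>2"
    proof -
      have "t' = 1 - s'" using st by simp
      then show ?thesis by algebra
    qed
    moreover have "\<dots> \<ge> 0" using r by simp
    ultimately have "(s' * u' + t' * v')\<^sup>2 \<le> s' * u'\<^sup>2 + t' * v'\<^sup>2" by linarith
    then show ?thesis using r
      by (simp add: ennreal_mult[symmetric] ennreal_plus[symmetric] ennreal_power ennreal_leI del: ennreal_plus)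
  qed (use assms in \<open>auto simp: top ennreal_mult_eq_top_iff ennreal_mult_top ennreal_top_mult\<close>)
qed

section \<open>Multiindices\<close>

lemma mabs_add [simp]: "mabs (N + M) = mabs N + mabs M"
  by (simp add: mabs_def sum.distrib)

lemma mfact_0 [simp]: "mfact 0 = 1"
  by (simp add: mfact_def)

lemma mfact_pos [simp]: "mfact N > 0"
  by (simp add: mfact_def prod_pos)

lemma mfact_nz [simp]: "mfact N \<noteq> 0"
  using mfact_pos[of N] by linarith

lemma bij_betw_atMost_vec: "bij_betw vec_lambda (PiE UNIV (\<lambda>k. {..R $ k})) {..R::nat ^ 'n}"
  by (rule bij_betwI[where g = vec_nth]) (auto simp: less_eq_vec_def PiE_def Pi_def)

lemma finite_atMost_vec [simp]: "finite {..R::nat ^ 'n}"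
  using bij_betw_finite[OF bij_betw_atMost_vec[of R]] by (simp add: finite_PiE)

text \<open>Reduces multiindex identities, such as the binomial theorem, to one coordinate at a
  time.\<close>

lemma sum_atMost_vec_prod:
  fixes f :: "'n::finite \<Rightarrow> nat \<Rightarrow> 'a::comm_semiring_1"
  shows "(\<Sum>I\<in>{..R}. \<Prod>k\<in>UNIV. f k (I $ k)) = (\<Prod>k\<in>UNIV. \<Sum>i\<le>R $ k. f k i)"
proof -
  have "(\<Prod>k\<in>UNIV. \<Sum>i\<le>R $ k. f k i) = (\<Sum>g\<in>PiE UNIV (\<lambda>k. {..R $ k}). \<Prod>k\<in>UNIV. f k (g k))"
    by (rule prod_sum_PiE) auto
  also have "\<dots> = (\<Sum>I\<in>{..R}. \<Prod>k\<in>UNIV. f k (I $ k))"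
    using sum.reindex_bij_betw[OF bij_betw_atMost_vec[of R], of "\<lambda>I. \<Prod>k\<in>UNIV. f k (I $ k)"] by simp
  finally show ?thesis ..
qed

lemma mbinom_refl [simp]: "mbinom R R = 1"
  by (simp add: mbinom_def)

lemma vec_le_diff_add: "I \<le> R \<Longrightarrow> (R - I) + I = R" "I \<le> R \<Longrightarrow> I + (R - I) = R" for R I :: "nat ^ 'n"
  by (auto simp: vec_eq_iff less_eq_vec_def)

lemma vec_diff_le [simp]: "R - I \<le> R" for R I :: "nat ^ 'n"
  by (auto simp: less_eq_vec_def)

lemma vec_diff_diff: "I \<le> R \<Longrightarrow> R - (R - I) = I" for R I :: "nat ^ 'n"
  by (auto simp: vec_eq_iff less_eq_vec_def)

lemma mbinom_diff: "I \<le> R \<Longrightarrow> mbinom R (R - I) = mbinom R I"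
  by (auto simp: mbinom_def less_eq_vec_def binomial_symmetric[symmetric] intro!: prod.cong)

lemma mbinom_mfact: "I \<le> R \<Longrightarrow> mbinom R I * (mfact I * mfact (R - I)) = mfact R"
  by (auto simp: mbinom_def mfact_def less_eq_vec_def prod.distrib[symmetric] intro!: prod.cong)
     (metis binomial_fact_lemma mult.commute mult.assoc)

lemma sum_mbinom_power:
  "(\<Sum>I\<in>{..R}. of_nat (mbinom R I) * q ^ mabs I) = ((1 + q) ^ mabs R :: 'a::comm_semiring_1)"
proof -
  have "(\<Sum>I\<in>{..R}. of_nat (mbinom R I) * q ^ mabs I) =
        (\<Sum>I\<in>{..R}. \<Prod>k\<in>UNIV. of_nat (R $ k choose I $ k) * q ^ (I $ k))"
    by (simp add: mbinom_def mabs_def prod.distrib power_sum)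
  also have "\<dots> = (\<Prod>k\<in>UNIV. \<Sum>i\<le>R $ k. of_nat (R $ k choose i) * q ^ i)"
    by (rule sum_atMost_vec_prod)
  also have "\<dots> = (\<Prod>k\<in>UNIV. (1 + q) ^ (R $ k))"
    by (intro prod.cong refl) (simp add: binomial_ring[of q 1] add.commute[of 1 q])
  finally show ?thesis by (simp add: mabs_def power_sum)
qed

lemma sum_atMost_vec_reflect:
  "(\<Sum>I\<in>{..R::nat ^ 'n}. f (R - I)) = (\<Sum>I\<in>{..R}. f I)"
  by (rule sum.reindex_bij_witness[of _ "\<lambda>I. R - I" "\<lambda>I. R - I"]) (auto simp: vec_diff_diff)

section \<open>Monomials and the multivariate exponential series\<close>

definition mpow :: "'a::comm_monoid_mult ^ 'n \<Rightarrow> nat ^ 'n \<Rightarrow> 'a" where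
  "mpow v N = (\<Prod>k\<in>UNIV. (v $ k) ^ (N $ k))"

text \<open>With the factorial included, the coefficients of a series in these functions are its
  derivatives, and differentiation becomes an index shift of the array.\<close>

definition mexp_term :: "nat ^ 'n \<Rightarrow> complex ^ 'n \<Rightarrow> complex" where
  "mexp_term N v = mpow v N / of_nat (mfact N)"

lemma mpow_add: "mpow v (N + M) = mpow v N * mpow v M"
  by (simp add: mpow_def power_add prod.distrib)

lemma mpow_0 [simp]: "mpow v 0 = 1"
  by (simp add: mpow_def)

lemma mexp_term_prod: "mexp_term N v = (\<Prod>k\<in>UNIV. (v $ k) ^ (N $ k) / fact (N $ k))"
  by (simp add: mexp_term_def mpow_def mfact_def prod_dividef)

lemma mexp_term_0 [simp]: "mexp_term 0 v = 1"
  by (simp add: mexp_term_def)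

lemma bij_vec_lambda: "bij_betw vec_lambda (PiE UNIV (\<lambda>k. UNIV)) (UNIV :: ('a ^ 'n) set)"
  by (rule bij_betwI[where g = vec_nth]) auto

lemma has_sum_mexp_term:
  fixes v :: "complex ^ 'n"
  shows "((\<lambda>N. mexp_term N v) has_sum exp (\<Sum>k\<in>UNIV. v $ k)) UNIV"
proof -
  have ab: "(\<lambda>i. norm (z ^ i / fact i)) summable_on UNIV" for z :: complex
    using summable_nonneg_imp_summable_on[of "\<lambda>i. norm (z ^ i / fact i)"]
      summable_norm_exp[of z] by (simp add: norm_divide norm_power divide_inverse_commute scaleR_conv_of_real norm_mult)
  have ex: "infsum (\<lambda>i. z ^ i / fact i) UNIV = exp z" for z :: complex
  proof -
    have "(\<lambda>i. z ^ i / fact i) sums exp z"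
      using exp_converges[of z] by (simp add: scaleR_conv_of_real divide_inverse_commute)
    moreover have "(\<lambda>i. z ^ i / fact i) sums infsum (\<lambda>i. z ^ i / fact i) UNIV"
      using Infinite_Sum.abs_summable_summable[OF ab[of z]] by (intro has_sum_imp_sums has_sum_infsum)
    ultimately show ?thesis using sums_unique2 by blast
  qed
  have e: "infsum (\<lambda>g. \<Prod>k\<in>UNIV. (w $ k) ^ g k / fact (g k)) (PiE UNIV (\<lambda>k. UNIV)) = exp (\<Sum>k\<in>UNIV. w $ k)"
    for w :: "complex ^ 'n"
    using infsum_prod_PiE_abs[of UNIV "\<lambda>k i. (w $ k) ^ i / fact i" "\<lambda>k. UNIV"] ab
    by (simp add: ex exp_sum)
  have i: "infsum (\<lambda>N. mexp_term N w) UNIV = exp (\<Sum>k\<in>UNIV. w $ k)" for w :: "complex ^ 'n"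
    using infsum_reindex_bij_betw[OF bij_vec_lambda, of "\<lambda>N. mexp_term N w"] e[of w]
    by (simp add: mexp_term_prod)
  \<comment> \<open>An \<open>infsum\<close> without convergence would be 0, but an exponential is
    not 0, so the value alone forces summability. At nonnegative coordinates this is absolute
    summability.\<close>
  have "(\<lambda>N. mexp_term N (\<chi> k. of_real (cmod (v $ k)))) summable_on UNIV"
    using i[of "\<chi> k. of_real (cmod (v $ k))"] infsum_not_exists by force
  then have "(\<lambda>N. cmod (mexp_term N (\<chi> k. of_real (cmod (v $ k))))) summable_on UNIV"
    by (simp add: summable_on_iff_abs_summable_on_complex)
  moreover have "cmod (mexp_term N (\<chi> k. of_real (cmod (v $ k)))) = cmod (mexp_term N v)" for N
    by (simp add: mexp_term_prod prod_norm[symmetric] norm_divide norm_power)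
  ultimately have "(\<lambda>N. mexp_term N v) summable_on UNIV"
    by (simp add: summable_on_iff_abs_summable_on_complex)
  then show ?thesis using i[of v] by (metis has_sum_infsum)
qed

lemma infsum_power_mabs_finite:
  assumes "q \<ge> 0"
  shows "infsum (\<lambda>N::nat ^ 'n. ennreal (1 / real (mfact N)) * ennreal q ^ mabs N) UNIV < \<infinity>"
proof -
  have "infsum (\<lambda>N::nat ^ 'n. ennreal (cmod (mexp_term N (\<chi> k. of_real q)))) UNIV < \<infinity>"
    using has_sum_mexp_term[of "\<chi> k. of_real q", THEN has_sum_imp_summable]
    by (simp only: summable_on_iff_infsum_ennreal_cmod)
  moreover have "ennreal (cmod (mexp_term N (\<chi> k. of_real q))) = ennreal (1 / real (mfact N)) * ennreal q ^ mabs N"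
    for N :: "nat ^ 'n"
  proof -
    have "cmod (mexp_term N (\<chi> k. of_real q)) = 1 / real (mfact N) * q ^ mabs N"
      using assms by (simp add: mexp_term_def mpow_def norm_divide norm_power mabs_def power_sum[symmetric])
    then show ?thesis using assms by (simp add: ennreal_power ennreal_mult[symmetric])
  qed
  ultimately show ?thesis by simp
qed

section \<open>The cascade of quadratic sums\<close>

definition binsum :: "(nat ^ 'n \<Rightarrow> nat ^ 'n \<Rightarrow> ennreal) \<Rightarrow> nat ^ 'n \<Rightarrow> nat ^ 'n \<Rightarrow> ennreal" where
  "binsum x R S = (\<Sum>I\<in>{..R}. \<Sum>J\<in>{..S}. of_nat (mbinom R I * mbinom S J) * x I J)"

definition swap_if :: "bool \<Rightarrow> ('a \<Rightarrow> 'a \<Rightarrow> 'b) \<Rightarrow> 'a \<Rightarrow> 'a \<Rightarrow> 'b" where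
  "swap_if b x I J = (if b then x J I else x I J)"

text \<open>One level of the recursion for \<open>h\<close>; the flag says that \<open>l\<close> is odd. In \<open>cascade\<close> the head of the
  list is the outermost level, that is, the lowest bit of \<open>l\<close>.\<close>

definition cstep :: "bool \<Rightarrow> (nat ^ 'n \<Rightarrow> nat ^ 'n \<Rightarrow> ennreal) \<Rightarrow> nat ^ 'n \<Rightarrow> nat ^ 'n \<Rightarrow> ennreal" where
  "cstep b x R S = (\<Sum>\<^sub>\<infinity>N. ennreal (1 / mfact N) * (binsum (swap_if b x) R (N + S))\<^sup>2)"

primrec cascade :: "bool list \<Rightarrow> (nat ^ 'n \<Rightarrow> nat ^ 'n \<Rightarrow> ennreal) \<Rightarrow> nat ^ 'n \<Rightarrow> nat ^ 'n \<Rightarrow> ennreal" where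
  "cascade [] x = x"
| "cascade (b # bs) x = cstep b (cascade bs x)"

lemma cascade_append: "cascade (bs @ bs') x = cascade bs (cascade bs' x)"
  by (induction bs) simp_all

lemma binsum_mono: "(\<And>I J. x I J \<le> y I J) \<Longrightarrow> binsum x R S \<le> binsum y R S"
  unfolding binsum_def by (intro sum_mono mult_left_mono) auto

lemma cstep_mono: "(\<And>I J. x I J \<le> y I J) \<Longrightarrow> cstep b x R S \<le> cstep b y R S"
  unfolding cstep_def
  by (intro infsum_mono_ennreal mult_left_mono power_mono binsum_mono) (auto simp: swap_if_def)

lemma cascade_mono: "(\<And>I J. x I J \<le> y I J) \<Longrightarrow> cascade bs x R S \<le> cascade bs y R S"
  by (induction bs arbitrary: R S) (auto intro: cstep_mono)

lemma binsum_linear: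
  "binsum (\<lambda>I J. s * x I J + t * y I J) R S = s * binsum x R S + t * binsum y R S"
  by (simp add: binsum_def sum_distrib_left sum.distrib algebra_simps)

lemma cstep_convex:
  assumes "s + t = 1"
  shows "cstep b (\<lambda>I J. s * x I J + t * y I J) R S \<le> s * cstep b x R S + t * cstep b y R S"
proof -
  have sw: "swap_if b (\<lambda>I J. s * x I J + t * y I J) = (\<lambda>I J. s * swap_if b x I J + t * swap_if b y I J)"
    by (auto simp: swap_if_def fun_eq_iff)
  have "cstep b (\<lambda>I J. s * x I J + t * y I J) R S
      \<le> (\<Sum>\<^sub>\<infinity>N. ennreal (1 / mfact N) * (s * (binsum (swap_if b x) R (N + S))\<^sup>2
          + t * (binsum (swap_if b y) R (N + S))\<^sup>2))"
    unfolding cstep_def sw binsum_linear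
    by (intro infsum_mono_ennreal mult_left_mono power2_convex_ennreal assms) auto
  also have "\<dots> = (\<Sum>\<^sub>\<infinity>N. s * (ennreal (1 / mfact N) * (binsum (swap_if b x) R (N + S))\<^sup>2)
          + t * (ennreal (1 / mfact N) * (binsum (swap_if b y) R (N + S))\<^sup>2))"
    by (simp add: algebra_simps)
  also have "\<dots> = s * cstep b x R S + t * cstep b y R S"
    by (simp add: infsum_add infsum_cmult_ennreal cstep_def)
  finally show ?thesis .
qed

text \<open>Each level is a positive linear map, followed by the convex and monotone square,
  followed by a positive sum. Monotonicity lets the convexity estimate of the inner levels pass
  through the outer one.\<close>

lemma cascade_convex:
  assumes "s + t = 1"
  shows "cascade bs (\<lambda>I J. s * x I J + t * y I J) R S \<le> s * cascade bs x R S + t * cascade bs y R S"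
proof (induction bs arbitrary: R S)
  case (Cons b bs)
  have "cascade (b # bs) (\<lambda>I J. s * x I J + t * y I J) R S
      \<le> cstep b (\<lambda>I J. s * cascade bs x I J + t * cascade bs y I J) R S"
    unfolding cascade.simps by (intro cstep_mono Cons.IH)
  also have "\<dots> \<le> s * cascade (b # bs) x R S + t * cascade (b # bs) y R S"
    unfolding cascade.simps by (rule cstep_convex[OF assms])
  finally show ?case .
qed simp

lemma cstep_cmult: "cstep b (\<lambda>I J. c * x I J) R S = c\<^sup>2 * cstep b x R S"
proof -
  have "binsum (swap_if b (\<lambda>I J. c * x I J)) R S' = c * binsum (swap_if b x) R S'" for S'
    by (auto simp: binsum_def swap_if_def sum_distrib_left algebra_simps intro!: sum.cong)
  then show ?thesis
    by (simp add: cstep_def power_mult_distrib mult.left_commute infsum_cmult_ennreal)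
qed

lemma cascade_cmult: "cascade bs (\<lambda>I J. c * x I J) R S = c ^ (2 ^ length bs) * cascade bs x R S"
proof (induction bs arbitrary: R S)
  case (Cons b bs)
  have "cascade (b # bs) (\<lambda>I J. c * x I J) R S = cstep b (\<lambda>I J. c ^ (2 ^ length bs) * cascade bs x I J) R S"
  proof -
    have "cascade bs (\<lambda>I J. c * x I J) = (\<lambda>I J. c ^ (2 ^ length bs) * cascade bs x I J)"
      by (intro ext Cons.IH)
    then show ?thesis by simp
  qed
  then show ?case unfolding cstep_cmult by (simp add: power_mult[symmetric] mult.commute[of 2])
qed simp

lemma le_binsum: "x R S \<le> binsum x R S"
proof -
  have "x R S = (\<Sum>I\<in>{R}. \<Sum>J\<in>{S}. of_nat (mbinom R I * mbinom S J) * x I J)" by simp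
  also have "\<dots> \<le> (\<Sum>I\<in>{R}. \<Sum>J\<in>{..S}. of_nat (mbinom R I * mbinom S J) * x I J)"
    by (intro sum_mono sum_mono2) auto
  also have "\<dots> \<le> binsum x R S"
    unfolding binsum_def by (intro sum_mono2) auto
  finally show ?thesis .
qed

lemma infsum_square_le_cstep:
  "(\<Sum>\<^sub>\<infinity>N. ennreal (1 / mfact N) * (swap_if b x R (N + S))\<^sup>2) \<le> cstep b x R S"
  unfolding cstep_def by (intro infsum_mono_ennreal mult_left_mono power_mono le_binsum) auto

lemma binsum_square_le_cstep: "(binsum (swap_if b x) R S)\<^sup>2 \<le> cstep b x R S"
  using infsum_ge_term_ennreal[of 0 UNIV "\<lambda>N. ennreal (1 / mfact N) * (binsum (swap_if b x) R (N + S))\<^sup>2"]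
  by (simp add: cstep_def)

lemma square_le_cstep: "(swap_if b x R S)\<^sup>2 \<le> cstep b x R S"
  by (rule order_trans[OF power_mono[OF le_binsum] binsum_square_le_cstep]) auto

section \<open>Arrays of at most geometric growth\<close>

definition geometric_bound :: "(nat ^ 'n \<Rightarrow> nat ^ 'n \<Rightarrow> ennreal) \<Rightarrow> bool" where
  "geometric_bound x \<longleftrightarrow> (\<exists>K q. \<forall>R S. x R S \<le> ennreal K * ennreal q ^ (mabs R + mabs S))"

lemma geometric_bound_finite: "geometric_bound x \<Longrightarrow> x R S < \<infinity>"
  unfolding geometric_bound_def
  by (metis ennreal_less_top ennreal_mult_less_top infinity_ennreal_def order.strict_trans1 power_less_top_ennreal)

text \<open>By the binomial theorem \<open>binsum\<close> turns the rate \<open>q\<close> into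
  \<open>1 + q\<close>, the square squares it, and the sum over \<open>N\<close> costs only a finite
  factor because of the weights \<open>1 / mfact N\<close>.\<close>

lemma geometric_bound_cstep:
  fixes x :: "nat ^ 'n \<Rightarrow> nat ^ 'n \<Rightarrow> ennreal"
  assumes "geometric_bound x"
  shows "geometric_bound (cstep b x)"
proof -
  obtain K q where Kq: "\<And>R S. x R S \<le> ennreal K * ennreal q ^ (mabs R + mabs S)"
    using assms by (auto simp: geometric_bound_def)
  \<comment> \<open>A negative \<open>q\<close> denotes 0 in \<open>ennreal\<close>, whence the
    maximum.\<close>
  define q' where "q' = (1 + max q 0)\<^sup>2"
  have q'0: "q' \<ge> 0" by (simp add: q'_def)
  have q': "(1 + ennreal q)\<^sup>2 = ennreal q'"
    by (cases "q \<ge> 0") (auto simp: q'_def ennreal_power[symmetric] max_def ennreal_neg ennreal_plus)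
  define C where "C = infsum (\<lambda>N::nat ^ 'n. ennreal (1 / real (mfact N)) * ennreal q' ^ mabs N) UNIV"
  have "C < \<infinity>" unfolding C_def by (rule infsum_power_mabs_finite[OF q'0])
  have bs: "binsum (swap_if b x) R S \<le> ennreal K * (1 + ennreal q) ^ (mabs R + mabs S)" for R S
  proof -
    have "binsum (swap_if b x) R S \<le> binsum (\<lambda>I J. ennreal K * ennreal q ^ (mabs I + mabs J)) R S"
      unfolding swap_if_def using Kq by (intro binsum_mono) (metis add.commute)
    also have "\<dots> = (\<Sum>I\<in>{..R}. \<Sum>J\<in>{..S}. ennreal K *
        ((of_nat (mbinom R I) * ennreal q ^ mabs I) * (of_nat (mbinom S J) * ennreal q ^ mabs J)))"
      unfolding binsum_def by (intro sum.cong refl) (simp add: power_add mult_ac)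
    also have "\<dots> = ennreal K * ((\<Sum>I\<in>{..R}. of_nat (mbinom R I) * ennreal q ^ mabs I)
        * (\<Sum>J\<in>{..S}. of_nat (mbinom S J) * ennreal q ^ mabs J))"
      unfolding sum_product by (simp only: sum_distrib_left)
    finally show ?thesis by (simp add: sum_mbinom_power power_add)
  qed
  have "cstep b x R S \<le> ((ennreal K)\<^sup>2 * C) * ennreal q' ^ (mabs R + mabs S)" for R S
  proof -
    have "cstep b x R S \<le> (\<Sum>\<^sub>\<infinity>N. ennreal (1 / mfact N) * (ennreal K * (1 + ennreal q) ^ (mabs R + mabs (N + S)))\<^sup>2)"
      unfolding cstep_def by (intro infsum_mono_ennreal mult_left_mono power_mono bs) auto
    also have "\<dots> = (\<Sum>\<^sub>\<infinity>N::nat ^ 'n. ((ennreal K)\<^sup>2 * ennreal q' ^ (mabs R + mabs S)) * (ennreal (1 / mfact N) * ennreal q' ^ mabs N))"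
      by (intro infsum_cong)
         (simp add: q'[symmetric] power_mult_distrib power_mult[symmetric] power_add distrib_left mult_ac)
    also have "\<dots> = ((ennreal K)\<^sup>2 * ennreal q' ^ (mabs R + mabs S)) * C"
      by (simp only: infsum_cmult_ennreal C_def)
    finally show ?thesis by (simp add: mult_ac)
  qed
  moreover have "(ennreal K)\<^sup>2 * C < top"
    using \<open>C < \<infinity>\<close> by (auto simp: ennreal_mult_less_top power_less_top_ennreal)
  then obtain K' where "(ennreal K)\<^sup>2 * C = ennreal K'" by (cases "(ennreal K)\<^sup>2 * C") auto
  ultimately show ?thesis unfolding geometric_bound_def by metis
qed

lemma geometric_bound_cascade: "geometric_bound x \<Longrightarrow> geometric_bound (cascade bs x)"
  by (induction bs) (auto intro: geometric_bound_cstep)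

text \<open>Dominated convergence at each level in turn. It is used for the tails of the star
  series, with the full sums as majorants.\<close>

lemma cascade_tendsto_0:
  fixes x :: "'i \<Rightarrow> nat ^ 'n \<Rightarrow> nat ^ 'n \<Rightarrow> ennreal"
  assumes lim: "\<And>R S. ((\<lambda>i. x i R S) \<longlongrightarrow> 0) G"
    and le: "\<And>i R S. x i R S \<le> y R S"
    and fin: "\<And>R S. cascade bs y R S < \<infinity>"
  shows "((\<lambda>i. cascade bs (x i) R S) \<longlongrightarrow> 0) G"
  using fin
proof (induction bs arbitrary: R S)
  case (Cons b bs)
  \<comment> \<open>The square of an inner value is bounded by the outer level, so finiteness passes
    inwards. At a swapping level the two indices have to be exchanged beforehand.\<close>
  have fin': "cascade bs y R S < \<infinity>" for R S
  proof -
    have "(cascade bs y R S)\<^sup>2 \<le> cascade (b # bs) y (if b then S else R) (if b then R else S)"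
      using square_le_cstep[of b "cascade bs y" "if b then S else R" "if b then R else S"]
      by (auto simp: swap_if_def split: if_splits)
    then have "(cascade bs y R S)\<^sup>2 < \<infinity>" using Cons.prems order.strict_trans1 by blast
    then show ?thesis by (auto simp: power2_eq_square less_top[symmetric])
  qed
  have IH: "((\<lambda>i. cascade bs (x i) R S) \<longlongrightarrow> 0) G" for R S
    by (rule Cons.IH[OF fin'])
  show ?case unfolding cascade.simps cstep_def
  proof (rule tendsto_infsum_dominated_ennreal)
    show "ennreal (1 / mfact N) * (binsum (swap_if b (cascade bs (x i))) R (N + S))\<^sup>2
      \<le> ennreal (1 / mfact N) * (binsum (swap_if b (cascade bs y)) R (N + S))\<^sup>2" for i N
      by (intro mult_left_mono power_mono binsum_mono) (auto simp: swap_if_def intro!: cascade_mono le)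
    show "(\<Sum>\<^sub>\<infinity>N. ennreal (1 / mfact N) * (binsum (swap_if b (cascade bs y)) R (N + S))\<^sup>2) < \<infinity>"
      using Cons.prems[of R S] by (simp add: cstep_def)
    fix N
    have sw: "((\<lambda>i. swap_if b (cascade bs (x i)) I J) \<longlongrightarrow> 0) G" for I J
      by (cases b) (simp_all add: swap_if_def IH)
    have "((\<lambda>i. binsum (swap_if b (cascade bs (x i))) R (N + S)) \<longlongrightarrow>
        (\<Sum>I\<in>{..R}. \<Sum>J\<in>{..N + S}. of_nat (mbinom R I * mbinom (N + S) J) * 0)) G"
      unfolding binsum_def
      by (intro tendsto_sum ennreal_tendsto_cmult)
         (auto simp: sw of_nat_less_top simp del: of_nat_mult)
    then have l: "((\<lambda>i. binsum (swap_if b (cascade bs (x i))) R (N + S)) \<longlongrightarrow> 0) G" by simp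
    have "((\<lambda>i. (binsum (swap_if b (cascade bs (x i))) R (N + S))\<^sup>2) \<longlongrightarrow> 0 * 0) G"
      unfolding power2_eq_square by (intro tendsto_mult_ennreal l) auto
    then have "((\<lambda>i. ennreal (1 / mfact N) * (binsum (swap_if b (cascade bs (x i))) R (N + S))\<^sup>2) \<longlongrightarrow> ennreal (1 / mfact N) * 0) G"
      by (intro ennreal_tendsto_cmult) auto
    then show "((\<lambda>i. ennreal (1 / mfact N) * (binsum (swap_if b (cascade bs (x i))) R (N + S))\<^sup>2) \<longlongrightarrow> 0) G" by simp
  qed
qed (use lim in simp)

section \<open>Arrays of Taylor coefficients\<close>

type_synonym 'n midx2 = "(nat ^ 'n) \<times> (nat ^ 'n)"

text \<open>For \<open>F = UNIV\<close> this is \<open>h\<^sub>0\<close> in the rescaled coordinates; general \<open>F\<close> serves for the tails of the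
  star series.\<close>

definition hsum :: "(nat ^ 'n::finite) set \<Rightarrow> ('n midx2 \<Rightarrow> complex) \<Rightarrow> nat ^ 'n \<Rightarrow> nat ^ 'n \<Rightarrow> ennreal" where
  "hsum F a R S = (\<Sum>\<^sub>\<infinity>N\<in>F. ennreal (1 / mfact N) * ennreal ((cmod (a (R, N + S)))\<^sup>2))"

abbreviation hcasc :: "bool list \<Rightarrow> ('n::finite midx2 \<Rightarrow> complex) \<Rightarrow> nat ^ 'n \<Rightarrow> nat ^ 'n \<Rightarrow> ennreal" where
  "hcasc bs a \<equiv> cascade bs (hsum UNIV a)"

text \<open>All lists of bits amount to all pairs of \<open>m\<close> and \<open>l < 2 ^ m\<close>,
  by \<open>index_bits_surj\<close>.\<close>

definition wick_arrays :: "('n::finite midx2 \<Rightarrow> complex) set" where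
  "wick_arrays = {a. \<forall>bs R S. hcasc bs a R S < \<infinity>}"

lemma wick_arraysD: "a \<in> wick_arrays \<Longrightarrow> hcasc bs a R S < \<infinity>"
  by (simp add: wick_arrays_def)

lemma hsum_mono: "(\<And>T. cmod (a T) \<le> cmod (b T)) \<Longrightarrow> hsum F a R S \<le> hsum F b R S"
  unfolding hsum_def by (intro infsum_mono_ennreal mult_left_mono ennreal_leI power_mono) auto

lemma hsum_mono_set: "hsum F a R S \<le> hsum UNIV a R S"
  unfolding hsum_def by (rule infsum_mono_neutral) auto

lemma hcasc_mono: "(\<And>T. cmod (a T) \<le> cmod (b T)) \<Longrightarrow> hcasc bs a R S \<le> hcasc bs b R S"
  by (intro cascade_mono hsum_mono)

lemma wick_arrays_mono: "(\<And>T. cmod (a T) \<le> cmod (b T)) \<Longrightarrow> b \<in> wick_arrays \<Longrightarrow> a \<in> wick_arrays"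
  unfolding wick_arrays_def using hcasc_mono[of a b] le_less_trans by blast

lemma hsum_cmult: "hsum F (\<lambda>T. c * a T) R S = ennreal ((cmod c)\<^sup>2) * hsum F a R S"
  unfolding hsum_def infsum_cmult_ennreal[symmetric]
  by (intro infsum_cong) (simp add: norm_mult power_mult_distrib ennreal_mult mult_ac)

lemma hcasc_cmult:
  "hcasc bs (\<lambda>T. c * a T) R S = ennreal (cmod c) ^ (2 ^ (length bs + 1)) * hcasc bs a R S"
proof -
  have "hsum UNIV (\<lambda>T. c * a T) = (\<lambda>R S. ennreal ((cmod c)\<^sup>2) * hsum UNIV a R S)"
    by (intro ext hsum_cmult)
  then show ?thesis
    by (simp add: cascade_cmult ennreal_power[symmetric] power_mult[symmetric])
qed

lemma hsum_convex:
  assumes "0 \<le> s" "0 \<le> t" "s + t = (1::real)"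
  shows "hsum F (\<lambda>T. of_real s * a T + of_real t * b T) R S \<le> ennreal s * hsum F a R S + ennreal t * hsum F b R S"
proof -
  have c: "ennreal ((cmod (of_real s * u + of_real t * v))\<^sup>2) \<le> ennreal s * ennreal ((cmod u)\<^sup>2) + ennreal t * ennreal ((cmod v)\<^sup>2)"
    for u v :: complex
  proof -
    have "cmod (of_real s * u + of_real t * v) \<le> s * cmod u + t * cmod v"
      using norm_triangle_ineq[of "of_real s * u" "of_real t * v"] assms by (simp add: norm_mult)
    then have "(cmod (of_real s * u + of_real t * v))\<^sup>2 \<le> (s * cmod u + t * cmod v)\<^sup>2"
      by (rule power_mono) simp
    also have "\<dots> \<le> s * (cmod u)\<^sup>2 + t * (cmod v)\<^sup>2"
    proof -
      have "t = 1 - s" using assms by simp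
      then have "s * (cmod u)\<^sup>2 + t * (cmod v)\<^sup>2 - (s * cmod u + t * cmod v)\<^sup>2 = s * t * (cmod u - cmod v)\<^sup>2"
        by algebra
      moreover have "\<dots> \<ge> 0" using assms by simp
      ultimately show ?thesis by linarith
    qed
    finally show ?thesis
      using assms by (simp add: ennreal_mult[symmetric] ennreal_plus[symmetric] ennreal_leI del: ennreal_plus)
  qed
  have "hsum F (\<lambda>T. of_real s * a T + of_real t * b T) R S
      \<le> (\<Sum>\<^sub>\<infinity>N\<in>F. ennreal (1 / mfact N) * (ennreal s * ennreal ((cmod (a (R, N + S)))\<^sup>2) + ennreal t * ennreal ((cmod (b (R, N + S)))\<^sup>2)))"
    unfolding hsum_def by (intro infsum_mono_ennreal mult_left_mono c) auto
  also have "\<dots> = (\<Sum>\<^sub>\<infinity>N\<in>F. ennreal s * (ennreal (1 / mfact N) * ennreal ((cmod (a (R, N + S)))\<^sup>2))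
      + ennreal t * (ennreal (1 / mfact N) * ennreal ((cmod (b (R, N + S)))\<^sup>2)))"
    by (intro infsum_cong) (simp add: distrib_left mult_ac)
  also have "\<dots> = ennreal s * hsum F a R S + ennreal t * hsum F b R S"
    by (simp only: infsum_add[OF summable_ennreal summable_ennreal] infsum_cmult_ennreal hsum_def)
  finally show ?thesis .
qed

lemma hcasc_convex:
  assumes "0 \<le> s" "0 \<le> t" "s + t = (1::real)"
  shows "hcasc bs (\<lambda>T. of_real s * a T + of_real t * b T) R S \<le> ennreal s * hcasc bs a R S + ennreal t * hcasc bs b R S"
proof -
  have st: "ennreal s + ennreal t = 1"
    using assms by (simp add: ennreal_plus[symmetric] del: ennreal_plus)
  show ?thesis
    by (rule order_trans[OF cascade_mono[OF hsum_convex[OF assms]] cascade_convex[OF st]])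
qed

text \<open>Gauge argument: divided by \<alpha> and \<beta>, both arrays have functionals below 1;
  so has their convex combination with weights proportional to \<alpha> and \<beta>, and homogeneity
  of degree \<open>2 ^ (length bs + 1)\<close> scales it back. Strict bounds by powers express the
  triangle inequality for open balls without roots.\<close>

lemma hcasc_triangle:
  assumes "0 < \<alpha>" "0 < \<beta>"
    and "hcasc bs a R S < ennreal (\<alpha> ^ (2 ^ (length bs + 1)))"
    and "hcasc bs b R S < ennreal (\<beta> ^ (2 ^ (length bs + 1)))"
  shows "hcasc bs (\<lambda>T. a T + b T) R S < ennreal ((\<alpha> + \<beta>) ^ (2 ^ (length bs + 1)))"
proof -
  define d :: nat where "d = 2 ^ (length bs + 1)"
  define s t where "s = \<alpha> / (\<alpha> + \<beta>)" and "t = \<beta> / (\<alpha> + \<beta>)"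
  have st: "0 < s" "0 < t" "s + t = 1" using assms by (auto simp: s_def t_def add_divide_distrib[symmetric])
  have small: "hcasc bs (\<lambda>T. of_real (1 / c) * a T) R S < 1"
    if "0 < c" "hcasc bs a R S < ennreal (c ^ d)" for c a
  proof -
    have "hcasc bs (\<lambda>T. of_real (1 / c) * a T) R S = ennreal (1 / c) ^ d * hcasc bs a R S"
      using that by (subst hcasc_cmult) (simp add: d_def norm_divide)
    also have "\<dots> < ennreal (1 / c) ^ d * ennreal (c ^ d)"
      using that by (intro ennreal_mult_strict_left_mono) (auto simp: ennreal_power)
    also have "\<dots> = 1"
      using that by (simp add: ennreal_power ennreal_mult[symmetric] power_mult_distrib[symmetric])
    finally show ?thesis .
  qed
  define a' b' where "a' = (\<lambda>T. of_real (1 / \<alpha>) * a T)" and "b' = (\<lambda>T. of_real (1 / \<beta>) * b T)"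
  have a': "hcasc bs a' R S < 1" and b': "hcasc bs b' R S < 1"
    unfolding a'_def b'_def using assms by (intro small; simp only: d_def)+
  have "hcasc bs (\<lambda>T. of_real s * a' T + of_real t * b' T) R S \<le> ennreal s * hcasc bs a' R S + ennreal t * hcasc bs b' R S"
    using st by (intro hcasc_convex) auto
  also have "\<dots> < 1"
  proof -
    obtain u v where uv: "hcasc bs a' R S = ennreal u" "hcasc bs b' R S = ennreal v" "0 \<le> u" "0 \<le> v"
      using a' b' by (metis ennreal_cases ennreal_one_less_top order.strict_trans less_irrefl)
    have "u < 1" "v < 1" using a' b' uv by (auto simp: ennreal_less_one_iff)
    then have "s * u < s" "t * v < t" using st by auto
    then have "s * u + t * v < 1" using st by linarith
    then show ?thesis using st uv
      by (simp add: ennreal_mult[symmetric] ennreal_plus[symmetric] ennreal_less_one_iff del: ennreal_plus)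
  qed
  finally have l: "hcasc bs (\<lambda>T. of_real s * a' T + of_real t * b' T) R S < 1" .
  have "(\<lambda>T. a T + b T) = (\<lambda>T. of_real (\<alpha> + \<beta>) * (of_real s * a' T + of_real t * b' T))"
  proof
    fix T
    have "of_real (\<alpha> + \<beta>) * (of_real s * a' T + of_real t * b' T) =
        of_real ((\<alpha> + \<beta>) * s / \<alpha>) * a T + of_real ((\<alpha> + \<beta>) * t / \<beta>) * b T"
      using assms by (simp add: a'_def b'_def algebra_simps)
    also have "\<dots> = a T + b T" using assms by (simp add: s_def t_def)
    finally show "a T + b T = of_real (\<alpha> + \<beta>) * (of_real s * a' T + of_real t * b' T)" ..
  qed
  then have "hcasc bs (\<lambda>T. a T + b T) R S =
      ennreal (\<alpha> + \<beta>) ^ d * hcasc bs (\<lambda>T. of_real s * a' T + of_real t * b' T) R S"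
    using assms by (simp only: hcasc_cmult) (simp add: d_def del: ennreal_plus of_real_add)
  also have "\<dots> < ennreal (\<alpha> + \<beta>) ^ d * 1"
    using assms l by (intro ennreal_mult_strict_left_mono) (auto simp: ennreal_power simp del: ennreal_plus)
  finally show ?thesis using assms by (simp add: d_def ennreal_power del: ennreal_plus)
qed

definition ehalf :: ennreal where
  "ehalf = ennreal (1 / 2)"

lemma ehalf_add: "ehalf + ehalf = 1"
  by (simp add: ehalf_def ennreal_plus[symmetric] del: ennreal_plus ennreal_half)

lemma ehalf_le: "ehalf * x \<le> x"
  using mult_right_mono[of ehalf 1 x] by (simp add: ehalf_def del: ennreal_half)

lemma ehalf_ennreal: "0 \<le> r \<Longrightarrow> ehalf * ennreal r = ennreal (r / 2)"
  by (simp add: ehalf_def ennreal_mult[symmetric] del: ennreal_half)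

lemma ehalf_less_top [simp]: "ehalf < top" "ehalf \<noteq> top" "ehalf \<noteq> 0"
  by (simp_all add: ehalf_def del: ennreal_half)

lemma wick_arrays_cmult: "a \<in> wick_arrays \<Longrightarrow> (\<lambda>T. c * a T) \<in> wick_arrays"
  by (simp add: wick_arrays_def hcasc_cmult ennreal_mult_less_top power_less_top_ennreal del: power_Suc)

lemma wick_arrays_add:
  assumes "a \<in> wick_arrays" "b \<in> wick_arrays"
  shows "(\<lambda>T. a T + b T) \<in> wick_arrays"
proof -
  have "hcasc bs (\<lambda>T. a T + b T) R S < \<infinity>" for bs R S
  proof -
    \<comment> \<open>The sum is the mean of the doubled summands, to which convexity
      applies.\<close>
    have "hcasc bs (\<lambda>T. of_real (1/2) * (2 * a T) + of_real (1/2) * (2 * b T)) R S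
        \<le> ehalf * hcasc bs (\<lambda>T. 2 * a T) R S + ehalf * hcasc bs (\<lambda>T. 2 * b T) R S"
      unfolding ehalf_def by (intro hcasc_convex) auto
    also have "\<dots> < \<infinity>"
      using wick_arraysD[OF wick_arrays_cmult[OF assms(1), of 2], of bs R S]
        wick_arraysD[OF wick_arrays_cmult[OF assms(2), of 2], of bs R S]
      by (simp add: ennreal_mult_less_top)
    finally show ?thesis by simp
  qed
  then show ?thesis by (simp add: wick_arrays_def)
qed

lemma wick_arrays_diff:
  "a \<in> wick_arrays \<Longrightarrow> b \<in> wick_arrays \<Longrightarrow> (\<lambda>T. a T - b T) \<in> wick_arrays"
  using wick_arrays_add[of a "\<lambda>T. (- 1) * b T"] wick_arrays_cmult[of b "- 1"] by simp

lemma hcasc_0: "hcasc bs (\<lambda>T. 0) R S = 0"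
  using hcasc_cmult[of bs 0 "\<lambda>T. 0" R S] by (simp add: power_0_left)

lemma wick_arrays_0: "(\<lambda>T. 0) \<in> wick_arrays"
  by (simp add: wick_arrays_def hcasc_0)

text \<open>The weights \<open>1 / mfact N\<close> absorb the squared powers of \<open>q\<close>, so
  \<open>hsum\<close> is again geometrically bounded and \<open>geometric_bound_cascade\<close>
  applies. This covers the Taylor arrays of exponentials.\<close>

lemma wick_arrays_geometric:
  fixes a :: "'n::finite midx2 \<Rightarrow> complex"
  assumes "\<And>R S. cmod (a (R, S)) \<le> K * q ^ (mabs R + mabs S)" "K \<ge> 0" "q \<ge> 0"
  shows "a \<in> wick_arrays"
proof -
  define C where "C = infsum (\<lambda>N::nat ^ 'n. ennreal (1 / real (mfact N)) * ennreal (q\<^sup>2) ^ mabs N) UNIV"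
  have "C < \<infinity>" unfolding C_def by (rule infsum_power_mabs_finite) auto
  have "hsum UNIV a R S \<le> (ennreal (K\<^sup>2) * C) * ennreal (q\<^sup>2) ^ (mabs R + mabs S)" for R S
  proof -
    have "ennreal ((cmod (a (R, N + S)))\<^sup>2) \<le> ennreal (K\<^sup>2) * ennreal (q\<^sup>2) ^ (mabs R + mabs S) * ennreal (q\<^sup>2) ^ mabs N" for N
    proof -
      have "(cmod (a (R, N + S)))\<^sup>2 \<le> (K * q ^ (mabs R + mabs (N + S)))\<^sup>2"
        by (intro power_mono assms) auto
      also have "\<dots> = K\<^sup>2 * (q\<^sup>2) ^ (mabs R + mabs S) * (q\<^sup>2) ^ mabs N"
        by (simp add: power_mult_distrib power_add power_mult[symmetric] mult_ac)
      finally show ?thesis using assms by (simp add: ennreal_power ennreal_mult[symmetric] ennreal_leI)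
    qed
    then have "hsum UNIV a R S \<le> (\<Sum>\<^sub>\<infinity>N::nat ^ 'n. ennreal (1 / mfact N) * (ennreal (K\<^sup>2) * ennreal (q\<^sup>2) ^ (mabs R + mabs S) * ennreal (q\<^sup>2) ^ mabs N))"
      unfolding hsum_def by (intro infsum_mono_ennreal mult_left_mono) auto
    also have "\<dots> = (\<Sum>\<^sub>\<infinity>N::nat ^ 'n. (ennreal (K\<^sup>2) * ennreal (q\<^sup>2) ^ (mabs R + mabs S)) * (ennreal (1 / mfact N) * ennreal (q\<^sup>2) ^ mabs N))"
      by (intro infsum_cong) (simp add: mult_ac)
    also have "\<dots> = (ennreal (K\<^sup>2) * C) * ennreal (q\<^sup>2) ^ (mabs R + mabs S)"
      unfolding infsum_cmult_ennreal C_def by (simp add: mult_ac)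
    finally show ?thesis .
  qed
  moreover have "ennreal (K\<^sup>2) * C < top"
    using \<open>C < \<infinity>\<close> by (auto simp: ennreal_mult_less_top)
  then obtain K' where "ennreal (K\<^sup>2) * C = ennreal K'" by (cases "ennreal (K\<^sup>2) * C") auto
  ultimately have "geometric_bound (hsum UNIV a)"
    unfolding geometric_bound_def by metis
  then show ?thesis
    by (auto simp: wick_arrays_def intro: geometric_bound_finite geometric_bound_cascade simp del: infinity_ennreal_def)
qed

section \<open>Complex conjugation\<close>

definition conj_array :: "('n::finite midx2 \<Rightarrow> complex) \<Rightarrow> 'n midx2 \<Rightarrow> complex" where
  "conj_array a = (\<lambda>(R, S). cnj (a (S, R)))"

lemma ennreal_le_half_1_plus_square: "x \<le> ehalf * 1 + ehalf * x\<^sup>2"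
proof (cases x)
  case (real r)
  have "0 \<le> (r - 1)\<^sup>2" by simp
  then have "r \<le> 1/2 + 1/2 * r\<^sup>2" by (simp add: power2_eq_square algebra_simps)
  then have "ennreal r \<le> ennreal (1/2 + r\<^sup>2/2)" by (intro ennreal_leI) simp
  also have "\<dots> = ennreal (1/2) + ennreal (r\<^sup>2/2)" by (rule ennreal_plus) auto
  also have "\<dots> = ehalf * 1 + ehalf * (ennreal r)\<^sup>2"
    using real by (simp add: ennreal_power ehalf_ennreal) (simp add: ehalf_def)
  finally show ?thesis using real by simp
qed (simp add: ennreal_mult_top power2_eq_square)

lemma square_le_hsum: "ennreal ((cmod (a (R, S)))\<^sup>2) \<le> hsum UNIV a R S"
  unfolding hsum_def
  using infsum_ge_term_ennreal[of 0 UNIV "\<lambda>N. ennreal (1 / mfact N) * ennreal ((cmod (a (R, N + S)))\<^sup>2)"] by simp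

text \<open>The sum in \<open>hsum\<close> runs over the second index, while conjugation demands one
  over the first. A swapping level inserted at the inner end supplies it, but with
  \<open>hsum\<close> squared. Linearising by \<open>x <= 1/2 + x^2/2\<close> makes up for this, and
  the summands \<open>1/2\<close> lead to a constant array whose cascade is \<open>C\<close>. It
  matters that \<open>C\<close> is the same for all arrays.\<close>

lemma hcasc_conj_array:
  fixes R S :: "nat ^ 'n"
  obtains C where "C < \<infinity>" "\<And>a. hcasc bs (conj_array a) R S \<le> C + hcasc (bs @ [True]) a R S"
proof -
  define E where "E = infsum (\<lambda>N::nat ^ 'n. ennreal (1 / real (mfact N)) * ennreal 1 ^ mabs N) UNIV"
  have E: "E < \<infinity>" unfolding E_def by (rule infsum_power_mabs_finite) auto
  define C where "C = cascade bs (\<lambda>R S. E) R S"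
  have "geometric_bound (\<lambda>(R::nat ^ 'n) (S::nat ^ 'n). E)"
    unfolding geometric_bound_def
    using E by (intro exI[of _ "enn2real E"] exI[of _ 1]) (simp add: ennreal_enn2real_if less_top)
  then have C: "C < \<infinity>" unfolding C_def by (intro geometric_bound_finite geometric_bound_cascade)
  have h: "hsum UNIV (conj_array a) R S \<le> ehalf * E + ehalf * cstep True (hsum UNIV a) R S" for a :: "'n midx2 \<Rightarrow> complex" and R S
  proof -
    have t: "ennreal (1 / mfact N) * ennreal ((cmod (conj_array a (R, N + S)))\<^sup>2)
        \<le> ehalf * (ennreal (1 / mfact N) * ennreal 1 ^ mabs N) + ehalf * (ennreal (1 / mfact N) * (swap_if True (hsum UNIV a) R (N + S))\<^sup>2)" for N
    proof -
      have "ennreal ((cmod (conj_array a (R, N + S)))\<^sup>2) \<le> hsum UNIV a (N + S) R"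
        using square_le_hsum[of a "N + S" R] by (simp add: conj_array_def)
      also have "\<dots> \<le> ehalf * 1 + ehalf * (hsum UNIV a (N + S) R)\<^sup>2"
        by (rule ennreal_le_half_1_plus_square)
      finally have "ennreal (1 / mfact N) * ennreal ((cmod (conj_array a (R, N + S)))\<^sup>2)
          \<le> ennreal (1 / mfact N) * (ehalf * 1 + ehalf * (hsum UNIV a (N + S) R)\<^sup>2)"
        by (rule mult_left_mono) simp
      then show ?thesis by (simp add: swap_if_def distrib_left mult_ac)
    qed
    have "hsum UNIV (conj_array a) R S \<le> (\<Sum>\<^sub>\<infinity>N. ehalf * (ennreal (1 / mfact N) * ennreal 1 ^ mabs N)
        + ehalf * (ennreal (1 / mfact N) * (swap_if True (hsum UNIV a) R (N + S))\<^sup>2))"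
      unfolding hsum_def by (intro infsum_mono_ennreal t[unfolded hsum_def])
    also have "\<dots> = ehalf * E + ehalf * (\<Sum>\<^sub>\<infinity>N. ennreal (1 / mfact N) * (swap_if True (hsum UNIV a) R (N + S))\<^sup>2)"
      by (simp only: infsum_add[OF summable_ennreal summable_ennreal] infsum_cmult_ennreal E_def)
    also have "\<dots> \<le> ehalf * E + ehalf * cstep True (hsum UNIV a) R S"
      by (intro add_left_mono mult_left_mono infsum_square_le_cstep) auto
    finally show ?thesis .
  qed
  have st: "ehalf + ehalf = 1"
    by (rule ehalf_add)
  note half = ehalf_le
  have "hcasc bs (conj_array a) R S \<le> C + hcasc (bs @ [True]) a R S" for a
  proof -
    have "hcasc bs (conj_array a) R S \<le> ehalf * C + ehalf * cascade bs (cstep True (hsum UNIV a)) R S"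
      unfolding C_def by (rule order_trans[OF cascade_mono[OF h] cascade_convex[OF st]])
    also have "\<dots> \<le> C + cascade bs (cstep True (hsum UNIV a)) R S"
      by (intro add_mono half)
    finally show ?thesis by (simp add: cascade_append)
  qed
  with C show ?thesis by (rule that)
qed

lemma wick_arrays_conj:
  assumes "a \<in> wick_arrays"
  shows "conj_array a \<in> wick_arrays"
  unfolding wick_arrays_def
proof safe
  fix bs R S
  obtain C where C: "C < \<infinity>" "hcasc bs (conj_array a) R S \<le> C + hcasc (bs @ [True]) a R S"
    by (metis hcasc_conj_array)
  have "C + hcasc (bs @ [True]) a R S < \<infinity>"
    using C(1) wick_arraysD[OF assms, of "bs @ [True]" R S] by simp
  then show "hcasc bs (conj_array a) R S < \<infinity>" using C(2) by (rule le_less_trans[rotated])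
qed

section \<open>The star product of arrays and its tails\<close>

definition conv_array :: "('n::finite midx2 \<Rightarrow> complex) \<Rightarrow> ('n midx2 \<Rightarrow> complex) \<Rightarrow> 'n midx2 \<Rightarrow> complex" where
  "conv_array a b = (\<lambda>(R, S). \<Sum>I\<in>{..R}. \<Sum>J\<in>{..S}.
     of_nat (mbinom R I * mbinom S J) * (a (I, J) * b (R - I, S - J)))"

text \<open>The \<open>N\<close>-th term of the star series, with the pointwise product of functions expressed as
  binomial convolution of arrays.\<close>

definition star_term :: "('n::finite midx2 \<Rightarrow> complex) \<Rightarrow> ('n midx2 \<Rightarrow> complex) \<Rightarrow> nat ^ 'n \<Rightarrow> 'n midx2 \<Rightarrow> complex" where
  "star_term a b N T = of_real (1 / mfact N) * conv_array (\<lambda>T. a (T + (N, 0))) (\<lambda>T. b (T + (0, N))) T"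

definition star_array :: "(nat ^ 'n) set \<Rightarrow> ('n::finite midx2 \<Rightarrow> complex) \<Rightarrow> ('n midx2 \<Rightarrow> complex) \<Rightarrow> 'n midx2 \<Rightarrow> complex" where
  "star_array F a b T = (\<Sum>\<^sub>\<infinity>N\<in>F. star_term a b N T)"

text \<open>Half the sum of squares separates the factors \<open>a (N + I, J)\<close> and
  \<open>b (R - I, N + S - J)\<close>. Summed over \<open>N\<close>, the square of \<open>b\<close>
  gives \<open>hsum\<close>; that of \<open>a\<close>, where \<open>N\<close> sits in the first
  index, gives \<open>hsum\<close> of the conjugate array. The Leibniz coefficients turn both into
  \<open>binsum\<close>, which is the inner sum in the recursion for \<open>h\<close>.\<close>

lemma infsum_star_term_le:
  "(\<Sum>\<^sub>\<infinity>N\<in>F. ennreal (cmod (star_term a b N (R, S)))) \<le>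
     ehalf * binsum (swap_if True (hsum F (conj_array a))) R S + ehalf * binsum (hsum F b) R S"
proof -
  define ca cb where "ca = (\<lambda>I J N. ennreal (1 / mfact N) * ennreal ((cmod (a (N + I, J)))\<^sup>2))"
    and "cb = (\<lambda>I J N. ennreal (1 / mfact N) * ennreal ((cmod (b (I, N + J)))\<^sup>2))"
  have ha: "infsum (ca I J) F = hsum F (conj_array a) J I" for I J
    by (simp add: ca_def hsum_def conj_array_def)
  have hb: "infsum (cb I J) F = hsum F b I J" for I J
    by (simp add: cb_def hsum_def)
  have am: "ennreal (x * y) \<le> ehalf * ennreal (x\<^sup>2) + ehalf * ennreal (y\<^sup>2)" for x y :: real
  proof -
    have "0 \<le> (x - y)\<^sup>2" by simp
    then have "x * y \<le> x\<^sup>2 / 2 + y\<^sup>2 / 2" by (simp add: power2_eq_square algebra_simps)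
    then show ?thesis
      by (simp add: ehalf_ennreal ennreal_plus[symmetric] ennreal_leI del: ennreal_plus)
  qed
  have t: "ennreal (cmod (star_term a b N (R, S))) \<le>
     (\<Sum>I\<in>{..R}. \<Sum>J\<in>{..S}. of_nat (mbinom R I * mbinom S J) *
        (ehalf * ca I J N + ehalf * cb (R - I) (S - J) N))" for N
  proof -
    have "cmod (star_term a b N (R, S)) \<le> 1 / mfact N * (\<Sum>I\<in>{..R}. \<Sum>J\<in>{..S}.
        real (mbinom R I * mbinom S J) * (cmod (a (N + I, J)) * cmod (b (R - I, N + (S - J)))))"
      unfolding star_term_def conv_array_def norm_mult prod.case
      by (intro mult_mono order_trans[OF norm_sum] sum_mono)
         (auto simp: norm_mult norm_divide add.commute intro!: order_trans[OF norm_sum] sum_mono sum_nonneg)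
    also have "\<dots> = (\<Sum>I\<in>{..R}. \<Sum>J\<in>{..S}.
        real (mbinom R I * mbinom S J) * (1 / mfact N * (cmod (a (N + I, J)) * cmod (b (R - I, N + (S - J))))))"
      by (simp only: sum_distrib_left mult.left_commute)
    finally have "ennreal (cmod (star_term a b N (R, S))) \<le> ennreal (\<Sum>I\<in>{..R}. \<Sum>J\<in>{..S}.
        real (mbinom R I * mbinom S J) * (1 / mfact N * (cmod (a (N + I, J)) * cmod (b (R - I, N + (S - J))))))"
      by (rule ennreal_leI)
    also have "\<dots> = (\<Sum>I\<in>{..R}. \<Sum>J\<in>{..S}.
        of_nat (mbinom R I * mbinom S J) * (ennreal (1 / mfact N) * ennreal (cmod (a (N + I, J)) * cmod (b (R - I, N + (S - J))))))"
      by (subst sum_ennreal[symmetric], force intro!: sum_nonneg, intro sum.cong refl,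
          subst sum_ennreal[symmetric], force, intro sum.cong refl)
         (simp add: ennreal_mult[symmetric] ennreal_of_nat_eq_real_of_nat del: of_nat_mult)
    also have "\<dots> \<le> (\<Sum>I\<in>{..R}. \<Sum>J\<in>{..S}. of_nat (mbinom R I * mbinom S J) *
        (ennreal (1 / mfact N) * (ehalf * ennreal ((cmod (a (N + I, J)))\<^sup>2)
          + ehalf * ennreal ((cmod (b (R - I, N + (S - J))))\<^sup>2))))"
      by (intro sum_mono mult_left_mono am) auto
    also have "\<dots> = (\<Sum>I\<in>{..R}. \<Sum>J\<in>{..S}. of_nat (mbinom R I * mbinom S J) *
        (ehalf * ca I J N + ehalf * cb (R - I) (S - J) N))"
      by (intro sum.cong refl) (simp add: ca_def cb_def distrib_left mult_ac)
    finally show ?thesis .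
  qed
  have "(\<Sum>\<^sub>\<infinity>N\<in>F. ennreal (cmod (star_term a b N (R, S)))) \<le>
    (\<Sum>\<^sub>\<infinity>N\<in>F. (\<Sum>I\<in>{..R}. \<Sum>J\<in>{..S}. of_nat (mbinom R I * mbinom S J) *
        (ehalf * ca I J N + ehalf * cb (R - I) (S - J) N)))"
    by (intro infsum_mono_ennreal t)
  also have "\<dots> = (\<Sum>I\<in>{..R}. \<Sum>J\<in>{..S}. of_nat (mbinom R I * mbinom S J) *
        (ehalf * hsum F (conj_array a) J I + ehalf * hsum F b (R - I) (S - J)))"
    by (simp only: infsum_sum_ennreal finite_atMost_vec infsum_cmult_ennreal
        infsum_add[OF summable_ennreal summable_ennreal] ha hb)
  also have "\<dots> = ehalf * (\<Sum>I\<in>{..R}. \<Sum>J\<in>{..S}. of_nat (mbinom R I * mbinom S J) * hsum F (conj_array a) J I)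
     + ehalf * (\<Sum>I\<in>{..R}. \<Sum>J\<in>{..S}. of_nat (mbinom R I * mbinom S J) * hsum F b (R - I) (S - J))"
    unfolding sum_distrib_left sum.distrib[symmetric]
    by (intro sum.cong refl) (simp add: distrib_left mult_ac)
  \<comment> \<open>The reflections of \<open>I\<close> in \<open>R\<close> and of \<open>J\<close>
    in \<open>S\<close> leave the binomial coefficients unchanged.\<close>
  also have "(\<Sum>I\<in>{..R}. \<Sum>J\<in>{..S}. of_nat (mbinom R I * mbinom S J) * hsum F b (R - I) (S - J)) = binsum (hsum F b) R S"
  proof -
    have "(\<Sum>I\<in>{..R}. \<Sum>J\<in>{..S}. of_nat (mbinom R I * mbinom S J) * hsum F b (R - I) (S - J)) =
      (\<Sum>I\<in>{..R}. \<Sum>J\<in>{..S}. of_nat (mbinom R (R - I) * mbinom S (S - J)) * hsum F b (R - I) (S - J))"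
      by (intro sum.cong refl) (simp add: mbinom_diff)
    also have "\<dots> = (\<Sum>I\<in>{..R}. \<Sum>J\<in>{..S}. of_nat (mbinom R (R - I) * mbinom S J) * hsum F b (R - I) J)"
      by (rule sum.cong[OF refl], rule sum_atMost_vec_reflect)
    also have "\<dots> = binsum (hsum F b) R S"
      unfolding binsum_def
      by (rule sum_atMost_vec_reflect[of "\<lambda>I. \<Sum>J\<in>{..S}. of_nat (mbinom R I * mbinom S J) * hsum F b I J"])
    finally show ?thesis .
  qed
  also have "(\<Sum>I\<in>{..R}. \<Sum>J\<in>{..S}. of_nat (mbinom R I * mbinom S J) * hsum F (conj_array a) J I)
      = binsum (swap_if True (hsum F (conj_array a))) R S"
    by (simp add: binsum_def swap_if_def)
  finally show ?thesis .
qed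

text \<open>Squaring the bound for the coefficients and summing with weights
  \<open>1 / mfact N\<close> is one more level of the recursion, and convexity of the square keeps
  the factors apart. The level swaps for the left factor, which enters through its conjugate
  array.\<close>

lemma hcasc_star_array:
  "hcasc bs (star_array F a b) R S \<le>
     cascade (bs @ [True]) (hsum F (conj_array a)) R S + cascade (bs @ [False]) (hsum F b) R S"
proof -
  have st: "ehalf + ehalf = 1"
    by (rule ehalf_add)
  note half = ehalf_le
  have h: "hsum UNIV (star_array F a b) R S \<le>
      ehalf * cstep True (hsum F (conj_array a)) R S + ehalf * cstep False (hsum F b) R S" for R S
  proof -
    have sw: "swap_if False (hsum F b) = hsum F b" by (simp add: swap_if_def fun_eq_iff)
    have "ennreal ((cmod (star_array F a b (R, S')))\<^sup>2) \<le>
      ehalf * (binsum (swap_if True (hsum F (conj_array a))) R S')\<^sup>2 + ehalf * (binsum (swap_if False (hsum F b)) R S')\<^sup>2" for S'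
    proof -
      have "ennreal ((cmod (star_array F a b (R, S')))\<^sup>2) = (ennreal (cmod (star_array F a b (R, S'))))\<^sup>2"
        by (simp add: ennreal_power)
      also have "\<dots> \<le> (ehalf * binsum (swap_if True (hsum F (conj_array a))) R S' + ehalf * binsum (swap_if False (hsum F b)) R S')\<^sup>2"
        unfolding star_array_def sw
        by (intro power_mono order_trans[OF cmod_infsum_le_ennreal infsum_star_term_le]) auto
      also have "\<dots> \<le> ehalf * (binsum (swap_if True (hsum F (conj_array a))) R S')\<^sup>2 + ehalf * (binsum (swap_if False (hsum F b)) R S')\<^sup>2"
        by (rule power2_convex_ennreal[OF st])
      finally show ?thesis .
    qed
    then have "hsum UNIV (star_array F a b) R S \<le> (\<Sum>\<^sub>\<infinity>N. ennreal (1 / mfact N) *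
        (ehalf * (binsum (swap_if True (hsum F (conj_array a))) R (N + S))\<^sup>2 + ehalf * (binsum (swap_if False (hsum F b)) R (N + S))\<^sup>2))"
      unfolding hsum_def[of UNIV "star_array F a b"]
      by (intro infsum_mono_ennreal mult_left_mono) auto
    also have "\<dots> = (\<Sum>\<^sub>\<infinity>N. ehalf * (ennreal (1 / mfact N) * (binsum (swap_if True (hsum F (conj_array a))) R (N + S))\<^sup>2)
        + ehalf * (ennreal (1 / mfact N) * (binsum (swap_if False (hsum F b)) R (N + S))\<^sup>2))"
      by (intro infsum_cong) (simp add: distrib_left mult_ac)
    also have "\<dots> = ehalf * cstep True (hsum F (conj_array a)) R S + ehalf * cstep False (hsum F b) R S"
      by (simp only: infsum_add[OF summable_ennreal summable_ennreal] infsum_cmult_ennreal cstep_def)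
    finally show ?thesis .
  qed
  have "hcasc bs (star_array F a b) R S \<le> ehalf * cascade bs (cstep True (hsum F (conj_array a))) R S
      + ehalf * cascade bs (cstep False (hsum F b)) R S"
    by (rule order_trans[OF cascade_mono[OF h] cascade_convex[OF st]])
  also have "\<dots> \<le> cascade bs (cstep True (hsum F (conj_array a))) R S + cascade bs (cstep False (hsum F b)) R S"
    by (intro add_mono half)
  finally show ?thesis by (simp add: cascade_append)
qed

lemma wick_arrays_star:
  assumes "a \<in> wick_arrays" "b \<in> wick_arrays"
  shows "star_array F a b \<in> wick_arrays"
  unfolding wick_arrays_def
proof safe
  fix bs R S
  have "hcasc bs (star_array F a b) R S \<le>
     cascade (bs @ [True]) (hsum F (conj_array a)) R S + cascade (bs @ [False]) (hsum F b) R S"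
    by (rule hcasc_star_array)
  also have "\<dots> \<le> hcasc (bs @ [True]) (conj_array a) R S + hcasc (bs @ [False]) b R S"
    by (intro add_mono cascade_mono hsum_mono_set)
  also have "\<dots> < \<infinity>"
    using wick_arraysD[OF wick_arrays_conj[OF assms(1)], of "bs @ [True]" R S]
      wick_arraysD[OF assms(2), of "bs @ [False]" R S] by simp
  finally show "hcasc bs (star_array F a b) R S < \<infinity>" .
qed

lemma hsum_finite: "a \<in> wick_arrays \<Longrightarrow> hsum UNIV a R S < \<infinity>"
  using wick_arraysD[of a "[]"] by simp

lemma binsum_hsum_finite:
  assumes "a \<in> wick_arrays"
  shows "binsum (swap_if b (hsum UNIV a)) R S < \<infinity>"
proof -
  have "(binsum (swap_if b (hsum UNIV a)) R S)\<^sup>2 < \<infinity>"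
    using binsum_square_le_cstep[of b "hsum UNIV a" R S] wick_arraysD[OF assms, of "[b]" R S]
    by (auto intro: le_less_trans)
  then show ?thesis by (auto simp: power2_eq_square less_top[symmetric] ennreal_mult_eq_top_iff)
qed

lemma infsum_star_term_finite:
  assumes "a \<in> wick_arrays" "b \<in> wick_arrays"
  shows "(\<Sum>\<^sub>\<infinity>N. ennreal (cmod (star_term a b N T))) < \<infinity>"
proof -
  obtain R S where T: "T = (R, S)" by (cases T)
  have "swap_if False (hsum UNIV b) = hsum UNIV b" by (simp add: swap_if_def fun_eq_iff)
  then have "ehalf * binsum (swap_if True (hsum UNIV (conj_array a))) R S + ehalf * binsum (hsum UNIV b) R S < \<infinity>"
    using binsum_hsum_finite[OF wick_arrays_conj[OF assms(1)], of True R S] binsum_hsum_finite[OF assms(2), of False R S]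
    by (simp add: ennreal_mult_less_top)
  then show ?thesis unfolding T by (rule le_less_trans[OF infsum_star_term_le])
qed

lemma star_term_summable:
  assumes "a \<in> wick_arrays" "b \<in> wick_arrays"
  shows "(\<lambda>N. star_term a b N T) summable_on F"
  by (rule summable_on_subset_banach[of _ UNIV])
     (use infsum_star_term_finite[OF assms] in \<open>simp_all only: summable_on_iff_infsum_ennreal_cmod subset_UNIV\<close>)

lemma star_array_split:
  assumes "a \<in> wick_arrays" "b \<in> wick_arrays" "finite F"
  shows "star_array UNIV a b T - (\<Sum>N\<in>F. star_term a b N T) = star_array (UNIV - F) a b T"
proof -
  have "star_array UNIV a b T = infsum (\<lambda>N. star_term a b N T) (F \<union> (UNIV - F))"
    by (simp add: star_array_def)
  also have "\<dots> = (\<Sum>N\<in>F. star_term a b N T) + star_array (UNIV - F) a b T"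
    using assms by (subst infsum_Un_disjoint) (auto intro: star_term_summable simp: star_array_def)
  finally show ?thesis by simp
qed

text \<open>The restriction to \<open>UNIV - F\<close> passes from the star series to the sums
  \<open>hsum (UNIV - F)\<close> of both factors. These tend to 0 and are dominated by the full
  sums.\<close>

lemma hcasc_star_tail_tendsto:
  assumes "a \<in> wick_arrays" "b \<in> wick_arrays"
  shows "((\<lambda>F. hcasc bs (star_array (UNIV - F) a b) R S) \<longlongrightarrow> 0) (finite_subsets_at_top UNIV)"
proof -
  have h: "((\<lambda>F. cascade bs (hsum (UNIV - F) a) R S) \<longlongrightarrow> 0) (finite_subsets_at_top UNIV)"
    if "a \<in> wick_arrays" for a :: "'a midx2 \<Rightarrow> complex" and bs R S
  proof (rule cascade_tendsto_0)
    show "((\<lambda>F. hsum (UNIV - F) a R S) \<longlongrightarrow> 0) (finite_subsets_at_top UNIV)" for R S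
      unfolding hsum_def using hsum_finite[OF that, of R S]
      by (intro infsum_tail_tendsto_0_ennreal) (simp add: hsum_def)
  qed (use hsum_mono_set wick_arraysD[OF that] in auto)
  have "((\<lambda>F. cascade (bs @ [True]) (hsum (UNIV - F) (conj_array a)) R S
      + cascade (bs @ [False]) (hsum (UNIV - F) b) R S) \<longlongrightarrow> 0 + 0) (finite_subsets_at_top UNIV)"
    by (intro tendsto_add h assms wick_arrays_conj)
  then have l: "((\<lambda>F. cascade (bs @ [True]) (hsum (UNIV - F) (conj_array a)) R S
      + cascade (bs @ [False]) (hsum (UNIV - F) b) R S) \<longlongrightarrow> 0) (finite_subsets_at_top UNIV)"
    by simp
  show ?thesis
    by (rule tendsto_sandwich[OF _ _ tendsto_const l]) (auto intro: always_eventually hcasc_star_array)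
qed

section \<open>Entire power series in doubled variables\<close>

lemma mexp_term_add:
  "mexp_term N (v + w) = (\<Sum>I\<in>{..N}. mexp_term I v * mexp_term (N - I) w)"
proof -
  have one: "(x + y) ^ n / fact n = (\<Sum>i\<le>n. (x ^ i / fact i) * (y ^ (n - i) / fact (n - i)))" for x y :: complex and n
  proof -
    have "(x + y) ^ n / fact n = (\<Sum>i\<le>n. of_nat (n choose i) * x ^ i * y ^ (n - i) / fact n)"
      by (simp add: binomial_ring sum_divide_distrib)
    also have "\<dots> = (\<Sum>i\<le>n. (x ^ i / fact i) * (y ^ (n - i) / fact (n - i)))"
      by (intro sum.cong refl) (simp add: binomial_fact field_simps)
    finally show ?thesis .
  qed
  have "mexp_term N (v + w) = (\<Prod>k\<in>UNIV. \<Sum>i\<le>N $ k. (v $ k ^ i / fact i) * (w $ k ^ (N $ k - i) / fact (N $ k - i)))"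
    by (simp add: mexp_term_prod one)
  also have "\<dots> = (\<Sum>I\<in>{..N}. \<Prod>k\<in>UNIV. (v $ k ^ (I $ k) / fact (I $ k)) * (w $ k ^ (N $ k - I $ k) / fact (N $ k - I $ k)))"
    by (rule sum_atMost_vec_prod[symmetric])
  finally show ?thesis by (simp only: prod.distrib mexp_term_prod vector_minus_component)
qed

lemma mexp_term_mult:
  assumes "I \<le> R"
  shows "mexp_term I v * mexp_term (R - I) v = of_nat (mbinom R I) * mexp_term R v"
proof -
  have "of_nat (mfact R) = (of_nat (mbinom R I) * (of_nat (mfact I) * of_nat (mfact (R - I))) :: complex)"
    using mbinom_mfact[OF assms] by (metis of_nat_mult)
  moreover have "mpow v R = mpow v I * mpow v (R - I)"
    using mpow_add[of v I "R - I"] by (simp add: vec_le_diff_add assms)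
  moreover have "mbinom R I \<noteq> 0" using mbinom_mfact[OF assms] mfact_nz[of R] by (metis mult_is_0)
  ultimately show ?thesis by (simp add: mexp_term_def)
qed

definition below :: "'n::finite midx2 \<Rightarrow> 'n midx2 set" where
  "below T = {..fst T} \<times> {..snd T}"

definition eterm :: "'n::finite midx2 \<Rightarrow> (complex ^ 'n) \<times> (complex ^ 'n) \<Rightarrow> complex" where
  "eterm T \<xi> = mexp_term (fst T) (fst \<xi>) * mexp_term (snd T) (snd \<xi>)"

lemma finite_below [simp]: "finite (below T)"
  by (simp add: below_def)

lemma eterm_0 [simp]: "eterm 0 \<xi> = 1"
  by (simp add: eterm_def)

lemma eterm_add: "eterm T (\<xi> + \<eta>) = (\<Sum>A\<in>below T. eterm A \<xi> * eterm (T - A) \<eta>)"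
  unfolding eterm_def below_def fst_add snd_add mexp_term_add sum_product sum.cartesian_product
  by (intro sum.cong) (auto simp: mult_ac)

lemma below_diff_add: "A \<in> below T \<Longrightarrow> A + (T - A) = T"
  by (auto simp: below_def prod_eq_iff vec_le_diff_add)

lemma vec_add_diff: "I + J - I = J" for I J :: "nat ^ 'n"
  by (simp add: vec_eq_iff)

lemma in_below_add: "A \<in> below (A + B)" "(A + B) - A = B"
  by (simp_all add: below_def prod_eq_iff mem_Times_iff less_eq_vec_def vec_add_diff)

text \<open>Cauchy regrouping: a pair is determined by its sum together with its first
  member.\<close>

lemma bij_antidiagonal:
  "bij_betw (\<lambda>(T, A). (A, T - A)) (Sigma UNIV below) (UNIV :: ('n::finite midx2 \<times> 'n midx2) set)"
  by (rule bij_betwI[where g = "\<lambda>(A, B). (A + B, A)"])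
     (auto simp only: below_diff_add in_below_add prod.case mem_Sigma_iff UNIV_I split_paired_all Pi_iff)

lemma has_sum_antidiagonal:
  fixes f :: "'n::finite midx2 \<times> 'n midx2 \<Rightarrow> complex"
  assumes "(f has_sum s) UNIV"
  shows "((\<lambda>T. \<Sum>A\<in>below T. f (A, T - A)) has_sum s) UNIV"
proof -
  have "((\<lambda>(T, A). f (A, T - A)) has_sum s) (Sigma UNIV below)"
    using has_sum_reindex_bij_betw[OF bij_antidiagonal, of f s] assms by (simp add: case_prod_unfold)
  then show ?thesis
    by (rule has_sum_SigmaD) (simp add: has_sum_finiteI)
qed

lemma infsum_antidiagonal_ennreal:
  fixes f :: "'n::finite midx2 \<times> 'n midx2 \<Rightarrow> ennreal"
  shows "infsum f UNIV = (\<Sum>\<^sub>\<infinity>T. \<Sum>A\<in>below T. f (A, T - A))"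
proof -
  have "infsum f UNIV = infsum (\<lambda>(T, A). f (A, T - A)) (Sigma UNIV below)"
    using infsum_reindex_bij_betw[OF bij_antidiagonal, of f] by (simp add: case_prod_unfold)
  then show ?thesis by (simp add: infsum_Sigma_ennreal)
qed

section \<open>Everywhere convergent arrays, their Taylor expansion and their products\<close>

definition cabs :: "complex ^ 'n \<Rightarrow> complex ^ 'n" where
  "cabs v = (\<chi> k. of_real (cmod (v $ k)))"

lemma mexp_term_cabs: "mexp_term N (cabs v) = of_real (cmod (mexp_term N v))"
  by (simp add: mexp_term_prod cabs_def prod_norm[symmetric] norm_divide norm_power of_real_prod)

lemma eterm_cabs: "eterm T (cabs (fst \<xi>), cabs (snd \<xi>)) = of_real (cmod (eterm T \<xi>))"
  by (simp add: eterm_def mexp_term_cabs norm_mult)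

definition entire_array :: "('n::finite midx2 \<Rightarrow> complex) \<Rightarrow> bool" where
  "entire_array a \<longleftrightarrow> (\<forall>\<xi>. (\<lambda>T. a T * eterm T \<xi>) summable_on UNIV)"

text \<open>The two components of \<open>\<xi>\<close> stand for \<open>z\<close> and its conjugate, treated as independent variables.\<close>

definition cent :: "('n::finite midx2 \<Rightarrow> complex) \<Rightarrow> (complex ^ 'n) \<times> (complex ^ 'n) \<Rightarrow> complex" where
  "cent a \<xi> = (\<Sum>\<^sub>\<infinity>T. a T * eterm T \<xi>)"

lemma entire_arrayD: "entire_array a \<Longrightarrow> (\<lambda>T. a T * eterm T \<xi>) summable_on UNIV"
  unfolding entire_array_def by blast

lemma entire_arrayI: "(\<And>\<xi>. (\<lambda>T. a T * eterm T \<xi>) summable_on UNIV) \<Longrightarrow> entire_array a"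
  unfolding entire_array_def by blast

lemma has_sum_cent: "entire_array a \<Longrightarrow> ((\<lambda>T. a T * eterm T \<xi>) has_sum cent a \<xi>) UNIV"
  unfolding cent_def by (intro has_sum_infsum entire_arrayD)

lemma entire_array_iff_ennreal:
  "entire_array a \<longleftrightarrow> (\<forall>\<xi>. (\<Sum>\<^sub>\<infinity>T. ennreal (cmod (a T)) * ennreal (cmod (eterm T \<xi>))) < \<infinity>)"
  by (simp add: entire_array_def summable_on_iff_infsum_ennreal_cmod norm_mult ennreal_mult)

text \<open>By the binomial theorem the absolute double series regroups exactly into the absolute
  series of \<open>a\<close> at the point whose coordinates are the sums of the moduli of those of
  \<xi> and \<eta>.\<close>

lemma entire_array_double_sum_finite:
  assumes "entire_array a"
  shows "(\<Sum>\<^sub>\<infinity>(A, B). ennreal (cmod (a (A + B))) * (ennreal (cmod (eterm A \<xi>)) * ennreal (cmod (eterm B \<eta>)))) < \<infinity>"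
proof -
  define \<zeta> where "\<zeta> = (cabs (fst \<xi>), cabs (snd \<xi>)) + (cabs (fst \<eta>), cabs (snd \<eta>))"
  have eq: "(\<Sum>A\<in>below T. ennreal (cmod (a (A + (T - A)))) * (ennreal (cmod (eterm A \<xi>)) * ennreal (cmod (eterm (T - A) \<eta>))))
     = ennreal (cmod (a T)) * ennreal (cmod (eterm T \<zeta>))" for T
  proof -
    have "eterm T \<zeta> = of_real (\<Sum>A\<in>below T. cmod (eterm A \<xi>) * cmod (eterm (T - A) \<eta>))"
      by (simp add: \<zeta>_def eterm_add eterm_cabs del: Product_Plus.add_Pair)
    then have "cmod (eterm T \<zeta>) = (\<Sum>A\<in>below T. cmod (eterm A \<xi>) * cmod (eterm (T - A) \<eta>))"
      by (simp only: norm_of_real) (simp add: sum_nonneg)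
    then have "ennreal (cmod (eterm T \<zeta>)) = (\<Sum>A\<in>below T. ennreal (cmod (eterm A \<xi>)) * ennreal (cmod (eterm (T - A) \<eta>)))"
      by (simp add: sum_ennreal[symmetric] ennreal_mult)
    then show ?thesis by (simp add: sum_distrib_left below_diff_add)
  qed
  have "(\<Sum>\<^sub>\<infinity>(A, B). ennreal (cmod (a (A + B))) * (ennreal (cmod (eterm A \<xi>)) * ennreal (cmod (eterm B \<eta>))))
     = (\<Sum>\<^sub>\<infinity>T. ennreal (cmod (a T)) * ennreal (cmod (eterm T \<zeta>)))"
    by (subst infsum_antidiagonal_ennreal) (simp add: eq)
  then show ?thesis
    using assms[unfolded entire_array_iff_ennreal, rule_format, of \<zeta>] by (simp only:)
qed

lemma entire_array_double_has_sum:
  assumes "entire_array a"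
  shows "((\<lambda>(A, B). a (A + B) * (eterm A \<xi> * eterm B \<eta>)) has_sum cent a (\<xi> + \<eta>)) UNIV"
proof -
  define f where "f = (\<lambda>(A, B). a (A + B) * (eterm A \<xi> * eterm B \<eta>))"
  have "f summable_on UNIV"
    unfolding summable_on_iff_infsum_ennreal_cmod
    using entire_array_double_sum_finite[OF assms, of \<xi> \<eta>]
    by (simp add: f_def case_prod_unfold norm_mult ennreal_mult)
  then have f: "(f has_sum infsum f UNIV) UNIV" by simp
  then have "((\<lambda>T. \<Sum>A\<in>below T. f (A, T - A)) has_sum infsum f UNIV) UNIV"
    by (rule has_sum_antidiagonal)
  moreover have "(\<Sum>A\<in>below T. f (A, T - A)) = a T * eterm T (\<xi> + \<eta>)" for T
    by (simp add: f_def eterm_add sum_distrib_left below_diff_add)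
  ultimately have "infsum f UNIV = cent a (\<xi> + \<eta>)"
    using has_sum_cent[OF assms, of "\<xi> + \<eta>"] has_sum_unique by auto
  with f show ?thesis by (simp add: f_def)
qed

lemma mexp_term_1_nz: "mexp_term N (\<chi> k. 1) \<noteq> 0"
  by (simp add: mexp_term_prod)

lemma entire_array_shift:
  assumes "entire_array a"
  shows "entire_array (\<lambda>T. a (T + B))"
  unfolding entire_array_def
proof
  fix \<xi>
  \<comment> \<open>At the all-ones point \<open>eterm B \<eta>\<close> is nonzero, so it can be
    divided out of the slice of the double series with fixed \<open>B\<close>.\<close>
  define \<eta> :: "(complex ^ 'a) \<times> (complex ^ 'a)" where "\<eta> = (\<chi> k. 1, \<chi> k. 1)"
  have nz: "eterm B \<eta> \<noteq> 0" by (simp add: eterm_def \<eta>_def mexp_term_1_nz)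
  have "(\<lambda>(A, B). a (A + B) * (eterm A \<xi> * eterm B \<eta>)) summable_on UNIV"
    using entire_array_double_has_sum[OF assms] has_sum_imp_summable by blast
  then have "(\<lambda>(A, B). a (A + B) * (eterm A \<xi> * eterm B \<eta>)) summable_on (\<lambda>A. (A, B)) ` UNIV"
    by (rule summable_on_subset_banach) simp
  then have "(\<lambda>A. a (A + B) * (eterm A \<xi> * eterm B \<eta>)) summable_on UNIV"
    by (subst (asm) summable_on_reindex) (auto simp: inj_on_def o_def)
  then have "(\<lambda>A. (a (A + B) * eterm A \<xi>) * eterm B \<eta>) summable_on UNIV"
    by (simp add: mult.assoc)
  then show "(\<lambda>A. a (A + B) * eterm A \<xi>) summable_on UNIV"
    using nz by (simp add: summable_on_cmult_left')
qed

text \<open>Shifting by \<open>B\<close> is differentiation, so this is the Taylor expansion about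
  \<xi>. It is the double series with the sum over \<open>A\<close> carried out first.\<close>

lemma cent_taylor:
  assumes "entire_array a"
  shows "((\<lambda>B. cent (\<lambda>T. a (T + B)) \<xi> * eterm B \<eta>) has_sum cent a (\<xi> + \<eta>)) UNIV"
proof -
  have "((\<lambda>(B, A). a (A + B) * (eterm A \<xi> * eterm B \<eta>)) has_sum cent a (\<xi> + \<eta>)) (UNIV \<times> UNIV)"
    using entire_array_double_has_sum[OF assms, of \<xi> \<eta>]
    by (subst has_sum_swap) (simp add: UNIV_Times_UNIV)
  then show ?thesis
  proof (rule has_sum_SigmaD)
    fix B
    have "((\<lambda>A. (a (A + B) * eterm A \<xi>) * eterm B \<eta>) has_sum cent (\<lambda>T. a (T + B)) \<xi> * eterm B \<eta>) UNIV"
      by (intro has_sum_cmult_left has_sum_cent entire_array_shift assms)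
    then show "((\<lambda>A. case (B, A) of (B, A) \<Rightarrow> a (A + B) * (eterm A \<xi> * eterm B \<eta>)) has_sum cent (\<lambda>T. a (T + B)) \<xi> * eterm B \<eta>) UNIV"
      by (simp add: mult.assoc)
  qed
qed

lemma entire_array_translate:
  assumes "entire_array a"
  shows "entire_array (\<lambda>B. cent (\<lambda>T. a (T + B)) \<xi>)"
  unfolding entire_array_def using cent_taylor[OF assms] has_sum_imp_summable by blast

lemma cent_translate:
  assumes "entire_array a"
  shows "cent (\<lambda>B. cent (\<lambda>T. a (T + B)) \<xi>) \<eta> = cent a (\<xi> + \<eta>)"
  unfolding cent_def[of "\<lambda>B. cent (\<lambda>T. a (T + B)) \<xi>"] using cent_taylor[OF assms] by (rule infsumI)

lemma entire_array_cmult: "entire_array a \<Longrightarrow> entire_array (\<lambda>T. c * a T)"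
  by (intro entire_arrayI) (simp add: mult.assoc summable_on_cmult_right entire_arrayD)

lemma cent_cmult: "entire_array a \<Longrightarrow> cent (\<lambda>T. c * a T) \<xi> = c * cent a \<xi>"
  unfolding cent_def mult.assoc by (rule infsum_cmult_right) (rule entire_arrayD)

lemma entire_array_add: "entire_array a \<Longrightarrow> entire_array b \<Longrightarrow> entire_array (\<lambda>T. a T + b T)"
  by (intro entire_arrayI) (simp add: distrib_right summable_on_add entire_arrayD)

lemma cent_add: "entire_array a \<Longrightarrow> entire_array b \<Longrightarrow> cent (\<lambda>T. a T + b T) \<xi> = cent a \<xi> + cent b \<xi>"
  unfolding cent_def distrib_right by (rule infsum_add) (simp_all add: entire_arrayD)

lemma cent_diff: "entire_array a \<Longrightarrow> entire_array b \<Longrightarrow> cent (\<lambda>T. a T - b T) \<xi> = cent a \<xi> - cent b \<xi>"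
  using cent_add[of a "\<lambda>T. (- 1) * b T" \<xi>] entire_array_cmult[of b "- 1"] cent_cmult[of b "- 1" \<xi>] by simp

lemma entire_array_0: "entire_array (\<lambda>T. 0)"
  by (simp add: entire_array_def)

lemma cent_0: "cent (\<lambda>T. 0) \<xi> = 0"
  by (simp add: cent_def)

lemma entire_array_sum:
  "(\<And>i. i \<in> I \<Longrightarrow> entire_array (a i)) \<Longrightarrow> entire_array (\<lambda>T. \<Sum>i\<in>I. a i T)"
  by (induction I rule: infinite_finite_induct) (auto intro: entire_array_0 entire_array_add)

lemma cent_sum:
  "(\<And>i. i \<in> I \<Longrightarrow> entire_array (a i)) \<Longrightarrow> cent (\<lambda>T. \<Sum>i\<in>I. a i T) \<xi> = (\<Sum>i\<in>I. cent (a i) \<xi>)"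
  by (induction I rule: infinite_finite_induct) (auto simp: cent_0 cent_add entire_array_sum)

lemma infsum_mult_const_ennreal:
  fixes f :: "'a \<Rightarrow> ennreal"
  shows "infsum (\<lambda>x. f x * c) A = infsum f A * c"
  by (simp add: mult.commute[of _ c] infsum_cmult_ennreal)

text \<open>Cauchy product of two absolutely convergent series; multiplying two basis functions
  produces the binomial coefficients of the Leibniz rule.\<close>

lemma cent_conv_has_sum:
  assumes "entire_array a" "entire_array b"
  shows "((\<lambda>T. conv_array a b T * eterm T \<xi>) has_sum cent a \<xi> * cent b \<xi>) UNIV"
proof -
  define f where "f = (\<lambda>(A, B). (a A * eterm A \<xi>) * (b B * eterm B \<xi>))"
  have "infsum (\<lambda>T. ennreal (cmod (f T))) UNIV =
     (\<Sum>\<^sub>\<infinity>(A, B)\<in>UNIV \<times> UNIV. ennreal (cmod (a A * eterm A \<xi>)) * ennreal (cmod (b B * eterm B \<xi>)))"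
    by (simp add: f_def case_prod_unfold norm_mult ennreal_mult)
  also have "\<dots> = (\<Sum>\<^sub>\<infinity>A. ennreal (cmod (a A * eterm A \<xi>))) * (\<Sum>\<^sub>\<infinity>B. ennreal (cmod (b B * eterm B \<xi>)))"
    by (subst infsum_Sigma_ennreal) (simp add: infsum_cmult_ennreal infsum_mult_const_ennreal)
  also have "\<dots> < \<infinity>"
    using entire_arrayD[OF assms(1), of \<xi>] entire_arrayD[OF assms(2), of \<xi>]
    by (simp add: summable_on_iff_infsum_ennreal_cmod ennreal_mult_less_top)
  finally have "f summable_on UNIV" by (simp add: summable_on_iff_infsum_ennreal_cmod)
  then have f: "(f has_sum infsum f UNIV) UNIV" by simp
  have "((\<lambda>A. (a A * eterm A \<xi>) * cent b \<xi>) has_sum infsum f UNIV) UNIV"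
  proof (rule has_sum_SigmaD)
    show "(f has_sum infsum f UNIV) (UNIV \<times> UNIV)" using f by simp
    show "((\<lambda>B. f (A, B)) has_sum a A * eterm A \<xi> * cent b \<xi>) UNIV" for A
      unfolding f_def prod.case by (intro has_sum_cmult_right has_sum_cent assms)
  qed
  moreover have "((\<lambda>A. (a A * eterm A \<xi>) * cent b \<xi>) has_sum cent a \<xi> * cent b \<xi>) UNIV"
    by (intro has_sum_cmult_left has_sum_cent assms)
  ultimately have s: "infsum f UNIV = cent a \<xi> * cent b \<xi>" by (rule has_sum_unique)
  have "((\<lambda>T. \<Sum>A\<in>below T. f (A, T - A)) has_sum infsum f UNIV) UNIV"
    by (rule has_sum_antidiagonal[OF f])
  moreover have "(\<Sum>A\<in>below T. f (A, T - A)) = conv_array a b T * eterm T \<xi>" for T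
  proof -
    have e: "eterm A \<xi> * eterm (T - A) \<xi> = of_nat (mbinom (fst T) (fst A) * mbinom (snd T) (snd A)) * eterm T \<xi>"
      if "A \<in> below T" for A
    proof -
      have le: "fst A \<le> fst T" "snd A \<le> snd T" using that by (auto simp: below_def)
      have "eterm A \<xi> * eterm (T - A) \<xi> =
          (mexp_term (fst A) (fst \<xi>) * mexp_term (fst T - fst A) (fst \<xi>)) *
          (mexp_term (snd A) (snd \<xi>) * mexp_term (snd T - snd A) (snd \<xi>))"
        by (simp add: eterm_def)
      also have "\<dots> = of_nat (mbinom (fst T) (fst A) * mbinom (snd T) (snd A)) * eterm T \<xi>"
        unfolding mexp_term_mult[OF le(1)] mexp_term_mult[OF le(2)]
        by (simp add: eterm_def)
      finally show ?thesis .
    qed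
    have "(\<Sum>A\<in>below T. f (A, T - A)) = (\<Sum>A\<in>below T. (a A * b (T - A)) * (eterm A \<xi> * eterm (T - A) \<xi>))"
      by (simp add: f_def mult_ac)
    also have "\<dots> = (\<Sum>A\<in>below T. (of_nat (mbinom (fst T) (fst A) * mbinom (snd T) (snd A)) * (a A * b (T - A))) * eterm T \<xi>)"
      by (intro sum.cong refl) (simp only: e mult_ac)
    also have "\<dots> = conv_array a b T * eterm T \<xi>"
      by (simp add: sum_distrib_right[symmetric] conv_array_def below_def sum.cartesian_product case_prod_unfold
          minus_prod_def)
    finally show ?thesis .
  qed
  ultimately show ?thesis using s by simp
qed

lemma entire_array_conv: "entire_array a \<Longrightarrow> entire_array b \<Longrightarrow> entire_array (conv_array a b)"
  unfolding entire_array_def[of "conv_array a b"] using cent_conv_has_sum has_sum_imp_summable by blast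

lemma cent_conv: "entire_array a \<Longrightarrow> entire_array b \<Longrightarrow> cent (conv_array a b) \<xi> = cent a \<xi> * cent b \<xi>"
  unfolding cent_def[of "conv_array a b"] by (rule infsumI[OF cent_conv_has_sum])

definition vcnj :: "complex ^ 'n \<Rightarrow> complex ^ 'n" where
  "vcnj v = (\<chi> k. cnj (v $ k))"

lemma infsum_mexp_term_finite: "(\<Sum>\<^sub>\<infinity>N. ennreal (cmod (mexp_term N v))) < \<infinity>"
  using has_sum_mexp_term[of v, THEN has_sum_imp_summable]
  by (simp only: summable_on_iff_infsum_ennreal_cmod)

lemma ennreal_product_le_squares:
  assumes "0 \<le> x" "0 \<le> y"
  shows "ennreal x * ennreal y \<le> ennreal (x\<^sup>2) + ennreal (y\<^sup>2)"
proof -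
  have "0 \<le> (x - y)\<^sup>2" "0 \<le> x * y" using assms by auto
  then have "x * y \<le> x\<^sup>2 + y\<^sup>2" by (simp add: power2_eq_square algebra_simps)
  then show ?thesis using assms
    by (simp add: ennreal_mult[symmetric] ennreal_plus[symmetric] ennreal_leI del: ennreal_plus)
qed

text \<open>In the second index, coefficient times monomial is split into squares, which leaves
  \<open>h R 0\<close> and an exponential series. In the first index the same splitting, applied to
  \<open>h R 0\<close> times a monomial, leaves the sum of the squares of \<open>h R 0\<close> with
  weights \<open>1 / mfact R\<close>; the swapping level at index 0 bounds it.\<close>

lemma wick_arrays_entire:
  fixes a :: "'n::finite midx2 \<Rightarrow> complex"
  assumes "a \<in> wick_arrays"
  shows "entire_array a"
  unfolding entire_array_iff_ennreal
proof
  fix \<xi> :: "(complex ^ 'n) \<times> (complex ^ 'n)"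
  define h where "h = hsum UNIV a"
  define c where "c = (\<lambda>N :: nat ^ 'n. 1 / real (mfact N))"
  \<comment> \<open>The monomials of \<open>sq v\<close> are the squared moduli of those of
    \<open>v\<close>, so the squares of the monomials sum to an exponential series again.\<close>
  define sq :: "complex ^ 'n \<Rightarrow> complex ^ 'n" where "sq v = (\<chi> k. of_real ((cmod (v $ k))\<^sup>2))" for v
  have c0: "c N \<ge> 0" for N by (simp add: c_def)
  have me: "cmod (mexp_term N v) = c N * cmod (mpow v N)" for N and v :: "complex ^ 'n"
    by (simp add: c_def mexp_term_def norm_divide)
  have sq: "c N * (cmod (mpow v N))\<^sup>2 = cmod (mexp_term N (sq v))" for N and v :: "complex ^ 'n"
    by (simp add: me mpow_def sq_def prod_norm[symmetric] norm_power power_mult[symmetric] mult.commute prod_power_distrib)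
  define C where "C = (\<lambda>v. \<Sum>\<^sub>\<infinity>N. ennreal (cmod (mexp_term N (sq v))))"
  have C: "C v < \<infinity>" for v unfolding C_def by (rule infsum_mexp_term_finite)
  define D where "D = (\<Sum>\<^sub>\<infinity>R. ennreal (cmod (mexp_term R (fst \<xi>))))"
  have D: "D < \<infinity>" unfolding D_def by (rule infsum_mexp_term_finite)
  have in_S: "(\<Sum>\<^sub>\<infinity>S. ennreal (cmod (a (R, S))) * ennreal (cmod (mexp_term S (snd \<xi>)))) \<le> h R 0 + C (snd \<xi>)" for R
  proof -
    have "(\<Sum>\<^sub>\<infinity>S. ennreal (cmod (a (R, S))) * ennreal (cmod (mexp_term S (snd \<xi>))))
      = (\<Sum>\<^sub>\<infinity>S. ennreal (c S) * (ennreal (cmod (a (R, S))) * ennreal (cmod (mpow (snd \<xi>) S))))"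
      by (intro infsum_cong) (simp add: me ennreal_mult c0 mult_ac)
    also have "\<dots> \<le> (\<Sum>\<^sub>\<infinity>S. ennreal (c S) * (ennreal ((cmod (a (R, S)))\<^sup>2) + ennreal ((cmod (mpow (snd \<xi>) S))\<^sup>2)))"
      by (intro infsum_mono_ennreal mult_left_mono ennreal_product_le_squares) auto
    also have "\<dots> = (\<Sum>\<^sub>\<infinity>S. ennreal (c S) * ennreal ((cmod (a (R, S)))\<^sup>2) + ennreal (cmod (mexp_term S (sq (snd \<xi>)))))"
      by (intro infsum_cong) (simp add: distrib_left sq[symmetric] ennreal_mult c0)
    also have "\<dots> = h R 0 + C (snd \<xi>)"
      by (simp only: infsum_add[OF summable_ennreal summable_ennreal] C_def)
         (simp add: h_def hsum_def c_def)
    finally show ?thesis .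
  qed
  have hR: "(\<Sum>\<^sub>\<infinity>R. ennreal (cmod (mexp_term R (fst \<xi>))) * h R 0) \<le> cstep True h 0 0 + C (fst \<xi>)"
  proof -
    have "ennreal (cmod (mexp_term R (fst \<xi>))) * h R 0 \<le> ennreal (c R) * (h R 0)\<^sup>2 + ennreal (cmod (mexp_term R (sq (fst \<xi>))))" for R
    proof -
      obtain r where r: "h R 0 = ennreal r" "r \<ge> 0"
        using hsum_finite[OF assms, of R 0] unfolding h_def by (cases "hsum UNIV a R 0") auto
      have "ennreal (cmod (mexp_term R (fst \<xi>))) * h R 0 = ennreal (c R) * (ennreal r * ennreal (cmod (mpow (fst \<xi>) R)))"
        using r by (simp add: me ennreal_mult c0 mult_ac)
      also have "\<dots> \<le> ennreal (c R) * (ennreal (r\<^sup>2) + ennreal ((cmod (mpow (fst \<xi>) R))\<^sup>2))"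
        using r by (intro mult_left_mono ennreal_product_le_squares) auto
      also have "\<dots> = ennreal (c R) * (h R 0)\<^sup>2 + ennreal (cmod (mexp_term R (sq (fst \<xi>))))"
        using r by (simp add: distrib_left sq[symmetric] ennreal_mult c0 ennreal_power)
      finally show ?thesis .
    qed
    then have "(\<Sum>\<^sub>\<infinity>R. ennreal (cmod (mexp_term R (fst \<xi>))) * h R 0)
        \<le> (\<Sum>\<^sub>\<infinity>R. ennreal (c R) * (h R 0)\<^sup>2 + ennreal (cmod (mexp_term R (sq (fst \<xi>)))))"
      by (rule infsum_mono_ennreal)
    also have "\<dots> = (\<Sum>\<^sub>\<infinity>R. ennreal (c R) * (h R 0)\<^sup>2) + C (fst \<xi>)"
      by (simp only: infsum_add[OF summable_ennreal summable_ennreal] C_def)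
    also have "\<dots> \<le> cstep True h 0 0 + C (fst \<xi>)"
      using infsum_square_le_cstep[of True h 0 0]
      by (intro add_right_mono) (simp add: c_def swap_if_def)
    finally show ?thesis .
  qed
  have "(\<Sum>\<^sub>\<infinity>T. ennreal (cmod (a T)) * ennreal (cmod (eterm T \<xi>)))
     = (\<Sum>\<^sub>\<infinity>(R, S)\<in>UNIV \<times> UNIV. ennreal (cmod (mexp_term R (fst \<xi>))) * (ennreal (cmod (a (R, S))) * ennreal (cmod (mexp_term S (snd \<xi>)))))"
    by (simp add: case_prod_unfold eterm_def norm_mult ennreal_mult mult_ac)
  also have "\<dots> = (\<Sum>\<^sub>\<infinity>R. ennreal (cmod (mexp_term R (fst \<xi>))) * (\<Sum>\<^sub>\<infinity>S. ennreal (cmod (a (R, S))) * ennreal (cmod (mexp_term S (snd \<xi>)))))"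
    by (subst infsum_Sigma_ennreal) (simp add: infsum_cmult_ennreal)
  also have "\<dots> \<le> (\<Sum>\<^sub>\<infinity>R. ennreal (cmod (mexp_term R (fst \<xi>))) * (h R 0 + C (snd \<xi>)))"
    by (intro infsum_mono_ennreal mult_left_mono in_S) auto
  also have "\<dots> = (\<Sum>\<^sub>\<infinity>R. ennreal (cmod (mexp_term R (fst \<xi>))) * h R 0 + C (snd \<xi>) * ennreal (cmod (mexp_term R (fst \<xi>))))"
    by (intro infsum_cong) (simp add: distrib_left mult_ac)
  also have "\<dots> = (\<Sum>\<^sub>\<infinity>R. ennreal (cmod (mexp_term R (fst \<xi>))) * h R 0) + C (snd \<xi>) * D"
    by (simp only: infsum_add[OF summable_ennreal summable_ennreal] infsum_cmult_ennreal D_def)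
  also have "\<dots> \<le> cstep True h 0 0 + C (fst \<xi>) + C (snd \<xi>) * D"
    by (intro add_right_mono hR)
  also have "\<dots> < \<infinity>"
    using C D wick_arraysD[OF assms, of "[True]" 0 0] by (simp add: ennreal_mult_less_top h_def)
  finally show "(\<Sum>\<^sub>\<infinity>T. ennreal (cmod (a T)) * ennreal (cmod (eterm T \<xi>))) < \<infinity>" .
qed

section \<open>Functions represented by entire series\<close>

definition dbl :: "real \<Rightarrow> complex ^ 'n \<Rightarrow> (complex ^ 'n) \<times> (complex ^ 'n)" where
  "dbl s v = (\<chi> k. v $ k / of_real s, \<chi> k. cnj (v $ k) / of_real s)"

definition ent :: "real \<Rightarrow> complex ^ 'n::finite \<Rightarrow> ('n midx2 \<Rightarrow> complex) \<Rightarrow> complex ^ 'n \<Rightarrow> complex" where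
  "ent s p a z = cent a (dbl s (z - p))"

definition uz :: "'n::finite \<Rightarrow> 'n midx2" where "uz k = (axis k 1, 0)"
definition ub :: "'n::finite \<Rightarrow> 'n midx2" where "ub k = (0, axis k 1)"

definition dir_deriv :: "real \<Rightarrow> complex ^ 'n::finite \<Rightarrow> ('n midx2 \<Rightarrow> complex) \<Rightarrow> 'n midx2 \<Rightarrow> complex" where
  "dir_deriv s v a T = (\<Sum>k\<in>UNIV. v $ k / of_real s * a (T + uz k)) + (\<Sum>k\<in>UNIV. cnj (v $ k) / of_real s * a (T + ub k))"

lemma dbl_add: "dbl s (v + w) = dbl s v + dbl s w"
  by (simp add: dbl_def vec_eq_iff add_divide_distrib)

lemma dbl_0 [simp]: "dbl s 0 = 0"
  by (simp add: dbl_def vec_eq_iff zero_prod_def)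

lemma mexp_term_axis: "mexp_term (axis k 1) v = v $ k"
proof -
  have "mexp_term (axis k 1) v = (\<Prod>j\<in>UNIV. if j = k then v $ j else 1)"
    unfolding mexp_term_prod by (intro prod.cong refl) (simp add: axis_def)
  then show ?thesis by simp
qed

lemma eterm_uz: "eterm (uz k) (dbl s v) = v $ k / of_real s"
  and eterm_ub: "eterm (ub k) (dbl s v) = cnj (v $ k) / of_real s"
  using mexp_term_axis[of k] by (simp_all add: eterm_def uz_def ub_def dbl_def)

lemma mabs_eq_0_iff: "mabs N = 0 \<longleftrightarrow> N = 0"
  by (simp add: mabs_def vec_eq_iff)

lemma mabs_eq_1D: "mabs N = 1 \<Longrightarrow> \<exists>k. N = axis k 1"
  unfolding mabs_def by (subst (asm) sum_eq_1_iff) (auto simp: vec_eq_iff axis_def)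

lemma deg_le_1D:
  assumes "mabs (fst B) + mabs (snd B) < 2"
  shows "B = 0 \<or> B \<in> range uz \<union> range ub"
proof -
  consider "mabs (fst B) = 0" "mabs (snd B) = 0" | "mabs (fst B) = 1" "mabs (snd B) = 0"
    | "mabs (fst B) = 0" "mabs (snd B) = 1" using assms by linarith
  then show ?thesis
  proof cases
    case 2
    then obtain k where "fst B = axis k 1" using mabs_eq_1D by blast
    then have "B = uz k" using 2 by (simp add: uz_def prod_eq_iff mabs_eq_0_iff)
    then show ?thesis by blast
  next
    case 3
    then obtain k where "snd B = axis k 1" using mabs_eq_1D by blast
    then have "B = ub k" using 3 by (simp add: ub_def prod_eq_iff mabs_eq_0_iff)
    then show ?thesis by blast
  qed (simp add: mabs_eq_0_iff prod_eq_iff)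
qed

lemma entire_array_dir_deriv: "entire_array a \<Longrightarrow> entire_array (dir_deriv s v a)"
  unfolding dir_deriv_def[abs_def]
  by (intro entire_array_add entire_array_sum entire_array_cmult entire_array_shift)

lemma cent_dir_deriv:
  "entire_array a \<Longrightarrow> cent (dir_deriv s v a) \<xi> =
    (\<Sum>k\<in>UNIV. v $ k / of_real s * cent (\<lambda>T. a (T + uz k)) \<xi>) + (\<Sum>k\<in>UNIV. cnj (v $ k) / of_real s * cent (\<lambda>T. a (T + ub k)) \<xi>)"
  unfolding dir_deriv_def[abs_def]
  by (simp add: cent_add cent_sum cent_cmult entire_array_sum entire_array_cmult entire_array_shift del: times_divide_eq_left)

lemma uz_ub_distinct: "uz k \<noteq> 0" "ub k \<noteq> 0" "uz k \<noteq> ub j" "inj uz" "inj ub"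
  by (auto simp: uz_def ub_def prod_eq_iff inj_def axis_eq_axis axis_eq_0_iff)

lemma mexp_term_scale:
  "mexp_term N (\<chi> k. v $ k * c) = mpow v N * mexp_term N (\<chi> k. c)"
  by (simp add: mexp_term_prod mpow_def power_mult_distrib prod.distrib[symmetric])

lemma cmod_mpow_le:
  assumes "\<And>k. cmod (v $ k) \<le> r"
  shows "cmod (mpow v N) \<le> r ^ mabs N"
proof -
  have "cmod (mpow v N) = (\<Prod>k\<in>UNIV. cmod (v $ k) ^ (N $ k))"
    by (simp add: mpow_def prod_norm[symmetric] norm_power)
  also have "\<dots> \<le> (\<Prod>k\<in>UNIV. r ^ (N $ k))"
    by (intro prod_mono conjI power_mono assms) auto
  finally show ?thesis by (simp add: mabs_def power_sum)
qed

text \<open>Once the constant and linear terms are split off, each remaining term has degree at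
  least 2 in the increment. For increments of norm at most 1 it is bounded by the squared norm times
  the same term at the all-ones increment, and \<open>C\<close> is the absolute sum of the
  latter.\<close>

lemma ent_has_derivative:
  fixes a :: "'n::finite midx2 \<Rightarrow> complex"
  assumes "entire_array a"
  shows "(ent s p a has_derivative (\<lambda>v. ent s p (dir_deriv s v a) z)) (at z)"
proof -
  define c where "c B = cent (\<lambda>T. a (T + B)) (dbl s (z - p))" for B
  define L where "L v = ent s p (dir_deriv s v a) z" for v
  have L: "L v = (\<Sum>k\<in>UNIV. v $ k / of_real s * c (uz k)) + (\<Sum>k\<in>UNIV. cnj (v $ k) / of_real s * c (ub k))" for v
    by (simp add: L_def ent_def cent_dir_deriv[OF assms] c_def)
  have "linear L"
  proof (rule linearI)
    show "L (v + w) = L v + L w" for v w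
      by (simp add: L add_divide_distrib distrib_right sum.distrib)
    show "L (r *\<^sub>R v) = r *\<^sub>R L v" for r v
      by (simp add: L scaleR_add_right scaleR_sum_right scaleR_conv_of_real[where 'a = complex]
            distrib_left sum_distrib_left mult_ac)
  qed
  then have bl: "bounded_linear L" by (simp add: linear_conv_bounded_linear)
  define e1 where "e1 = dbl s ((\<chi> k. 1) :: complex ^ 'n)"
  define U where "U = insert 0 (range uz \<union> range ub :: 'n midx2 set)"
  define C where "C = (\<Sum>\<^sub>\<infinity>B\<in>UNIV - U. cmod (c B * eterm B e1))"
  have ce: "entire_array c" unfolding c_def by (rule entire_array_translate[OF assms])
  have sumC: "(\<lambda>B. cmod (c B * eterm B e1)) summable_on UNIV - U"
    using entire_arrayD[OF ce, of e1]
    by (simp only: summable_on_iff_abs_summable_on_complex summable_on_subset_banach[OF _ subset_UNIV])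
  have bound: "cmod (ent s p a (z + h) - ent s p a z - L h) \<le> C * (norm h)\<^sup>2" if h: "norm h \<le> 1" for h
  proof -
    have tay: "((\<lambda>B. c B * eterm B (dbl s h)) has_sum ent s p a (z + h)) UNIV"
      using cent_taylor[OF assms, of "dbl s (z - p)" "dbl s h"]
      by (simp add: c_def ent_def dbl_add[symmetric] algebra_simps)
    have "(\<Sum>B\<in>U. c B * eterm B (dbl s h)) = ent s p a z + L h"
    proof -
      have "(\<Sum>B\<in>U. c B * eterm B (dbl s h)) = c 0 + ((\<Sum>B\<in>range uz. c B * eterm B (dbl s h)) + (\<Sum>B\<in>range ub. c B * eterm B (dbl s h)))"
      proof -
        have "(0 :: 'n midx2) \<notin> range uz \<union> range ub" "range uz \<inter> range ub = ({} :: 'n midx2 set)"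
          using uz_ub_distinct(1-3) by (metis UnE imageE, blast)
        then show ?thesis
          unfolding U_def by (subst sum.insert) (auto simp: sum.union_disjoint)
      qed
      also have "\<dots> = ent s p a z + L h"
        by (simp add: sum.reindex[OF uz_ub_distinct(4)] sum.reindex[OF uz_ub_distinct(5)] L eterm_uz eterm_ub mult.commute)
           (simp add: c_def ent_def)
      finally show ?thesis .
    qed
    then have "((\<lambda>B. c B * eterm B (dbl s h)) has_sum ent s p a (z + h) - (ent s p a z + L h)) (UNIV - U)"
      using tay by (intro has_sum_Diff) (auto intro!: has_sum_finiteI simp: U_def)
    then have eq: "ent s p a (z + h) - ent s p a z - L h = infsum (\<lambda>B. c B * eterm B (dbl s h)) (UNIV - U)"
      by (simp add: infsumI)
    have le: "cmod (c B * eterm B (dbl s h)) \<le> (norm h)\<^sup>2 * cmod (c B * eterm B e1)" if "B \<in> UNIV - U" for B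
    proof -
      have deg: "2 \<le> mabs (fst B) + mabs (snd B)"
        using that deg_le_1D[of B] by (fastforce simp: U_def)
      have "eterm B (dbl s h) = mexp_term (fst B) (\<chi> k. h $ k * (1 / of_real s)) * mexp_term (snd B) (\<chi> k. vcnj h $ k * (1 / of_real s))"
        by (simp add: eterm_def dbl_def vcnj_def)
      also have "\<dots> = (mpow h (fst B) * mpow (vcnj h) (snd B)) * eterm B e1"
        unfolding mexp_term_scale by (simp add: eterm_def e1_def dbl_def)
      finally have "eterm B (dbl s h) = (mpow h (fst B) * mpow (vcnj h) (snd B)) * eterm B e1" .
      moreover have mp: "cmod (mpow h (fst B) * mpow (vcnj h) (snd B)) \<le> (norm h)\<^sup>2"
      proof -
        have "cmod (mpow h (fst B) * mpow (vcnj h) (snd B)) \<le> norm h ^ mabs (fst B) * norm h ^ mabs (snd B)"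
          unfolding norm_mult
          by (intro mult_mono cmod_mpow_le) (auto simp: vcnj_def Finite_Cartesian_Product.norm_nth_le)
        also have "\<dots> \<le> (norm h)\<^sup>2"
          unfolding power_add[symmetric] by (rule power_decreasing[OF deg]) (use h in auto)
        finally show ?thesis .
      qed
      ultimately have "cmod (c B * eterm B (dbl s h)) = cmod (mpow h (fst B) * mpow (vcnj h) (snd B)) * cmod (c B * eterm B e1)"
        by (simp add: norm_mult)
      also have "\<dots> \<le> (norm h)\<^sup>2 * cmod (c B * eterm B e1)"
        by (intro mult_right_mono mp) auto
      finally show ?thesis .
    qed
    have sb: "(\<lambda>B. (norm h)\<^sup>2 * cmod (c B * eterm B e1)) summable_on UNIV - U"
      by (intro summable_on_cmult_right sumC)
    then have ab: "(\<lambda>B. cmod (c B * eterm B (dbl s h))) summable_on UNIV - U"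
      by (rule Infinite_Sum.abs_summable_on_comparison_test'[OF _ le])
    have "cmod (infsum (\<lambda>B. c B * eterm B (dbl s h)) (UNIV - U)) \<le> infsum (\<lambda>B. cmod (c B * eterm B (dbl s h))) (UNIV - U)"
      by (rule norm_infsum_bound[OF ab])
    also have "\<dots> \<le> infsum (\<lambda>B. (norm h)\<^sup>2 * cmod (c B * eterm B e1)) (UNIV - U)"
      by (rule infsum_mono[OF ab sb le])
    also have "\<dots> = C * (norm h)\<^sup>2"
      using sumC by (simp add: infsum_cmult_right C_def mult.commute)
    finally show ?thesis using eq by simp
  qed
  have "(ent s p a has_derivative L) (at z)"
  proof (rule has_derivativeI_sandwich[where e = 1 and H = "\<lambda>y. C * norm (y - z)"])
    show "((\<lambda>y. C * norm (y - z)) \<longlongrightarrow> 0) (at z)"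
      by (rule tendsto_eq_intros | simp)+
    fix y assume y: "y \<in> UNIV" "y \<noteq> z" "dist y z < 1"
    have "cmod (ent s p a y - ent s p a z - L (y - z)) \<le> C * (norm (y - z))\<^sup>2"
      using bound[of "y - z"] y by (simp add: dist_norm)
    then show "norm (ent s p a y - ent s p a z - L (y - z)) / norm (y - z) \<le> C * norm (y - z)"
      using y by (simp add: divide_le_eq power2_eq_square mult.assoc)
  qed (use bl in auto)
  then show ?thesis by (simp add: L_def[abs_def])
qed

lemma frechet_derivative_ent:
  "entire_array a \<Longrightarrow> frechet_derivative (ent s p a) (at z) = (\<lambda>v. ent s p (dir_deriv s v a) z)"
  using frechet_derivative_at[OF ent_has_derivative] by metis

lemma smooth_ent:
  assumes "entire_array a"
  shows "smooth (ent s p a)"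
proof -
  have "C_k n (ent s p a)" for n
    using assms
  proof (induction n arbitrary: a)
    case 0
    then show ?case
      by (auto intro!: continuous_at_imp_continuous_on has_derivative_continuous ent_has_derivative)
  next
    case (Suc n)
    then show ?case
      using ent_has_derivative differentiableI
      by (fastforce simp: frechet_derivative_ent entire_array_dir_deriv)
  qed
  then show ?thesis by (simp add: smooth_def)
qed

section \<open>Iterated Wirtinger derivatives and the jet\<close>

lemma dir_deriv_axis:
  "dir_deriv s (axis k x) a T = x / of_real s * a (T + uz k) + cnj x / of_real s * a (T + ub k)"
proof -
  have "(\<Sum>j\<in>UNIV. axis k x $ j / of_real s * a (T + uz j)) = (\<Sum>j\<in>UNIV. if j = k then x / of_real s * a (T + uz j) else 0)"
    by (intro sum.cong refl) (simp add: axis_def)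
  moreover have "(\<Sum>j\<in>UNIV. cnj (axis k x $ j) / of_real s * a (T + ub j)) = (\<Sum>j\<in>UNIV. if j = k then cnj x / of_real s * a (T + ub j) else 0)"
    by (intro sum.cong refl) (simp add: axis_def)
  ultimately show ?thesis by (simp add: dir_deriv_def)
qed

lemma
  assumes "entire_array a"
  shows dz_ent: "dz k (ent s p a) = ent s p (\<lambda>T. of_real (1 / s) * a (T + uz k))"
    and dzbar_ent: "dzbar k (ent s p a) = ent s p (\<lambda>T. of_real (1 / s) * a (T + ub k))"
proof -
  have d: "ent s p (dir_deriv s (axis k x) a) z = x / of_real s * cent (\<lambda>T. a (T + uz k)) (dbl s (z - p))
      + cnj x / of_real s * cent (\<lambda>T. a (T + ub k)) (dbl s (z - p))" for x z
    using assms by (simp add: ent_def dir_deriv_axis[abs_def] cent_add cent_cmult entire_array_shift entire_array_cmult del: times_divide_eq_left)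
  have e: "ent s p (\<lambda>T. of_real (1 / s) * a (T + B)) z = of_real (1 / s) * cent (\<lambda>T. a (T + B)) (dbl s (z - p))" for B z
    unfolding ent_def by (rule cent_cmult[OF entire_array_shift[OF assms]])
  show "dz k (ent s p a) = ent s p (\<lambda>T. of_real (1 / s) * a (T + uz k))"
    "dzbar k (ent s p a) = ent s p (\<lambda>T. of_real (1 / s) * a (T + ub k))"
    unfolding fun_eq_iff e dz_def dzbar_def frechet_derivative_ent[OF assms] d
    by (simp_all add: field_simps)
qed

text \<open>Here \<open>e\<close> stands for the embedding of multiindices into one of the two
  slots, so that one induction serves both Wirtinger derivatives.\<close>

lemma multi_deriv_ent:
  fixes D :: "'n::finite \<Rightarrow> (complex ^ 'n \<Rightarrow> complex) \<Rightarrow> complex ^ 'n \<Rightarrow> complex" and e :: "nat ^ 'n \<Rightarrow> 'n midx2"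
  assumes D: "\<And>k a. entire_array a \<Longrightarrow> D k (ent s p a) = ent s p (\<lambda>T. of_real (1 / s) * a (T + e (axis k 1)))"
    and e: "e 0 = 0" "\<And>N M. e (N + M) = e N + e M"
    and a: "entire_array a"
  shows "multi_deriv D N (ent s p a) = ent s p (\<lambda>T. of_real (1 / s) ^ mabs N * a (T + e N))"
proof -
  have pow: "(D k ^^ m) (ent s p a) = ent s p (\<lambda>T. of_real (1 / s) ^ m * a (T + e (axis k m)))" if "entire_array a" for k m a
  proof (induction m)
    case 0
    have ax: "axis k (0::nat) = 0" by (simp add: axis_eq_0_iff)
    show ?case by (simp add: ax e(1))
  next
    case (Suc m)
    have "axis k (Suc m) = axis k 1 + axis k m" by (simp add: axis_def vec_eq_iff)
    then have "e (axis k (Suc m)) = e (axis k 1) + e (axis k m)" by (simp add: e)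
    then show ?case
      using that by (simp add: Suc D entire_array_cmult entire_array_shift algebra_simps)
  qed
  \<comment> \<open>Stated for every list without repetitions, with sums over its members, because
    the induction passes through incomplete lists of coordinates.\<close>
  have fold: "distinct ks \<Longrightarrow> foldr (\<lambda>k g. (D k ^^ (N $ k)) g) ks (ent s p a)
      = ent s p (\<lambda>T. of_real (1 / s) ^ (\<Sum>k\<in>set ks. N $ k) * a (T + e (\<Sum>k\<in>set ks. axis k (N $ k))))" for ks
  proof (induction ks)
    case (Cons k ks)
    then show ?case
      using a by (simp add: pow entire_array_cmult entire_array_shift power_add e algebra_simps)
  qed (simp add: e)
  define ks where "ks = (SOME ks :: 'n list. distinct ks \<and> set ks = UNIV)"
  have ks: "distinct ks" "set ks = UNIV"
    using someI_ex[of "\<lambda>ks :: 'n list. distinct ks \<and> set ks = UNIV"] finite_distinct_list[of "UNIV :: 'n set"]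
    unfolding ks_def by auto
  have "(\<Sum>k\<in>UNIV. axis k (N $ k)) = N"
    by (simp add: vec_eq_iff sum_component axis_def if_distrib cong: if_cong)
  then show ?thesis
    using fold[OF ks(1)] ks(2) by (simp add: multi_deriv_def ks_def[symmetric] mabs_def)
qed

lemma dz_multi_ent: "entire_array a \<Longrightarrow> dz_multi N (ent s p a) = ent s p (\<lambda>T. of_real (1 / s) ^ mabs N * a (T + (N, 0)))"
  by (rule multi_deriv_ent) (auto simp: dz_ent uz_def zero_prod_def)

lemma dzbar_multi_ent: "entire_array a \<Longrightarrow> dzbar_multi N (ent s p a) = ent s p (\<lambda>T. of_real (1 / s) ^ mabs N * a (T + (0, N)))"
  by (rule multi_deriv_ent) (auto simp: dzbar_ent ub_def zero_prod_def)

text \<open>Powers of \<open>s = \<surd>(2\<hbar>)\<close> absorb the powers of \<open>2\<hbar>\<close> in \<open>h\<^sub>0\<close> and in the star product.\<close>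

definition njet :: "real \<Rightarrow> complex ^ 'n::finite \<Rightarrow> (complex ^ 'n \<Rightarrow> complex) \<Rightarrow> 'n midx2 \<Rightarrow> complex" where
  "njet s p f = (\<lambda>(R, S). of_real s ^ (mabs R + mabs S) * dz_multi R (dzbar_multi S f) p)"

lemma mexp_term_zero: "mexp_term N 0 = (if N = 0 then 1 else 0)"
  by (auto simp: mexp_term_prod vec_eq_iff)

lemma cent_at_0: "cent a 0 = a 0"
proof -
  have "cent a 0 = (\<Sum>\<^sub>\<infinity>T\<in>{0}. a T * eterm T 0)"
    unfolding cent_def
    by (rule infsum_cong_neutral) (auto simp: eterm_def mexp_term_zero prod_eq_iff)
  then show ?thesis by simp
qed

lemma njet_ent:
  assumes "entire_array a" "s > 0"
  shows "njet s p (ent s p a) = a"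
proof
  fix T :: "'a midx2" obtain R S where T: "T = (R, S)" by (cases T)
  have "dz_multi R (dzbar_multi S (ent s p a)) p = of_real (1 / s) ^ mabs R * (of_real (1 / s) ^ mabs S * a (R, S))"
    using assms by (simp add: dzbar_multi_ent dz_multi_ent entire_array_cmult entire_array_shift)
      (simp add: ent_def cent_at_0)
  then show "njet s p (ent s p a) T = a T"
    using assms by (simp add: njet_def T power_add field_simps)
qed

text \<open>Regroups the two-step Taylor expansion, first along the real part and then along the imaginary
  part of the increment, by the total powers of the real and imaginary parts.\<close>

lemma bij_real_imag_split:
  "bij_betw (\<lambda>(K, I). ((fst I, fst K - fst I), (snd I, snd K - snd I))) (Sigma UNIV below) (UNIV :: ('n::finite midx2 \<times> 'n midx2) set)"
  by (rule bij_betwI[where g = "\<lambda>(A, B). ((fst A + snd A, fst B + snd B), (fst A, fst B))"])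
     (auto simp: below_def vec_le_diff_add vec_add_diff less_eq_vec_def)

text \<open>The increment is split into its real part and \<i> times its imaginary part. In doubled
  coordinates the two slots of each part are scalar multiples of one real vector, so a term depends
  on that vector only through the monomial whose exponent is the sum of both slots. Collecting by
  these exponents gives the series in real coordinates.\<close>

lemma real_analytic_ent:
  fixes a :: "'n::finite midx2 \<Rightarrow> complex"
  assumes "entire_array a"
  shows "real_analytic (ent s p a)"
  unfolding real_analytic_def
proof
  fix z0 :: "complex ^ 'n"
  define d where "d B = cent (\<lambda>T. a (T + B)) (dbl s (z0 - p))" for B
  have d: "entire_array d" unfolding d_def by (rule entire_array_translate[OF assms])
  define e1 where "e1 A = eterm A (dbl s ((\<chi> k. 1) :: complex ^ 'n))" for A
  define e2 where "e2 A = eterm A (dbl s ((\<chi> k. \<i>) :: complex ^ 'n))" for A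
  \<comment> \<open>\<open>I\<close> and \<open>J\<close> distribute the exponents \<open>K\<close>
    of the real and \<open>L\<close> of the imaginary part over the two slots.\<close>
  define c where "c K L = (\<Sum>(I, J)\<in>below (K, L). d ((I, K - I) + (J, L - J)) * (e1 (I, K - I) * e2 (J, L - J)))" for K L
  have "((\<lambda>(K, L). c K L * of_real (\<Prod>k\<in>UNIV. Re ((z - z0) $ k) ^ (K $ k))
                            * of_real (\<Prod>k\<in>UNIV. Im ((z - z0) $ k) ^ (L $ k))) has_sum ent s p a z) UNIV" for z
  proof -
    define v where "v = z - z0"
    define x y :: "complex ^ 'n" where "x = (\<chi> k. of_real (Re (v $ k)))" and "y = (\<chi> k. of_real (Im (v $ k)))"
    define ix iy where "ix = dbl s x" and "iy = dbl s (\<chi> k. \<i> * y $ k)"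
    have sum_v: "ix + iy = dbl s v"
      unfolding ix_def iy_def dbl_add[symmetric]
      by (rule arg_cong[where f = "dbl s"]) (simp add: x_def y_def vec_eq_iff complex_eq[symmetric] del: complex_eq)
    have ex: "eterm (I, I') ix = mpow x (I + I') * e1 (I, I')" for I I'
    proof -
      have "eterm (I, I') ix = mexp_term I (\<chi> k. x $ k * (1 / of_real s)) * mexp_term I' (\<chi> k. x $ k * (1 / of_real s))"
        by (simp add: eterm_def ix_def dbl_def x_def)
      also have "\<dots> = mpow x (I + I') * e1 (I, I')"
        unfolding mexp_term_scale by (simp add: eterm_def e1_def dbl_def mpow_add)
      finally show ?thesis .
    qed
    have ey: "eterm (I, I') iy = mpow y (I + I') * e2 (I, I')" for I I'
    proof -
      have "eterm (I, I') iy = mexp_term I (\<chi> k. y $ k * (\<i> / of_real s)) * mexp_term I' (\<chi> k. y $ k * (- \<i> / of_real s))"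
        by (simp add: eterm_def iy_def dbl_def y_def mult.commute)
      also have "\<dots> = mpow y (I + I') * e2 (I, I')"
        unfolding mexp_term_scale by (simp add: eterm_def e2_def dbl_def mpow_add)
      finally show ?thesis .
    qed
    define f where "f = (\<lambda>(A, B). d (A + B) * (eterm A ix * eterm B iy))"
    have "(f has_sum cent d (ix + iy)) UNIV"
      unfolding f_def by (rule entire_array_double_has_sum[OF d])
    also have "cent d (ix + iy) = ent s p a z"
      unfolding sum_v d_def[abs_def] cent_translate[OF assms]
      by (simp add: ent_def v_def dbl_add[symmetric])
    finally have "(f has_sum ent s p a z) UNIV" .
    then have "((\<lambda>(K, I). f ((fst I, fst K - fst I), (snd I, snd K - snd I))) has_sum ent s p a z) (Sigma UNIV below)"
      using has_sum_reindex_bij_betw[OF bij_real_imag_split, of f] by (simp add: case_prod_unfold)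
    then have "((\<lambda>K. \<Sum>I\<in>below K. f ((fst I, fst K - fst I), (snd I, snd K - snd I))) has_sum ent s p a z) UNIV"
      by (rule has_sum_SigmaD) (simp add: has_sum_finiteI)
    moreover have fib: "(\<Sum>I\<in>below (K, L). f ((fst I, K - fst I), (snd I, L - snd I)))
        = c K L * of_real (\<Prod>k\<in>UNIV. Re (v $ k) ^ (K $ k)) * of_real (\<Prod>k\<in>UNIV. Im (v $ k) ^ (L $ k))" for K L
    proof -
      have "mpow x K = of_real (\<Prod>k\<in>UNIV. Re (v $ k) ^ (K $ k))" "mpow y L = of_real (\<Prod>k\<in>UNIV. Im (v $ k) ^ (L $ k))"
        by (simp_all add: mpow_def x_def y_def)
      moreover have "f ((fst I, K - fst I), (snd I, L - snd I)) =
          d ((fst I, K - fst I) + (snd I, L - snd I)) * (e1 (fst I, K - fst I) * e2 (snd I, L - snd I)) * (mpow x K * mpow y L)"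
        if "I \<in> below (K, L)" for I
      proof -
        have "fst I + (K - fst I) = K" "snd I + (L - snd I) = L"
          using that by (auto simp: below_def vec_le_diff_add)
        then show ?thesis by (simp add: f_def ex ey mult_ac)
      qed
      ultimately show ?thesis
        by (simp add: c_def sum_distrib_right case_prod_unfold mult.assoc cong: sum.cong)
    qed
    moreover have "(\<lambda>K. \<Sum>I\<in>below K. f ((fst I, fst K - fst I), (snd I, snd K - snd I))) =
        (\<lambda>(K, L). c K L * of_real (\<Prod>k\<in>UNIV. Re (v $ k) ^ (K $ k)) * of_real (\<Prod>k\<in>UNIV. Im (v $ k) ^ (L $ k)))"
    proof
      fix K :: "'n midx2"
      show "(\<Sum>I\<in>below K. f ((fst I, fst K - fst I), (snd I, snd K - snd I))) =
        (case K of (K, L) \<Rightarrow> c K L * of_real (\<Prod>k\<in>UNIV. Re (v $ k) ^ (K $ k)) * of_real (\<Prod>k\<in>UNIV. Im (v $ k) ^ (L $ k)))"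
        using fib[of "fst K" "snd K"] by (simp only: case_prod_unfold prod.collapse)
    qed
    ultimately show ?thesis by (simp only: v_def)
  qed
  \<comment> \<open>The expansion holds at every point, so the radius 1 is an arbitrary
    choice.\<close>
  then show "\<exists>c r. r > 0 \<and> (\<forall>z\<in>ball z0 r.
           ((\<lambda>(K, L). c K L * of_real (\<Prod>k\<in>UNIV. Re ((z - z0) $ k) ^ (K $ k))
                            * of_real (\<Prod>k\<in>UNIV. Im ((z - z0) $ k) ^ (L $ k))) has_sum ent s p a z) UNIV)"
    by (intro exI[of _ c] exI[of _ 1]) auto
qed

section \<open>Smooth functions and symmetry of their derivatives\<close>

abbreviation ddir :: "'a::euclidean_space \<Rightarrow> ('a \<Rightarrow> 'b::real_normed_vector) \<Rightarrow> 'a \<Rightarrow> 'b" where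
  "ddir v f \<equiv> (\<lambda>x. frechet_derivative f (at x) v)"

lemma smooth_differentiable: "smooth f \<Longrightarrow> f differentiable (at x)"
  unfolding smooth_def by (metis C_k.simps(2))

lemma smooth_ddir: "smooth f \<Longrightarrow> smooth (ddir v f)"
  unfolding smooth_def by (metis C_k.simps(2))

lemma smooth_has_derivative: "smooth f \<Longrightarrow> (f has_derivative frechet_derivative f (at x)) (at x)"
  using smooth_differentiable frechet_derivative_works by blast

lemma smooth_continuous: "smooth f \<Longrightarrow> continuous_on UNIV f"
  unfolding smooth_def by (metis C_k.simps(1))

lemma ddir_eqI: "(f has_derivative F) (at x) \<Longrightarrow> ddir v f x = F v"
  using frechet_derivative_at by metis

lemma ddir_add:
  "smooth f \<Longrightarrow> smooth g \<Longrightarrow> ddir v (\<lambda>x. f x + g x) x = ddir v f x + ddir v g x"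
  by (rule ddir_eqI, rule has_derivative_add) (rule smooth_has_derivative, assumption)+

lemma ddir_cmult:
  fixes f :: "'a::euclidean_space \<Rightarrow> complex"
  shows "smooth f \<Longrightarrow> ddir v (\<lambda>x. c * f x) x = c * ddir v f x"
  by (rule ddir_eqI, rule has_derivative_mult_right, rule smooth_has_derivative)

lemma smooth_add:
  assumes "smooth f" "smooth g"
  shows "smooth (\<lambda>x. f x + g x)"
proof -
  have "C_k n (\<lambda>x. f x + g x)" for n
    using assms
  proof (induction n arbitrary: f g)
    case 0
    then show ?case by (simp add: continuous_on_add smooth_continuous)
  next
    case (Suc n)
    then show ?case by (simp add: smooth_differentiable ddir_add smooth_ddir)
  qed
  then show ?thesis by (simp add: smooth_def)
qed

lemma smooth_cmult:
  fixes f :: "'a::euclidean_space \<Rightarrow> complex"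
  assumes "smooth f"
  shows "smooth (\<lambda>x. c * f x)"
proof -
  have "C_k n (\<lambda>x. c * f x)" for n
    using assms
  proof (induction n arbitrary: f)
    case 0
    then show ?case by (simp add: continuous_on_mult_left smooth_continuous)
  next
    case (Suc n)
    then show ?case by (simp add: smooth_differentiable ddir_cmult smooth_ddir)
  qed
  then show ?thesis by (simp add: smooth_def)
qed

text \<open>Schwarz's argument: two applications of the mean value theorem show the second
  difference to be \<open>t * t\<close> times either mixed derivative at a point close to
  \<open>x\<close>; continuity then lets these points tend to \<open>x\<close>.\<close>

lemma symmetric_mixed_real:
  fixes h hu hv huv hvu :: "'a::real_normed_vector \<Rightarrow> real"
  assumes hu: "\<And>x t. ((\<lambda>t. h (x + t *\<^sub>R u)) has_real_derivative hu (x + t *\<^sub>R u)) (at t)"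
    and hv: "\<And>x t. ((\<lambda>t. h (x + t *\<^sub>R v)) has_real_derivative hv (x + t *\<^sub>R v)) (at t)"
    and huv: "\<And>x t. ((\<lambda>t. hu (x + t *\<^sub>R v)) has_real_derivative huv (x + t *\<^sub>R v)) (at t)"
    and hvu: "\<And>x t. ((\<lambda>t. hv (x + t *\<^sub>R u)) has_real_derivative hvu (x + t *\<^sub>R u)) (at t)"
    and cont: "isCont huv x" "isCont hvu x"
  shows "huv x = hvu x"
proof -
  define \<Delta> where "\<Delta> t = h (x + t *\<^sub>R u + t *\<^sub>R v) - h (x + t *\<^sub>R u) - h (x + t *\<^sub>R v) + h x" for t
  \<comment> \<open>The second difference is symmetric in the two directions, so one claim with
    \<open>a\<close> and \<open>b\<close> in either role covers both orders.\<close>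
  have key: "\<exists>\<xi> \<eta>. 0 < \<xi> \<and> \<xi> < t \<and> 0 < \<eta> \<and> \<eta> < t \<and> \<Delta> t = t * (t * k (x + \<xi> *\<^sub>R a + \<eta> *\<^sub>R b))"
    if t: "0 < t" and ab: "(a = u \<and> b = v) \<or> (a = v \<and> b = u)"
      and da: "\<And>x t. ((\<lambda>t. h (x + t *\<^sub>R a)) has_real_derivative ha (x + t *\<^sub>R a)) (at t)"
      and dab: "\<And>x t. ((\<lambda>t. ha (x + t *\<^sub>R b)) has_real_derivative k (x + t *\<^sub>R b)) (at t)"
    for t a b ha k
  proof -
    have D: "((\<lambda>s. h ((x + t *\<^sub>R b) + s *\<^sub>R a) - h (x + s *\<^sub>R a)) has_real_derivative
        ha ((x + t *\<^sub>R b) + s *\<^sub>R a) - ha (x + s *\<^sub>R a)) (at s)" for s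
      by (intro DERIV_diff da)
    obtain \<xi> where \<xi>: "0 < \<xi>" "\<xi> < t"
      "(h ((x + t *\<^sub>R b) + t *\<^sub>R a) - h (x + t *\<^sub>R a)) - (h ((x + t *\<^sub>R b) + 0 *\<^sub>R a) - h (x + 0 *\<^sub>R a))
        = (t - 0) * (ha ((x + t *\<^sub>R b) + \<xi> *\<^sub>R a) - ha (x + \<xi> *\<^sub>R a))"
      using MVT2[OF t, of "\<lambda>s. h ((x + t *\<^sub>R b) + s *\<^sub>R a) - h (x + s *\<^sub>R a)"
          "\<lambda>s. ha ((x + t *\<^sub>R b) + s *\<^sub>R a) - ha (x + s *\<^sub>R a)"] D by blast
    obtain \<eta> where \<eta>: "0 < \<eta>" "\<eta> < t"
      "ha ((x + \<xi> *\<^sub>R a) + t *\<^sub>R b) - ha ((x + \<xi> *\<^sub>R a) + 0 *\<^sub>R b) = (t - 0) * k ((x + \<xi> *\<^sub>R a) + \<eta> *\<^sub>R b)"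
      using MVT2[OF t, of "\<lambda>s. ha ((x + \<xi> *\<^sub>R a) + s *\<^sub>R b)" "\<lambda>s. k ((x + \<xi> *\<^sub>R a) + s *\<^sub>R b)"] dab by blast
    have "\<Delta> t = t * (ha ((x + t *\<^sub>R b) + \<xi> *\<^sub>R a) - ha (x + \<xi> *\<^sub>R a))"
      using \<xi>(3) ab by (auto simp: \<Delta>_def algebra_simps)
    also have "\<dots> = t * (t * k (x + \<xi> *\<^sub>R a + \<eta> *\<^sub>R b))"
      using \<eta>(3) by (simp add: add_ac)
    finally show ?thesis using \<xi> \<eta> by blast
  qed
  have near: "norm (\<xi> *\<^sub>R a + \<eta> *\<^sub>R b) \<le> t * (norm a + norm b)" if "0 < \<xi>" "\<xi> < t" "0 < \<eta>" "\<eta> < t"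
    for \<xi> \<eta> t and a b :: 'a
  proof -
    have "norm (\<xi> *\<^sub>R a + \<eta> *\<^sub>R b) \<le> \<xi> * norm a + \<eta> * norm b"
      using norm_triangle_ineq[of "\<xi> *\<^sub>R a" "\<eta> *\<^sub>R b"] that by simp
    also have "\<dots> \<le> t * norm a + t * norm b"
      using that by (intro add_mono mult_right_mono) auto
    finally show ?thesis by (simp add: distrib_left)
  qed
  have "\<bar>huv x - hvu x\<bar> < e" if "e > 0" for e
  proof -
    obtain d1 where d1: "d1 > 0" "\<And>y. dist y x < d1 \<Longrightarrow> dist (huv y) (huv x) < e / 2"
      using cont(1) \<open>e > 0\<close> unfolding continuous_at_eps_delta by (meson half_gt_zero)
    obtain d2 where d2: "d2 > 0" "\<And>y. dist y x < d2 \<Longrightarrow> dist (hvu y) (hvu x) < e / 2"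
      using cont(2) \<open>e > 0\<close> unfolding continuous_at_eps_delta by (meson half_gt_zero)
    \<comment> \<open>The added 1 keeps \<open>M\<close> positive even if both directions are
      0.\<close>
    define M where "M = norm u + norm v + 1"
    have "M > 0" by (simp add: M_def add_nonneg_pos)
    define t where "t = min d1 d2 / M"
    have t: "t > 0" using d1 d2 \<open>M > 0\<close> by (simp add: t_def)
    have tM: "t * (norm u + norm v) < min d1 d2"
    proof -
      have "t * (norm u + norm v) < t * M" using t by (simp add: M_def)
      also have "\<dots> = min d1 d2" using \<open>M > 0\<close> by (simp add: t_def)
      finally show ?thesis .
    qed
    obtain \<xi> \<eta> where 1: "0 < \<xi>" "\<xi> < t" "0 < \<eta>" "\<eta> < t" "\<Delta> t = t * (t * huv (x + \<xi> *\<^sub>R u + \<eta> *\<^sub>R v))"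
      using key[OF t _ hu huv] by blast
    obtain \<xi>' \<eta>' where 2: "0 < \<xi>'" "\<xi>' < t" "0 < \<eta>'" "\<eta>' < t" "\<Delta> t = t * (t * hvu (x + \<xi>' *\<^sub>R v + \<eta>' *\<^sub>R u))"
      using key[OF t _ hv hvu] by blast
    have "huv (x + \<xi> *\<^sub>R u + \<eta> *\<^sub>R v) = hvu (x + \<xi>' *\<^sub>R v + \<eta>' *\<^sub>R u)"
      using 1(5) 2(5) t by simp
    moreover have "dist (huv (x + \<xi> *\<^sub>R u + \<eta> *\<^sub>R v)) (huv x) < e / 2"
      using near[OF 1(1-4), of u v] tM by (intro d1) (simp add: dist_norm add.assoc)
    moreover have "dist (hvu (x + \<xi>' *\<^sub>R v + \<eta>' *\<^sub>R u)) (hvu x) < e / 2"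
      using near[OF 2(1-4), of v u] tM by (intro d2) (simp add: dist_norm add.assoc add.commute[of "norm v"])
    ultimately show ?thesis unfolding dist_real_def by linarith
  qed
  then show ?thesis by (metis abs_0_eq abs_ge_zero eq_iff_diff_eq_0 less_irrefl order_le_less)
qed

lemma smooth_line_derivative:
  assumes "smooth f"
  shows "((\<lambda>t. f (x + t *\<^sub>R v)) has_vector_derivative ddir v f (x + t *\<^sub>R v)) (at t)"
proof -
  have "((\<lambda>t. x + t *\<^sub>R v) has_derivative (\<lambda>t. t *\<^sub>R v)) (at t)"
    by (auto intro!: derivative_eq_intros)
  then have "((\<lambda>t. f (x + t *\<^sub>R v)) has_derivative (\<lambda>s. frechet_derivative f (at (x + t *\<^sub>R v)) (s *\<^sub>R v))) (at t)"
    by (rule has_derivative_compose) (rule smooth_has_derivative[OF assms])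
  moreover have "linear (frechet_derivative f (at (x + t *\<^sub>R v)))"
    using smooth_has_derivative[OF assms] has_derivative_linear by blast
  ultimately show ?thesis by (simp add: has_vector_derivative_def linear_scale)
qed

lemma ddir_commute:
  fixes f :: "'a::euclidean_space \<Rightarrow> complex"
  assumes "smooth f"
  shows "ddir u (ddir v f) = ddir v (ddir u f)"
proof
  fix x
  \<comment> \<open>The mean value theorem asks for real values, so the function is composed with
    real linear functionals; the real and imaginary parts determine the result.\<close>
  have "F (ddir u (ddir v f) x) = F (ddir v (ddir u f) x)" if F: "bounded_linear F" for F :: "complex \<Rightarrow> real"
  proof (rule symmetric_mixed_real[where h = "\<lambda>x. F (f x)" and hu = "\<lambda>x. F (ddir v f x)" and hv = "\<lambda>x. F (ddir u f x)" and u = v and v = u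
      and huv = "\<lambda>x. F (ddir u (ddir v f) x)" and hvu = "\<lambda>x. F (ddir v (ddir u f) x)" and x = x])
    have d: "((\<lambda>t. F (g (x + t *\<^sub>R w))) has_real_derivative F (ddir w g (x + t *\<^sub>R w))) (at t)"
      if "smooth g" for g :: "'a \<Rightarrow> complex" and x w t
      using bounded_linear.has_vector_derivative[OF F smooth_line_derivative[OF that]]
      by (simp add: has_real_derivative_iff_has_vector_derivative)
    show "((\<lambda>t. F (f (x + t *\<^sub>R v))) has_real_derivative F (ddir v f (x + t *\<^sub>R v))) (at t)" for x t
      by (rule d[OF assms])
    show "((\<lambda>t. F (f (x + t *\<^sub>R u))) has_real_derivative F (ddir u f (x + t *\<^sub>R u))) (at t)" for x t
      by (rule d[OF assms])
    show "((\<lambda>t. F (ddir v f (x + t *\<^sub>R u))) has_real_derivative F (ddir u (ddir v f) (x + t *\<^sub>R u))) (at t)" for x t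
      by (rule d[OF smooth_ddir[OF assms]])
    show "((\<lambda>t. F (ddir u f (x + t *\<^sub>R v))) has_real_derivative F (ddir v (ddir u f) (x + t *\<^sub>R v))) (at t)" for x t
      by (rule d[OF smooth_ddir[OF assms]])
    have c: "isCont (\<lambda>x. F (g x)) x" if "smooth g" for g :: "'a \<Rightarrow> complex"
      using smooth_continuous[OF that] by (intro bounded_linear.isCont[OF F]) (simp add: continuous_on_eq_continuous_at)
    show "isCont (\<lambda>x. F (ddir u (ddir v f) x)) x" "isCont (\<lambda>x. F (ddir v (ddir u f) x)) x"
      by (intro c smooth_ddir assms)+
  qed
  from this[OF bounded_linear_Re] this[OF bounded_linear_Im]
  show "ddir u (ddir v f) x = ddir v (ddir u f) x" by (rule complex_eqI)
qed

section \<open>Commuting Wirtinger derivatives and functions with vanishing jet\<close>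

definition wirt :: "complex \<Rightarrow> 'a \<Rightarrow> 'a \<Rightarrow> ('a::euclidean_space \<Rightarrow> complex) \<Rightarrow> 'a \<Rightarrow> complex" where
  "wirt c u v f = (\<lambda>x. 1 / 2 * (ddir u f x + c * ddir v f x))"

lemma dz_eq_wirt: "dz k = wirt (- \<i>) (axis k 1) (axis k \<i>)"
  and dzbar_eq_wirt: "dzbar k = wirt \<i> (axis k 1) (axis k \<i>)"
  by (auto simp: fun_eq_iff dz_def dzbar_def wirt_def)

lemma smooth_wirt: "smooth f \<Longrightarrow> smooth (wirt c u v f)"
  unfolding wirt_def by (intro smooth_cmult smooth_add smooth_ddir)

lemma ddir_wirt:
  assumes "smooth f"
  shows "ddir w (wirt c u v f) x = wirt c u v (ddir w f) x"
  using fun_cong[OF ddir_commute[OF assms, of w u], of x] fun_cong[OF ddir_commute[OF assms, of w v], of x]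
  by (simp only: wirt_def ddir_cmult ddir_add smooth_cmult smooth_add smooth_ddir assms)

lemma wirt_add: "smooth f \<Longrightarrow> smooth g \<Longrightarrow> wirt c u v (\<lambda>x. f x + g x) = (\<lambda>x. wirt c u v f x + wirt c u v g x)"
  by (simp only: wirt_def ddir_add) (simp add: algebra_simps)

lemma wirt_cmult: "smooth f \<Longrightarrow> wirt c u v (\<lambda>x. b * f x) = (\<lambda>x. b * wirt c u v f x)"
  by (simp only: wirt_def ddir_cmult) (simp add: algebra_simps)

text \<open>Directional derivatives commute and the combinations have constant coefficients. The
  free parameters cover \<open>dz\<close> with \<open>dz\<close>, \<open>dzbar\<close> with
  \<open>dzbar\<close>, and the mixed case.\<close>

lemma wirt_commute:
  assumes "smooth f"
  shows "wirt c u v (wirt c' u' v' f) = wirt c' u' v' (wirt c u v f)"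
proof -
  have "wirt c u v (wirt c' u' v' f) = (\<lambda>x. 1 / 2 * (ddir u (wirt c' u' v' f) x + c * ddir v (wirt c' u' v' f) x))"
    by (rule wirt_def)
  also have "\<dots> = (\<lambda>x. 1 / 2 * (wirt c' u' v' (ddir u f) x + c * wirt c' u' v' (ddir v f) x))"
    by (simp only: ddir_wirt[OF assms])
  also have "\<dots> = wirt c' u' v' (\<lambda>x. 1 / 2 * (ddir u f x + c * ddir v f x))"
    by (simp only: wirt_cmult wirt_add smooth_add smooth_cmult smooth_ddir assms)
  also have "\<dots> = wirt c' u' v' (wirt c u v f)"
    by (simp only: wirt_def[of c u v f])
  finally show ?thesis .
qed

locale commuting_derivations =
  fixes D :: "'n::finite \<Rightarrow> (complex ^ 'n \<Rightarrow> complex) \<Rightarrow> complex ^ 'n \<Rightarrow> complex"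
  assumes smooth_D: "smooth f \<Longrightarrow> smooth (D k f)"
    and D_commute: "smooth f \<Longrightarrow> D j (D k f) = D k (D j f)"
    and D_add: "smooth f \<Longrightarrow> smooth g \<Longrightarrow> D k (\<lambda>z. f z + g z) = (\<lambda>z. D k f z + D k g z)"
    and D_cmult: "smooth f \<Longrightarrow> D k (\<lambda>z. c * f z) = (\<lambda>z. c * D k f z)"
begin

lemma smooth_pow: "smooth f \<Longrightarrow> smooth ((D k ^^ m) f)"
  by (induction m) (auto intro: smooth_D)

lemma smooth_fold: "smooth f \<Longrightarrow> smooth (foldr (\<lambda>k g. (D k ^^ (N k)) g) ks f)"
  by (induction ks) (auto intro: smooth_pow)

lemma smooth_multi: "smooth f \<Longrightarrow> smooth (multi_deriv D N f)"
  unfolding multi_deriv_def by (rule smooth_fold)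

lemma fold_swap:
  assumes E: "\<And>k f. smooth f \<Longrightarrow> D k (E f) = E (D k f)" and f: "smooth f"
  shows "foldr (\<lambda>k g. (D k ^^ (N k)) g) ks (E f) = E (foldr (\<lambda>k g. (D k ^^ (N k)) g) ks f)"
proof -
  have pow: "smooth g \<Longrightarrow> (D k ^^ m) (E g) = E ((D k ^^ m) g)" for k m g
    by (induction m) (auto simp: E smooth_pow)
  show ?thesis by (induction ks) (auto simp: pow smooth_fold f)
qed

lemma multi_swap:
  assumes E: "\<And>k f. smooth f \<Longrightarrow> D k (E f) = E (D k f)" and f: "smooth f"
  shows "multi_deriv D N (E f) = E (multi_deriv D N f)"
  unfolding multi_deriv_def by (rule fold_swap[OF assms])

text \<open>\<open>multi_deriv\<close> applies the coordinates in a fixed order, so an extra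
  \<open>D k\<close> at the innermost place has to travel outwards to the other derivatives in
  direction \<open>k\<close>. The inductive claim distinguishes whether \<open>k\<close> has already
  occurred, as tails of the list lack coordinates.\<close>

lemma multi_step:
  assumes f: "smooth f"
  shows "multi_deriv D N (D k f) = multi_deriv D (N + axis k 1) f"
proof -
  have "distinct ks \<Longrightarrow> foldr (\<lambda>j g. (D j ^^ ((N + axis k 1) $ j)) g) ks f =
      (if k \<in> set ks then foldr (\<lambda>j g. (D j ^^ (N $ j)) g) ks (D k f) else foldr (\<lambda>j g. (D j ^^ (N $ j)) g) ks f)" for ks
  proof (induction ks)
    case (Cons j ks)
    have sw: "foldr (\<lambda>j g. (D j ^^ (N $ j)) g) ks (D k f) = D k (foldr (\<lambda>j g. (D j ^^ (N $ j)) g) ks f)"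
      by (rule fold_swap[OF _ f]) (rule D_commute)
    show ?case
    proof (cases "j = k")
      case True
      then have ax: "(N + axis k 1) $ j = Suc (N $ j)" by (simp add: axis_def)
      have "k \<notin> set ks" using Cons.prems True by auto
      then show ?thesis
        using Cons True unfolding foldr_Cons o_def ax by (simp add: sw funpow_swap1)
    next
      case False
      then have "(N + axis k 1) $ j = N $ j" by (simp add: axis_def)
      then show ?thesis using Cons False by auto
    qed
  qed simp
  moreover define ks where "ks = (SOME ks :: 'n list. distinct ks \<and> set ks = UNIV)"
  have "distinct ks" "set ks = UNIV"
    using someI_ex[of "\<lambda>ks :: 'n list. distinct ks \<and> set ks = UNIV"] finite_distinct_list[of "UNIV :: 'n set"]
    unfolding ks_def by auto
  ultimately show ?thesis by (simp add: multi_deriv_def ks_def[symmetric])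
qed

lemma multi_add:
  assumes "smooth f" "smooth g"
  shows "multi_deriv D N (\<lambda>z. f z + g z) = (\<lambda>z. multi_deriv D N f z + multi_deriv D N g z)"
proof -
  have pow: "smooth f \<Longrightarrow> smooth g \<Longrightarrow> (D k ^^ m) (\<lambda>z. f z + g z) = (\<lambda>z. (D k ^^ m) f z + (D k ^^ m) g z)" for k m f g
    by (induction m) (auto simp: D_add smooth_pow)
  have "foldr (\<lambda>k g. (D k ^^ (N $ k)) g) ks (\<lambda>z. f z + g z) =
      (\<lambda>z. foldr (\<lambda>k g. (D k ^^ (N $ k)) g) ks f z + foldr (\<lambda>k g. (D k ^^ (N $ k)) g) ks g z)" for ks
    by (induction ks) (auto simp: pow smooth_fold assms)
  then show ?thesis by (simp add: multi_deriv_def)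
qed

lemma multi_cmult:
  assumes "smooth f"
  shows "multi_deriv D N (\<lambda>z. c * f z) = (\<lambda>z. c * multi_deriv D N f z)"
proof -
  have pow: "smooth f \<Longrightarrow> (D k ^^ m) (\<lambda>z. c * f z) = (\<lambda>z. c * (D k ^^ m) f z)" for k m f
    by (induction m) (auto simp: D_cmult smooth_pow)
  have "foldr (\<lambda>k g. (D k ^^ (N $ k)) g) ks (\<lambda>z. c * f z) =
      (\<lambda>z. c * foldr (\<lambda>k g. (D k ^^ (N $ k)) g) ks f z)" for ks
    by (induction ks) (auto simp: pow smooth_fold assms)
  then show ?thesis by (simp add: multi_deriv_def)
qed

end

interpretation dz: commuting_derivations dz
  by unfold_locales (auto simp: dz_eq_wirt smooth_wirt wirt_add wirt_cmult intro: wirt_commute)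

interpretation dzbar: commuting_derivations dzbar
  by unfold_locales (auto simp: dzbar_eq_wirt smooth_wirt wirt_add wirt_cmult intro: wirt_commute)

lemma ddir_eq_wirtinger:
  fixes f :: "complex ^ 'n \<Rightarrow> complex"
  assumes "smooth f"
  shows "ddir v f z = (\<Sum>k\<in>UNIV. v $ k * dz k f z + cnj (v $ k) * dzbar k f z)"
proof -
  define L where "L = frechet_derivative f (at z)"
  have L: "linear L" unfolding L_def using smooth_has_derivative[OF assms] has_derivative_linear by blast
  have "v = (\<Sum>k\<in>UNIV. Re (v $ k) *\<^sub>R axis k 1 + Im (v $ k) *\<^sub>R axis k \<i>)"
  proof (simp add: vec_eq_iff sum_component, intro allI)
    fix i
    have "(\<Sum>k\<in>UNIV. Re (v $ k) *\<^sub>R axis k 1 $ i + Im (v $ k) *\<^sub>R axis k \<i> $ i)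
       = (\<Sum>k\<in>UNIV. if k = i then of_real (Re (v $ i)) + of_real (Im (v $ i)) * \<i> else 0)"
      by (intro sum.cong refl) (simp add: axis_def scaleR_conv_of_real)
    then show "v $ i = (\<Sum>k\<in>UNIV. Re (v $ k) *\<^sub>R axis k 1 $ i + Im (v $ k) *\<^sub>R axis k \<i> $ i)"
      by (simp add: complex_eq_iff)
  qed
  then have "L v = L (\<Sum>k\<in>UNIV. Re (v $ k) *\<^sub>R axis k 1 + Im (v $ k) *\<^sub>R axis k \<i>)" by simp
  also have "\<dots> = (\<Sum>k\<in>UNIV. Re (v $ k) *\<^sub>R L (axis k 1) + Im (v $ k) *\<^sub>R L (axis k \<i>))"
    by (simp add: linear_sum[OF L] linear_add[OF L] linear_scale[OF L])
  also have "\<dots> = (\<Sum>k\<in>UNIV. v $ k * dz k f z + cnj (v $ k) * dzbar k f z)"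
    by (intro sum.cong refl) (simp add: dz_def dzbar_def L_def[symmetric] complex_eq_iff field_simps)
  finally show ?thesis by (simp add: L_def)
qed

definition flat :: "complex ^ 'n::finite \<Rightarrow> (complex ^ 'n \<Rightarrow> complex) \<Rightarrow> bool" where
  "flat p f \<longleftrightarrow> smooth f \<and> (\<forall>R S. dz_multi R (dzbar_multi S f) p = 0)"

lemma flat_add: "flat p f \<Longrightarrow> flat p g \<Longrightarrow> flat p (\<lambda>z. f z + g z)"
  by (simp add: flat_def smooth_add dz.multi_add dzbar.multi_add dzbar.smooth_multi)

lemma flat_cmult: "flat p f \<Longrightarrow> flat p (\<lambda>z. c * f z)"
  by (simp add: flat_def smooth_cmult dz.multi_cmult dzbar.multi_cmult dzbar.smooth_multi)

lemma multi_deriv_0: "multi_deriv D 0 f = f"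
proof -
  have "foldr (\<lambda>k g. (D k ^^ (0 $ k)) g) ks f = f" for ks by (induction ks) auto
  then show ?thesis by (simp add: multi_deriv_def)
qed

lemma flat_sum:
  assumes "finite I" "I \<noteq> {}" "\<And>i. i \<in> I \<Longrightarrow> flat p (g i)"
  shows "flat p (\<lambda>z. \<Sum>i\<in>I. g i z)"
  using assms by (induction I rule: finite_ne_induct) (auto intro: flat_add)

lemma flat_dz:
  assumes "flat p f"
  shows "flat p (dz k f)" "flat p (dzbar k f)"
proof -
  have f: "smooth f" using assms by (simp add: flat_def)
  have "dzbar_multi S (dz k f) = dz k (dzbar_multi S f)" for S
    by (rule dzbar.multi_swap[OF _ f]) (simp add: dz_eq_wirt dzbar_eq_wirt wirt_commute)
  then show "flat p (dz k f)"
    using assms f by (simp add: flat_def dz.smooth_D dz.multi_step dzbar.smooth_multi)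
  show "flat p (dzbar k f)"
    using assms f by (simp add: flat_def dzbar.smooth_D dzbar.multi_step)
qed

text \<open>A directional derivative is a combination of Wirtinger derivatives, and these only shift
  the jet. Thus flatness survives the repeated differentiation along a line.\<close>

lemma flat_ddir:
  assumes "flat p f"
  shows "flat p (ddir v f)"
proof -
  have f: "smooth f" using assms by (simp add: flat_def)
  have "ddir v f = (\<lambda>z. \<Sum>k\<in>UNIV. v $ k * dz k f z + cnj (v $ k) * dzbar k f z)"
    by (rule ext) (rule ddir_eq_wirtinger[OF f])
  then show ?thesis
    by (simp add: flat_sum flat_add flat_cmult flat_dz assms)
qed

section \<open>Uniqueness of real-analytic functions with a given jet\<close>

lemma line_power_series_deriv:
  assumes f: "smooth f" and r: "0 < r"
    and s: "\<And>t. \<bar>t\<bar> < r \<Longrightarrow> (\<lambda>n. c n * of_real t ^ n) sums f (p + t *\<^sub>R v)"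
    and t: "\<bar>t\<bar> < r"
  shows "(\<lambda>n. diffs c n * of_real t ^ n) sums (ddir v f (p + t *\<^sub>R v) :: complex)"
proof -
  \<comment> \<open>Termwise differentiation at \<open>t\<close> asks for convergence at some
    strictly larger radius.\<close>
  define K where "K = (\<bar>t\<bar> + r) / 2"
  have K: "\<bar>t\<bar> < K" "K < r" "0 < K" using t r by (auto simp: K_def)
  have sm: "summable (\<lambda>n. c n * (of_real K :: complex) ^ n)"
    using s[of K] K by (simp add: sums_iff)
  have smz: "summable (\<lambda>n. c n * z ^ n)" if "norm z < K" for z
    using powser_inside[OF sm, of z] that K by simp
  have d: "((\<lambda>z. \<Sum>n. c n * z ^ n) has_field_derivative (\<Sum>n. diffs c n * of_real t ^ n)) (at (of_real t))"
    by (rule termdiffs_strong[OF sm]) (use K in auto)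
  have sd: "summable (\<lambda>n. diffs c n * (of_real t :: complex) ^ n)"
    by (rule termdiff_converges[of _ K]) (use K smz in auto)
  have "((\<lambda>u. \<Sum>n. c n * of_real u ^ n) has_vector_derivative (\<Sum>n. diffs c n * of_real t ^ n)) (at t)"
    using has_vector_derivative_real_field[OF d] by simp
  then have "((\<lambda>u. f (p + u *\<^sub>R v)) has_vector_derivative (\<Sum>n. diffs c n * of_real t ^ n)) (at t)"
  proof (rule has_vector_derivative_transform_within_open[of _ _ _ "{-r<..<r}"])
    show "(\<Sum>n. c n * of_real u ^ n) = f (p + u *\<^sub>R v)" if "u \<in> {-r<..<r}" for u
      using s[of u] that by (simp add: sums_iff abs_less_iff)
  qed (use t in auto)
  then have "(\<Sum>n. diffs c n * of_real t ^ n) = ddir v f (p + t *\<^sub>R v)"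
    using smooth_line_derivative[OF f] vector_derivative_unique_at by blast
  with sd show ?thesis by (simp add: sums_iff)
qed

text \<open>The value at parameter 0 annihilates the constant coefficient. Differentiation along the
  line gives a series with coefficients \<open>diffs c\<close> for a function that is flat again,
  and \<open>diffs c n\<close> is a nonzero multiple of \<open>c (Suc n)\<close>.\<close>

lemma flat_line_power_series_0:
  assumes "flat p f" "0 < r"
    and "\<And>t. \<bar>t\<bar> < r \<Longrightarrow> (\<lambda>n. c n * of_real t ^ n) sums f (p + t *\<^sub>R v)"
  shows "c n = 0"
  using assms
proof (induction n arbitrary: f c)
  case 0
  have "dz_multi 0 (dzbar_multi 0 f) p = 0" using 0(1) unfolding flat_def by blast
  then have "f p = 0" by (simp add: multi_deriv_0)
  moreover have "(\<lambda>n. c n * 0 ^ n) sums f p" using 0(3)[of 0] 0(2) by simp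
  ultimately show ?case by (simp add: powser_sums_zero_iff)
next
  case (Suc n)
  have "diffs c n = 0"
  proof (rule Suc.IH[OF flat_ddir[OF Suc.prems(1), of v] Suc.prems(2)])
    show "(\<lambda>n. diffs c n * of_real t ^ n) sums ddir v f (p + t *\<^sub>R v)" if "\<bar>t\<bar> < r" for t
      using Suc.prems that by (intro line_power_series_deriv[where r = r]) (auto simp: flat_def)
  qed
  then show ?case by (simp add: diffs_def del: of_nat_Suc)
qed

section \<open>The identity theorem along real lines\<close>

definition line_analytic :: "(real \<Rightarrow> complex) \<Rightarrow> bool" where
  "line_analytic \<phi> \<longleftrightarrow> (\<forall>t0. \<exists>c r. 0 < r \<and> (\<forall>t. \<bar>t\<bar> < r \<longrightarrow> (\<lambda>n. c n * of_real t ^ n) sums \<phi> (t0 + t)))"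

lemma real_analytic_line:
  fixes f :: "complex ^ 'n::finite \<Rightarrow> complex"
  assumes "real_analytic f"
  shows "line_analytic (\<lambda>t. f (p + t *\<^sub>R v))"
  unfolding line_analytic_def
proof
  fix t0 :: real
  define a where "a = p + t0 *\<^sub>R v"
  obtain c :: "nat ^ 'n \<Rightarrow> nat ^ 'n \<Rightarrow> complex" and r where r: "r > 0"
    and s: "\<And>z. z \<in> ball a r \<Longrightarrow> ((\<lambda>(K, L). c K L * of_real (\<Prod>k\<in>UNIV. Re ((z - a) $ k) ^ (K $ k))
                            * of_real (\<Prod>k\<in>UNIV. Im ((z - a) $ k) ^ (L $ k))) has_sum f z) UNIV"
    using assms unfolding real_analytic_def by blast
  \<comment> \<open>Collecting the monomials by total degree turns the series in many variables into
    a power series in the line parameter.\<close>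
  define F :: "nat \<Rightarrow> ('n midx2) set" where "F n = {(K, L). mabs K + mabs L = n}" for n
  have finF: "finite (F n)" for n
  proof (rule finite_subset)
    have le: "K $ k \<le> mabs K" for K :: "nat ^ 'n" and k
      unfolding mabs_def by (rule member_le_sum) auto
    show "F n \<subseteq> {..(\<chi> k. n)} \<times> {..(\<chi> k. n)}"
    proof
      fix T assume "T \<in> F n"
      then have "mabs (fst T) \<le> n" "mabs (snd T) \<le> n" by (auto simp: F_def)
      then have "fst T $ k \<le> n" "snd T $ k \<le> n" for k
        using le[of "fst T" k] le[of "snd T" k] by linarith+
      then show "T \<in> {..(\<chi> k. n)} \<times> {..(\<chi> k. n)}"
        by (simp add: mem_Times_iff less_eq_vec_def)
    qed
  qed simp
  define d where "d = (\<lambda>(K, L). c K L * of_real (\<Prod>k\<in>UNIV. Re (v $ k) ^ (K $ k)) * of_real (\<Prod>k\<in>UNIV. Im (v $ k) ^ (L $ k)))"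
  \<comment> \<open>The radius keeps \<open>t *\<^sub>R v\<close> inside the ball; the added 1 takes
    care of \<open>v = 0\<close>.\<close>
  have "(\<lambda>n. (\<Sum>T\<in>F n. d T) * of_real t ^ n) sums f (p + (t0 + t) *\<^sub>R v)" if t: "\<bar>t\<bar> < r / (norm v + 1)" for t
  proof -
    have nv: "norm v + 1 > 0" by (simp add: add_nonneg_pos)
    have "norm (t *\<^sub>R v) \<le> \<bar>t\<bar> * (norm v + 1)" by (simp add: algebra_simps)
    also have "\<dots> < r" using t nv by (simp add: pos_less_divide_eq)
    finally have "a + t *\<^sub>R v \<in> ball a r" by (simp add: dist_norm)
    from s[OF this] have "((\<lambda>(K, L). c K L * of_real (\<Prod>k\<in>UNIV. Re ((t *\<^sub>R v) $ k) ^ (K $ k))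
                            * of_real (\<Prod>k\<in>UNIV. Im ((t *\<^sub>R v) $ k) ^ (L $ k))) has_sum f (a + t *\<^sub>R v)) UNIV"
      by simp
    moreover have "c K L * of_real (\<Prod>k\<in>UNIV. Re ((t *\<^sub>R v) $ k) ^ (K $ k)) * of_real (\<Prod>k\<in>UNIV. Im ((t *\<^sub>R v) $ k) ^ (L $ k))
        = d (K, L) * of_real t ^ (mabs K + mabs L)" for K L
      by (simp add: d_def power_mult_distrib prod.distrib mabs_def power_add power_sum)
    ultimately have "((\<lambda>(K, L). d (K, L) * of_real t ^ (mabs K + mabs L)) has_sum f (a + t *\<^sub>R v)) UNIV"
      by (simp only:)
    moreover have "bij_betw snd (Sigma UNIV F) UNIV"
      by (rule bij_betwI[where g = "\<lambda>(K, L). (mabs K + mabs L, (K, L))"]) (auto simp: F_def)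
    ultimately have "((\<lambda>(n, T). d T * of_real t ^ n) has_sum f (a + t *\<^sub>R v)) (Sigma UNIV F)"
      by (subst (asm) has_sum_reindex_bij_betw[symmetric, of snd "Sigma UNIV F"])
         (auto simp: F_def elim!: has_sum_cong[THEN iffD1, rotated])
    then have "((\<lambda>n. (\<Sum>T\<in>F n. d T) * of_real t ^ n) has_sum f (a + t *\<^sub>R v)) UNIV"
      by (rule has_sum_SigmaD) (simp add: has_sum_finiteI finF sum_distrib_right)
    then show ?thesis
      by (simp add: a_def scaleR_add_left add.assoc has_sum_imp_sums)
  qed
  then show "\<exists>c r. 0 < r \<and> (\<forall>t. \<bar>t\<bar> < r \<longrightarrow> (\<lambda>n. c n * of_real t ^ n) sums f (p + (t0 + t) *\<^sub>R v))"
    using r by (intro exI[of _ "\<lambda>n. \<Sum>T\<in>F n. d T"] exI[of _ "r / (norm v + 1)"]) (auto intro!: divide_pos_pos add_nonneg_pos)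
qed

lemma line_analytic_diff:
  assumes "line_analytic f" "line_analytic g"
  shows "line_analytic (\<lambda>t. f t - g t)"
  unfolding line_analytic_def
proof
  fix t0
  obtain c r c' r' where *: "0 < r" "\<And>t. \<bar>t\<bar> < r \<Longrightarrow> (\<lambda>n. c n * of_real t ^ n) sums f (t0 + t)"
    "0 < r'" "\<And>t. \<bar>t\<bar> < r' \<Longrightarrow> (\<lambda>n. c' n * of_real t ^ n) sums g (t0 + t)"
    using assms unfolding line_analytic_def by metis
  then have "(\<lambda>n. (c n - c' n) * of_real t ^ n) sums (f (t0 + t) - g (t0 + t))" if "\<bar>t\<bar> < min r r'" for t
    using sums_diff[OF *(2) *(4), of t] that by (simp add: left_diff_distrib)
  then show "\<exists>c r. 0 < r \<and> (\<forall>t. \<bar>t\<bar> < r \<longrightarrow> (\<lambda>n. c n * of_real t ^ n) sums (f (t0 + t) - g (t0 + t)))"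
    using * by (intro exI[of _ "\<lambda>n. c n - c' n"] exI[of _ "min r r'"]) auto
qed

text \<open>Connectedness of the real line: the set \<open>Z\<close> of points near which the
  function vanishes is open, closed and nonempty. It is closed because zeros of a power series are
  isolated: at a limit point outside \<open>Z\<close> zeros accumulate, so all coefficients of the
  local expansion vanish, which puts the point into \<open>Z\<close>. The expansion is summed at
  complex arguments, where the isolation of zeros is stated.\<close>

lemma line_analytic_eq_0:
  assumes "line_analytic \<phi>" "0 < e" "\<And>t. \<bar>t\<bar> < e \<Longrightarrow> \<phi> t = 0"
  shows "\<phi> t = 0"
proof -
  define Z where "Z = {t. \<exists>e>0. \<forall>u. dist u t < e \<longrightarrow> \<phi> u = 0}"
  have "open Z"
    unfolding open_dist
  proof
    fix t assume "t \<in> Z"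
    then obtain e where e: "e > 0" "\<And>u. dist u t < e \<Longrightarrow> \<phi> u = 0" by (auto simp: Z_def)
    have "u \<in> Z" if "dist u t < e / 2" for u
      unfolding Z_def
    proof (intro CollectI exI[of _ "e / 2"] conjI allI impI)
      fix w assume "dist w u < e / 2"
      then have "dist w t < e" using that dist_triangle[of w t u] by linarith
      then show "\<phi> w = 0" by (rule e)
    qed (use e in auto)
    then show "\<exists>e>0. \<forall>y. dist y t < e \<longrightarrow> y \<in> Z" using e by (intro exI[of _ "e / 2"]) auto
  qed
  moreover have "closed Z"
    unfolding closure_subset_eq[symmetric]
  proof
    fix t assume t: "t \<in> closure Z"
    show "t \<in> Z"
    proof (rule ccontr)
      assume nZ: "t \<notin> Z"
      obtain c r where r: "0 < r" and s: "\<And>h. \<bar>h\<bar> < r \<Longrightarrow> (\<lambda>n. c n * of_real h ^ n) sums \<phi> (t + h)"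
        using assms(1) unfolding line_analytic_def by metis
      have zeros: "\<exists>h. h \<noteq> 0 \<and> \<bar>h\<bar> < d \<and> \<phi> (t + h) = 0" if "d > 0" for d
      proof -
        obtain u where "u \<in> Z" "dist u t < d" using t \<open>d > 0\<close> by (meson closure_approachable)
        then show ?thesis using nZ by (intro exI[of _ "u - t"]) (auto simp: Z_def dist_real_def)
      qed
      define F where "F z = (\<Sum>n. c n * z ^ n)" for z
      have sm: "summable (\<lambda>n. c n * (of_real (r/2) :: complex) ^ n)"
        using s[of "r/2"] r by (simp add: sums_iff)
      have Fs: "(\<lambda>n. c n * z ^ n) sums F z" if "norm z < r / 2" for z
        using powser_inside[OF sm, of z] that r by (simp add: F_def summable_sums)
      have F\<phi>: "F (of_real h) = \<phi> (t + h)" if "\<bar>h\<bar> < r / 2" for h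
        using s[of h] that r by (simp add: F_def sums_iff)
      have Fc: "isCont F 0"
        unfolding F_def by (rule isCont_powser[OF sm]) (use r in auto)
      \<comment> \<open>\<open>powser_0_nonzero\<close> concerns coefficients of positive index, so
        the constant term is treated separately, by continuity.\<close>
      have F0: "F 0 = 0"
      proof (rule ccontr)
        assume "F 0 \<noteq> 0"
        then obtain d where d: "d > 0" "\<And>z. dist z 0 < d \<Longrightarrow> dist (F z) (F 0) < norm (F 0)"
          using Fc unfolding continuous_at_eps_delta by (metis zero_less_norm_iff)
        obtain h where h: "\<bar>h\<bar> < min d (r/2)" "\<phi> (t + h) = 0" using zeros[of "min d (r/2)"] d r by auto
        then have "F (of_real h) = 0" using F\<phi> by simp
        then show False using d(2)[of "of_real h"] h by (simp add: dist_norm)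
      qed
      have "c m = 0" for m
      proof (rule ccontr)
        assume m: "c m \<noteq> 0"
        have "c 0 = F 0" using Fs[of 0] r by (simp add: powser_sums_zero_iff)
        then have "m > 0" using m F0 by (metis gr0I)
        obtain q where q: "0 < q" "\<And>z. z \<in> cball 0 q - {0} \<Longrightarrow> F z \<noteq> 0"
          using powser_0_nonzero[of "r/2" 0 c F m] r Fs F0 m \<open>m > 0\<close> by auto
        obtain h where h: "h \<noteq> 0" "\<bar>h\<bar> < min q (r/2)" "\<phi> (t + h) = 0" using zeros[of "min q (r/2)"] q r by auto
        then have "F (of_real h) = 0" using F\<phi> by simp
        then show False using q(2)[of "of_real h"] h by auto
      qed
      then have "\<phi> (t + h) = 0" if "\<bar>h\<bar> < r" for h
        using s[OF that] sums_unique2[OF _ sums_zero] by auto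
      then have "\<phi> u = 0" if "dist u t < r" for u
        using that by (metis add.commute diff_add_cancel dist_real_def)
      then show False using nZ r by (auto simp: Z_def)
    qed
  qed
  moreover have "0 \<in> Z" using assms by (auto simp: Z_def)
  ultimately have "Z = UNIV" using clopen[of Z] by blast
  then have "t \<in> Z" by blast
  then show ?thesis by (auto simp: Z_def)
qed

lemma real_analytic_eq_ent:
  assumes f: "smooth f" "real_analytic f" and a: "entire_array (njet s p f)" and s: "s > 0"
  shows "f = ent s p (njet s p f)"
proof
  fix z
  define E where "E = ent s p (njet s p f)"
  define g where "g = (\<lambda>z. f z + (- 1) * E z)"
  have E: "smooth E" "real_analytic E" unfolding E_def using a by (rule smooth_ent, rule real_analytic_ent)
  have sg: "smooth g" unfolding g_def by (intro smooth_add smooth_cmult f E)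
  have "dz_multi R (dzbar_multi S g) p = 0" for R S
  proof -
    have "njet s p E (R, S) = njet s p f (R, S)" unfolding E_def using njet_ent[OF a s] by simp
    then have "dz_multi R (dzbar_multi S E) p = dz_multi R (dzbar_multi S f) p"
      using s by (simp add: njet_def)
    then show ?thesis
      using f E unfolding g_def
      by (simp only: dz.multi_add dzbar.multi_add dz.multi_cmult dzbar.multi_cmult smooth_cmult dzbar.smooth_multi) simp
  qed
  then have g: "flat p g" using sg by (simp add: flat_def)
  define v where "v = z - p"
  define \<phi> where "\<phi> = (\<lambda>t. f (p + t *\<^sub>R v) - E (p + t *\<^sub>R v))"
  have la: "line_analytic \<phi>"
    unfolding \<phi>_def by (intro line_analytic_diff real_analytic_line f E)
  then obtain c r where r: "0 < r" and cs: "\<And>t. \<bar>t\<bar> < r \<Longrightarrow> (\<lambda>n. c n * of_real t ^ n) sums \<phi> t"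
    unfolding line_analytic_def by (metis add.left_neutral)
  have "c n = 0" for n
    by (rule flat_line_power_series_0[OF g r, of c v]) (use cs in \<open>auto simp: \<phi>_def g_def\<close>)
  then have "\<phi> t = 0" if "\<bar>t\<bar> < r" for t
    using cs[OF that] sums_unique2[OF _ sums_zero] by auto
  then have "\<phi> 1 = 0" by (rule line_analytic_eq_0[OF la r])
  then show "f z = ent s p (njet s p f) z" by (simp add: \<phi>_def v_def E_def)
qed

section \<open>The star product on arrays\<close>

text \<open>A majorant with nonnegative terms: the arrays of absolute values stay in the algebra,
  since the functionals depend on absolute values only.\<close>

lemma cmod_star_term_le:
  "cmod (star_term a b N T) \<le> cmod (star_term (\<lambda>T. of_real (cmod (a T))) (\<lambda>T. of_real (cmod (b T))) N T)"
  and star_term_abs_eq: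
  "star_term (\<lambda>T. of_real (cmod (a T))) (\<lambda>T. of_real (cmod (b T))) N T =
     of_real (cmod (star_term (\<lambda>T. of_real (cmod (a T))) (\<lambda>T. of_real (cmod (b T))) N T))"
proof -
  obtain R S where T: "T = (R, S)" by (cases T)
  define X where "X = 1 / real (mfact N) * (\<Sum>I\<in>{..R}. \<Sum>J\<in>{..S}. real (mbinom R I * mbinom S J) *
        (cmod (a ((I, J) + (N, 0))) * cmod (b ((R - I, S - J) + (0, N)))))"
  have X0: "X \<ge> 0" unfolding X_def by (intro mult_nonneg_nonneg sum_nonneg) auto
  have eq: "star_term (\<lambda>T. of_real (cmod (a T))) (\<lambda>T. of_real (cmod (b T))) N T = of_real X"
    by (simp add: star_term_def conv_array_def X_def T)
  show "star_term (\<lambda>T. of_real (cmod (a T))) (\<lambda>T. of_real (cmod (b T))) N T =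
     of_real (cmod (star_term (\<lambda>T. of_real (cmod (a T))) (\<lambda>T. of_real (cmod (b T))) N T))"
    using X0 by (simp add: eq)
  have "cmod (star_term a b N T) \<le> X"
    unfolding star_term_def conv_array_def norm_mult T prod.case X_def
    by (intro mult_mono order_trans[OF norm_sum] sum_mono)
       (auto simp: norm_mult norm_divide intro!: order_trans[OF norm_sum] sum_mono sum_nonneg)
  then show "cmod (star_term a b N T) \<le> cmod (star_term (\<lambda>T. of_real (cmod (a T))) (\<lambda>T. of_real (cmod (b T))) N T)"
    using X0 by (simp add: eq)
qed

lemma wick_arrays_abs: "a \<in> wick_arrays \<Longrightarrow> (\<lambda>T. of_real (cmod (a T))) \<in> wick_arrays"
  by (rule wick_arrays_mono) auto

lemma entire_array_star_term:
  assumes "entire_array a" "entire_array b"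
  shows "entire_array (star_term a b N)"
    and "cent (star_term a b N) \<xi> = of_real (1 / mfact N) * (cent (\<lambda>T. a (T + (N, 0))) \<xi> * cent (\<lambda>T. b (T + (0, N))) \<xi>)"
proof -
  have c: "entire_array (conv_array (\<lambda>T. a (T + (N, 0))) (\<lambda>T. b (T + (0, N))))"
    by (intro entire_array_conv entire_array_shift assms)
  show "entire_array (star_term a b N)"
    unfolding star_term_def[abs_def] by (rule entire_array_cmult[OF c])
  show "cent (star_term a b N) \<xi> = of_real (1 / mfact N) * (cent (\<lambda>T. a (T + (N, 0))) \<xi> * cent (\<lambda>T. b (T + (0, N))) \<xi>)"
    unfolding star_term_def[abs_def] cent_cmult[OF c]
    by (simp only: cent_conv[OF entire_array_shift[OF assms(1)] entire_array_shift[OF assms(2)]])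
qed

text \<open>The double series over \<open>T\<close> and \<open>N\<close> converges absolutely: its
  sums over \<open>N\<close> are dominated by the coefficients of the star product of the absolute
  arrays, and that array is entire. Summing over \<open>N\<close> first gives the value of the star
  product, summing over \<open>T\<close> first gives the products of derivatives.\<close>

lemma cent_star_has_sum:
  fixes a b :: "'n::finite midx2 \<Rightarrow> complex"
  assumes "a \<in> wick_arrays" "b \<in> wick_arrays"
  shows "((\<lambda>N. of_real (1 / mfact N) * (cent (\<lambda>T. a (T + (N, 0))) \<xi> * cent (\<lambda>T. b (T + (0, N))) \<xi>))
    has_sum cent (star_array UNIV a b) \<xi>) UNIV"
proof -
  define a' b' where "a' = (\<lambda>T. complex_of_real (cmod (a T)))" and "b' = (\<lambda>T. complex_of_real (cmod (b T)))"
  have wa: "a' \<in> wick_arrays" "b' \<in> wick_arrays" unfolding a'_def b'_def by (intro wick_arrays_abs assms)+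
  define f where "f = (\<lambda>(T, N). star_term a b N T * eterm T \<xi>)"
  have inner: "(\<Sum>\<^sub>\<infinity>N. ennreal (cmod (star_term a b N T))) \<le> ennreal (cmod (star_array UNIV a' b' T))" for T
  proof -
    have sm: "(\<lambda>N. cmod (star_term a' b' N T)) summable_on UNIV"
      using star_term_summable[OF wa, of T UNIV] by (simp only: summable_on_iff_abs_summable_on_complex)
    have eq: "star_array UNIV a' b' T = of_real (infsum (\<lambda>N. cmod (star_term a' b' N T)) UNIV)"
    proof -
      have "star_array UNIV a' b' T = (\<Sum>\<^sub>\<infinity>N. of_real (cmod (star_term a' b' N T)))"
        unfolding star_array_def a'_def b'_def by (rule infsum_cong) (rule star_term_abs_eq)
      also have "\<dots> = of_real (infsum (\<lambda>N. cmod (star_term a' b' N T)) UNIV)"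
        by (rule infsumI) (rule has_sum_of_real[OF has_sum_infsum[OF sm]])
      finally show ?thesis .
    qed
    have "(\<Sum>\<^sub>\<infinity>N. ennreal (cmod (star_term a b N T))) \<le> (\<Sum>\<^sub>\<infinity>N. ennreal (cmod (star_term a' b' N T)))"
      unfolding a'_def b'_def by (intro infsum_mono_ennreal ennreal_leI cmod_star_term_le)
    also have "\<dots> = ennreal (infsum (\<lambda>N. cmod (star_term a' b' N T)) UNIV)"
      by (rule infsum_ennreal[OF sm]) simp
    also have "\<dots> = ennreal (cmod (star_array UNIV a' b' T))"
      by (simp add: eq infsum_nonneg)
    finally show ?thesis .
  qed
  have "infsum (\<lambda>x. ennreal (cmod (f x))) UNIV
      = (\<Sum>\<^sub>\<infinity>(T, N)\<in>UNIV \<times> UNIV. ennreal (cmod (eterm T \<xi>)) * ennreal (cmod (star_term a b N T)))"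
    by (simp add: f_def case_prod_unfold norm_mult ennreal_mult mult.commute)
  also have "\<dots> = (\<Sum>\<^sub>\<infinity>T. ennreal (cmod (eterm T \<xi>)) * (\<Sum>\<^sub>\<infinity>N. ennreal (cmod (star_term a b N T))))"
    by (subst infsum_Sigma_ennreal) (simp add: infsum_cmult_ennreal)
  also have "\<dots> \<le> (\<Sum>\<^sub>\<infinity>T. ennreal (cmod (eterm T \<xi>)) * ennreal (cmod (star_array UNIV a' b' T)))"
    by (intro infsum_mono_ennreal mult_left_mono inner) auto
  also have "\<dots> < \<infinity>"
    using wick_arrays_entire[OF wick_arrays_star[OF wa, of UNIV], unfolded entire_array_iff_ennreal, rule_format, of \<xi>]
    by (simp only: mult.commute)
  finally have "f summable_on UNIV" by (simp only: summable_on_iff_infsum_ennreal_cmod)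
  then have f: "(f has_sum infsum f UNIV) (UNIV \<times> UNIV)" by simp
  have ent: "entire_array a" "entire_array b" by (intro wick_arrays_entire assms)+
  have "((\<lambda>T. star_array UNIV a b T * eterm T \<xi>) has_sum infsum f UNIV) UNIV"
  proof (rule has_sum_SigmaD[OF f])
    show "((\<lambda>N. f (T, N)) has_sum star_array UNIV a b T * eterm T \<xi>) UNIV" for T
      unfolding f_def prod.case star_array_def
      by (intro has_sum_cmult_left has_sum_infsum star_term_summable assms)
  qed
  then have s: "infsum f UNIV = cent (star_array UNIV a b) \<xi>"
    unfolding cent_def by (rule infsumI[symmetric])
  have "((\<lambda>(N, T). f (T, N)) has_sum infsum f UNIV) (UNIV \<times> UNIV)"
    using f by (subst (asm) has_sum_swap) (simp add: case_prod_unfold)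
  then have "((\<lambda>N. cent (star_term a b N) \<xi>) has_sum infsum f UNIV) UNIV"
  proof (rule has_sum_SigmaD)
    show "((\<lambda>T. case (N, T) of (N, T) \<Rightarrow> f (T, N)) has_sum cent (star_term a b N) \<xi>) UNIV" for N
      unfolding f_def prod.case by (intro has_sum_cent entire_array_star_term ent)
  qed
  then show ?thesis by (simp only: s entire_array_star_term[OF ent])
qed

section \<open>Star products with exponentials\<close>

definition exp_array :: "complex \<Rightarrow> complex ^ 'n::finite \<Rightarrow> complex ^ 'n \<Rightarrow> 'n midx2 \<Rightarrow> complex" where
  "exp_array c \<alpha> \<beta> = (\<lambda>(R, S). c * (mpow \<alpha> R * mpow \<beta> S))"

lemma wick_arrays_exp_array: "exp_array c \<alpha> \<beta> \<in> wick_arrays"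
proof (rule wick_arrays_geometric[of _ "cmod c" "max (norm \<alpha>) (norm \<beta>)"])
  fix R S
  have "cmod (mpow \<alpha> R) \<le> max (norm \<alpha>) (norm \<beta>) ^ mabs R" "cmod (mpow \<beta> S) \<le> max (norm \<alpha>) (norm \<beta>) ^ mabs S"
    by (intro cmod_mpow_le; metis Finite_Cartesian_Product.norm_nth_le max.coboundedI1 max.coboundedI2)+
  then have "cmod (mpow \<alpha> R) * cmod (mpow \<beta> S) \<le> max (norm \<alpha>) (norm \<beta>) ^ mabs R * max (norm \<alpha>) (norm \<beta>) ^ mabs S"
    by (intro mult_mono) (auto simp: le_max_iff_disj)
  then show "cmod (exp_array c \<alpha> \<beta> (R, S)) \<le> cmod c * max (norm \<alpha>) (norm \<beta>) ^ (mabs R + mabs S)"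
    by (simp add: exp_array_def norm_mult power_add mult_left_mono)
qed (auto simp: le_max_iff_disj)

lemma cent_exp_array:
  "cent (exp_array c \<alpha> \<beta>) \<xi> = c * exp ((\<Sum>k\<in>UNIV. \<alpha> $ k * fst \<xi> $ k) + (\<Sum>k\<in>UNIV. \<beta> $ k * snd \<xi> $ k))"
proof -
  define A where "A R = c * mexp_term R (\<chi> k. \<alpha> $ k * fst \<xi> $ k)" for R
  define B where "B S = mexp_term S (\<chi> k. \<beta> $ k * snd \<xi> $ k)" for S
  have m: "mpow \<gamma> N * mexp_term N v = mexp_term N (\<chi> k. \<gamma> $ k * v $ k)" for \<gamma> v :: "complex ^ 'a" and N
    by (simp add: mexp_term_def mpow_def power_mult_distrib prod.distrib)
  have t: "exp_array c \<alpha> \<beta> T * eterm T \<xi> = A (fst T) * B (snd T)" for T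
    by (simp add: exp_array_def eterm_def A_def B_def m[symmetric] case_prod_unfold mult_ac)
  have "((\<lambda>(R, S). A R * B S) has_sum cent (exp_array c \<alpha> \<beta>) \<xi>) (UNIV \<times> UNIV)"
    using has_sum_cent[OF wick_arrays_entire[OF wick_arrays_exp_array[of c \<alpha> \<beta>]], of \<xi>]
    by (simp add: t case_prod_unfold)
  then have "((\<lambda>R. A R * exp (\<Sum>k\<in>UNIV. (\<chi> k. \<beta> $ k * snd \<xi> $ k) $ k)) has_sum cent (exp_array c \<alpha> \<beta>) \<xi>) UNIV"
    by (rule has_sum_SigmaD) (simp only: prod.case B_def has_sum_cmult_right has_sum_mexp_term)
  moreover have "((\<lambda>R. A R * exp (\<Sum>k\<in>UNIV. (\<chi> k. \<beta> $ k * snd \<xi> $ k) $ k)) has_sum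
      c * exp (\<Sum>k\<in>UNIV. (\<chi> k. \<alpha> $ k * fst \<xi> $ k) $ k) * exp (\<Sum>k\<in>UNIV. (\<chi> k. \<beta> $ k * snd \<xi> $ k) $ k)) UNIV"
    unfolding A_def by (intro has_sum_cmult_left has_sum_cmult_right has_sum_mexp_term)
  ultimately have "cent (exp_array c \<alpha> \<beta>) \<xi> =
      c * exp (\<Sum>k\<in>UNIV. (\<chi> k. \<alpha> $ k * fst \<xi> $ k) $ k) * exp (\<Sum>k\<in>UNIV. (\<chi> k. \<beta> $ k * snd \<xi> $ k) $ k)"
    by (rule has_sum_unique)
  then show ?thesis by (simp add: exp_add)
qed

text \<open>Exponentials are eigenvectors of all derivatives. Divided by the factorial in the star
  series, the eigenvalue is \<open>mexp_term N\<close> at \<alpha> or \<beta>, which is the weight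
  of the \<open>N\<close>-th derivative in the Taylor expansion of the other factor.\<close>

lemma cent_shift_exp_array:
  "cent (\<lambda>T. exp_array c \<alpha> \<beta> (T + (N, 0))) \<xi> = mpow \<alpha> N * cent (exp_array c \<alpha> \<beta>) \<xi>"
  "cent (\<lambda>T. exp_array c \<alpha> \<beta> (T + (0, N))) \<xi> = mpow \<beta> N * cent (exp_array c \<alpha> \<beta>) \<xi>"
proof -
  have e: "entire_array (exp_array c \<alpha> \<beta>)" by (intro wick_arrays_entire wick_arrays_exp_array)
  have "(\<lambda>T. exp_array c \<alpha> \<beta> (T + (N, 0))) = (\<lambda>T. mpow \<alpha> N * exp_array c \<alpha> \<beta> T)"
    "(\<lambda>T. exp_array c \<alpha> \<beta> (T + (0, N))) = (\<lambda>T. mpow \<beta> N * exp_array c \<alpha> \<beta> T)"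
    by (auto simp: exp_array_def fun_eq_iff mpow_add)
  then show "cent (\<lambda>T. exp_array c \<alpha> \<beta> (T + (N, 0))) \<xi> = mpow \<alpha> N * cent (exp_array c \<alpha> \<beta>) \<xi>"
    "cent (\<lambda>T. exp_array c \<alpha> \<beta> (T + (0, N))) \<xi> = mpow \<beta> N * cent (exp_array c \<alpha> \<beta>) \<xi>"
    by (simp_all only: cent_cmult[OF e])
qed

lemma cent_taylor_fst:
  assumes "entire_array a"
  shows "((\<lambda>N. mexp_term N v * cent (\<lambda>T. a (T + (N, 0))) \<xi>) has_sum cent a (\<xi> + (v, 0))) UNIV"
proof -
  have "((\<lambda>B. cent (\<lambda>T. a (T + B)) \<xi> * eterm B (v, 0)) has_sum cent a (\<xi> + (v, 0))) (range (\<lambda>N. (N, 0)))"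
    by (rule has_sum_cong_neutral[THEN iffD2, OF _ _ _ cent_taylor[OF assms]])
       (auto simp: eterm_def mexp_term_zero image_iff prod_eq_iff)
  then show ?thesis
    by (subst (asm) has_sum_reindex) (auto simp: inj_on_def o_def eterm_def mult.commute)
qed

lemma cent_taylor_snd:
  assumes "entire_array a"
  shows "((\<lambda>N. mexp_term N v * cent (\<lambda>T. a (T + (0, N))) \<xi>) has_sum cent a (\<xi> + (0, v))) UNIV"
proof -
  have "((\<lambda>B. cent (\<lambda>T. a (T + B)) \<xi> * eterm B (0, v)) has_sum cent a (\<xi> + (0, v))) (range (\<lambda>N. (0, N)))"
    by (rule has_sum_cong_neutral[THEN iffD2, OF _ _ _ cent_taylor[OF assms]])
       (auto simp: eterm_def mexp_term_zero image_iff prod_eq_iff)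
  then show ?thesis
    by (subst (asm) has_sum_reindex) (auto simp: inj_on_def o_def eterm_def mult.commute)
qed

lemma cent_star_exp_array_left:
  assumes "b \<in> wick_arrays"
  shows "cent (star_array UNIV (exp_array c \<alpha> \<beta>) b) \<xi> = cent (exp_array c \<alpha> \<beta>) \<xi> * cent b (\<xi> + (0, \<alpha>))"
proof -
  have "((\<lambda>N. cent (exp_array c \<alpha> \<beta>) \<xi> * (mexp_term N \<alpha> * cent (\<lambda>T. b (T + (0, N))) \<xi>))
     has_sum cent (exp_array c \<alpha> \<beta>) \<xi> * cent b (\<xi> + (0, \<alpha>))) UNIV"
    by (intro has_sum_cmult_right cent_taylor_snd wick_arrays_entire assms)
  moreover have "cent (exp_array c \<alpha> \<beta>) \<xi> * (mexp_term N \<alpha> * cent (\<lambda>T. b (T + (0, N))) \<xi>) =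
     of_real (1 / mfact N) * (cent (\<lambda>T. exp_array c \<alpha> \<beta> (T + (N, 0))) \<xi> * cent (\<lambda>T. b (T + (0, N))) \<xi>)" for N
    by (simp add: cent_shift_exp_array mexp_term_def)
  ultimately show ?thesis
    using cent_star_has_sum[OF wick_arrays_exp_array[of c \<alpha> \<beta>] assms, of \<xi>]
    by (simp only:) (rule has_sum_unique)
qed

lemma cent_star_exp_array_right:
  assumes "a \<in> wick_arrays"
  shows "cent (star_array UNIV a (exp_array c \<alpha> \<beta>)) \<xi> = cent a (\<xi> + (\<beta>, 0)) * cent (exp_array c \<alpha> \<beta>) \<xi>"
proof -
  have "((\<lambda>N. (mexp_term N \<beta> * cent (\<lambda>T. a (T + (N, 0))) \<xi>) * cent (exp_array c \<alpha> \<beta>) \<xi>)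
     has_sum cent a (\<xi> + (\<beta>, 0)) * cent (exp_array c \<alpha> \<beta>) \<xi>) UNIV"
    by (intro has_sum_cmult_left cent_taylor_fst wick_arrays_entire assms)
  moreover have "(mexp_term N \<beta> * cent (\<lambda>T. a (T + (N, 0))) \<xi>) * cent (exp_array c \<alpha> \<beta>) \<xi> =
     of_real (1 / mfact N) * (cent (\<lambda>T. a (T + (N, 0))) \<xi> * cent (\<lambda>T. exp_array c \<alpha> \<beta> (T + (0, N))) \<xi>)" for N
    by (simp add: cent_shift_exp_array mexp_term_def)
  ultimately show ?thesis
    using cent_star_has_sum[OF assms wick_arrays_exp_array[of c \<alpha> \<beta>], of \<xi>]
    by (simp only:) (rule has_sum_unique)
qed

definition trans_array :: "real \<Rightarrow> complex ^ 'n::finite \<Rightarrow> ('n midx2 \<Rightarrow> complex) \<Rightarrow> 'n midx2 \<Rightarrow> complex" where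
  "trans_array s w a = (\<lambda>B. cent (\<lambda>T. a (T + B)) (dbl s w))"

lemma entire_trans_array: "entire_array a \<Longrightarrow> entire_array (trans_array s w a)"
  unfolding trans_array_def by (rule entire_array_translate)

lemma cent_trans_array: "entire_array a \<Longrightarrow> cent (trans_array s w a) \<xi> = cent a (dbl s w + \<xi>)"
  unfolding trans_array_def by (rule cent_translate)

lemma shift_trans_array: "(\<lambda>T. trans_array s w a (T + B)) = trans_array s w (\<lambda>T. a (T + B))"
  by (simp add: trans_array_def fun_eq_iff add.assoc)

lemma trans_array_diff:
  "entire_array a \<Longrightarrow> entire_array b \<Longrightarrow> trans_array s w (\<lambda>T. a T - b T) = (\<lambda>T. trans_array s w a T - trans_array s w b T)"
  by (simp add: trans_array_def fun_eq_iff cent_diff entire_array_shift)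

lemma trans_array_cmult:
  "entire_array a \<Longrightarrow> trans_array s w (\<lambda>T. c * a T) = (\<lambda>T. c * trans_array s w a T)"
  by (simp add: trans_array_def fun_eq_iff cent_cmult entire_array_shift)

lemma pull_back_ent:
  assumes "entire_array a"
  shows "pull_back w (ent s p a) = ent s p (trans_array s w a)"
  unfolding pull_back_def ent_def cent_trans_array[OF assms] dbl_add[symmetric]
  by (simp add: algebra_simps)

lemma ent_inj:
  assumes "entire_array a" "entire_array b" "s > 0" "ent s p a = ent s p b"
  shows "a = b"
proof -
  have "a = njet s p (ent s p a)" by (rule njet_ent[OF assms(1,3), symmetric])
  also have "\<dots> = njet s p (ent s p b)" by (simp only: assms(4))
  also have "\<dots> = b" by (rule njet_ent[OF assms(2,3)])
  finally show ?thesis .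
qed

text \<open>The array of \<open>u_trans\<close>, re-centred at \<open>p\<close>: the value of the
  exponent at \<open>p\<close> goes into the scalar factor. The linear part is multiplied by the
  scale \<open>sqrt (2 * hbar)\<close> and divided by its square, which leaves the scale in the
  denominator.\<close>

definition u_array :: "real \<Rightarrow> complex ^ 'n::finite \<Rightarrow> complex ^ 'n \<Rightarrow> 'n midx2 \<Rightarrow> complex" where
  "u_array hbar p w = exp_array
     (exp (- (\<Sum>k\<in>UNIV. cnj (w $ k) * w $ k) / of_real (4 * hbar)) *
      exp (1 / of_real (2 * hbar) * ((\<Sum>k\<in>UNIV. cnj (w $ k) * p $ k) - (\<Sum>k\<in>UNIV. w $ k * cnj (p $ k)))))
     (\<chi> k. cnj (w $ k) / of_real (sqrt (2 * hbar))) (\<chi> k. - w $ k / of_real (sqrt (2 * hbar)))"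

lemma u_array_wick: "u_array hbar p w \<in> wick_arrays"
  unfolding u_array_def by (rule wick_arrays_exp_array)

lemma sqrt_2hbar: "hbar > 0 \<Longrightarrow> complex_of_real (sqrt (2 * hbar)) * complex_of_real (sqrt (2 * hbar)) = of_real (2 * hbar)"
  by (simp add: of_real_mult[symmetric] del: of_real_mult)

lemma ent_u_array:
  assumes "hbar > 0"
  shows "ent (sqrt (2 * hbar)) p (u_array hbar p w) = u_trans hbar w"
proof
  fix z
  define s where "s = complex_of_real (sqrt (2 * hbar))"
  have s: "s * s = of_real (2 * hbar)" unfolding s_def by (rule sqrt_2hbar[OF assms])
  have 1: "(\<Sum>k\<in>UNIV. cnj (w $ k) / s * ((z $ k - p $ k) / s)) =
      1 / of_real (2 * hbar) * ((\<Sum>k\<in>UNIV. cnj (w $ k) * z $ k) - (\<Sum>k\<in>UNIV. cnj (w $ k) * p $ k))"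
    unfolding times_divide_times_eq s right_diff_distrib diff_divide_distrib sum_subtractf sum_divide_distrib[symmetric]
    by simp
  have 2: "(\<Sum>k\<in>UNIV. - w $ k / s * (cnj (z $ k - p $ k) / s)) =
      - (1 / of_real (2 * hbar) * ((\<Sum>k\<in>UNIV. w $ k * cnj (z $ k)) - (\<Sum>k\<in>UNIV. w $ k * cnj (p $ k))))"
    unfolding times_divide_times_eq s complex_cnj_diff right_diff_distrib diff_divide_distrib sum_subtractf
      sum_divide_distrib[symmetric]
    by (simp add: sum_negf)
  show "ent (sqrt (2 * hbar)) p (u_array hbar p w) z = u_trans hbar w z"
    unfolding ent_def u_array_def cent_exp_array u_trans_def dbl_def fst_conv snd_conv vec_lambda_beta
      vector_minus_component s_def[symmetric] 1 2 mult.assoc exp_add[symmetric]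
    by (simp add: algebra_simps)
qed

text \<open>With \<open>q\<close> the squared length of \<open>w\<close> over
  \<open>4 * hbar\<close>, the shift of the first variable contributes \<open>exp (q + q)\<close>,
  and each of the two normalising factors contributes \<open>exp (- q)\<close>. Everything else
  changes sign with \<open>w\<close> and cancels.\<close>

lemma u_array_product:
  assumes "hbar > 0" and "\<zeta>' = \<zeta> + (\<chi> k. w $ k / of_real (sqrt (2 * hbar)))"
  shows "cent (u_array hbar p w) (\<zeta>', \<omega>) * cent (u_array hbar p (- w)) (\<zeta>, \<omega>) = 1"
proof -
  define s where "s = complex_of_real (sqrt (2 * hbar))"
  have s: "s * s = of_real (2 * hbar)" unfolding s_def by (rule sqrt_2hbar[OF assms(1)])
  define q where "q = (\<Sum>k\<in>UNIV. cnj (w $ k) * w $ k) / complex_of_real (4 * hbar)"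
  have "(\<Sum>k\<in>UNIV. cnj (w $ k) / s * (w $ k / s)) = q + q"
    unfolding times_divide_times_eq s sum_divide_distrib[symmetric] q_def
    using assms by (simp add: field_simps)
  then have 1: "(\<Sum>k\<in>UNIV. cnj (w $ k) / s * (\<zeta> $ k + w $ k / s)) = (\<Sum>k\<in>UNIV. cnj (w $ k) / s * \<zeta> $ k) + (q + q)"
    by (simp only: distrib_left sum.distrib)
  show ?thesis
    unfolding u_array_def cent_exp_array assms(2) fst_conv snd_conv vec_lambda_beta s_def[symmetric]
      vector_add_component 1
    by (simp add: exp_add[symmetric] sum_negf q_def mult.commute exp_minus[symmetric] diff_divide_distrib)
qed

text \<open>Up to the scale, the left factor shifts the second variable by the conjugate of
  \<open>w\<close> and the right factor shifts the first by \<open>w\<close>, which together is the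
  translation. The exponentials left over cancel by \<open>u_array_product\<close>. As products stay
  in the algebra, so does the translated array.\<close>

lemma trans_array_eq_star:
  assumes h: "hbar > 0" and a: "a \<in> wick_arrays"
  shows "trans_array (sqrt (2 * hbar)) w a = star_array UNIV (star_array UNIV (u_array hbar p w) a) (u_array hbar p (- w))"
    (is "?L = ?R")
proof (rule ent_inj)
  define s where "s = sqrt (2 * hbar)"
  have s0: "s > 0" using h by (simp add: s_def)
  then show "sqrt (2 * hbar) > 0" by (simp add: s_def)
  show "entire_array ?L" by (intro entire_trans_array wick_arrays_entire a)
  show "entire_array ?R" by (intro wick_arrays_entire wick_arrays_star u_array_wick a)
  have "cent ?R (\<zeta>, \<omega>) = cent ?L (\<zeta>, \<omega>)" for \<zeta> \<omega>
  proof -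
    define wz where "wz = (\<chi> k. w $ k / of_real s)"
    define wb where "wb = (\<chi> k. cnj (w $ k) / of_real s)"
    have V: "u_array hbar p (- w) = exp_array
       (exp (- (\<Sum>k\<in>UNIV. cnj ((- w) $ k) * (- w) $ k) / of_real (4 * hbar)) *
        exp (1 / of_real (2 * hbar) * ((\<Sum>k\<in>UNIV. cnj ((- w) $ k) * p $ k) - (\<Sum>k\<in>UNIV. (- w) $ k * cnj (p $ k)))))
       (\<chi> k. cnj ((- w) $ k) / of_real s) wz"
      by (simp add: u_array_def wz_def s_def)
    have "cent ?R (\<zeta>, \<omega>) = cent (star_array UNIV (u_array hbar p w) a) ((\<zeta>, \<omega>) + (wz, 0)) * cent (u_array hbar p (- w)) (\<zeta>, \<omega>)"
      unfolding V by (rule cent_star_exp_array_right[OF wick_arrays_star[OF u_array_wick a]])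
    also have "cent (star_array UNIV (u_array hbar p w) a) ((\<zeta>, \<omega>) + (wz, 0)) =
        cent (u_array hbar p w) ((\<zeta>, \<omega>) + (wz, 0)) * cent a (((\<zeta>, \<omega>) + (wz, 0)) + (0, wb))"
      unfolding u_array_def wb_def s_def by (rule cent_star_exp_array_left[OF a])
    also have "cent (u_array hbar p w) ((\<zeta>, \<omega>) + (wz, 0)) * cent a (((\<zeta>, \<omega>) + (wz, 0)) + (0, wb)) * cent (u_array hbar p (- w)) (\<zeta>, \<omega>)
      = cent a (((\<zeta>, \<omega>) + (wz, 0)) + (0, wb)) * (cent (u_array hbar p w) (\<zeta> + wz, \<omega>) * cent (u_array hbar p (- w)) (\<zeta>, \<omega>))"
      by simp
    also have "cent (u_array hbar p w) (\<zeta> + wz, \<omega>) * cent (u_array hbar p (- w)) (\<zeta>, \<omega>) = 1"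
      by (rule u_array_product[OF h]) (simp add: wz_def s_def)
    also have "((\<zeta>, \<omega>) + (wz, 0)) + (0, wb) = dbl s w + (\<zeta>, \<omega>)"
      by (simp add: dbl_def wz_def wb_def add.commute)
    finally show ?thesis by (simp add: cent_trans_array wick_arrays_entire a s_def)
  qed
  then show "ent (sqrt (2 * hbar)) p ?L = ent (sqrt (2 * hbar)) p ?R"
    by (simp add: ent_def fun_eq_iff dbl_def)
qed

section \<open>The Frechet space as a space of arrays\<close>

primrec index_bits :: "nat \<Rightarrow> nat \<Rightarrow> bool list" where
  "index_bits 0 l = []"
| "index_bits (Suc m) l = odd l # index_bits m (l div 2)"

lemma length_index_bits [simp]: "length (index_bits m l) = m"
  by (induction m arbitrary: l) auto

lemma index_bits_surj: "\<exists>l < 2 ^ length bs. index_bits (length bs) l = bs"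
proof (induction bs)
  case (Cons b bs)
  then obtain l where l: "l < 2 ^ length bs" "index_bits (length bs) l = bs" by blast
  show ?case
    by (rule exI[of _ "2 * l + of_bool b"]) (use l in \<open>auto simp: of_bool_def\<close>)
qed simp

lemma wick_h_eq_hcasc:
  assumes "hbar > 0"
  shows "wick_h hbar p f m l R S = hcasc (index_bits m l) (njet (sqrt (2 * hbar)) p f) R S"
proof (induction m arbitrary: l R S)
  case 0
  have eq: "(2 * hbar) ^ (mabs R + mabs S + mabs N) / mfact N * (cmod (dz_multi R (dzbar_multi (N + S) f) p))\<^sup>2
      = 1 / mfact N * (cmod (njet (sqrt (2 * hbar)) p f (R, N + S)))\<^sup>2" for N
  proof -
    have "(sqrt (2 * hbar) ^ k)\<^sup>2 = (2 * hbar) ^ k" for k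
      using assms by (simp add: power_mult[symmetric] mult.commute[of k 2]) (simp add: power_mult)
    then have "(cmod (njet (sqrt (2 * hbar)) p f (R, N + S)))\<^sup>2 =
        (2 * hbar) ^ (mabs R + mabs S + mabs N) * (cmod (dz_multi R (dzbar_multi (N + S) f) p))\<^sup>2"
      using assms by (simp only: njet_def prod.case norm_mult norm_power norm_of_real power_mult_distrib
          mabs_add add_ac abs_of_pos real_sqrt_gt_0_iff)
    then show ?thesis by simp
  qed
  show ?case
    unfolding index_bits.simps cascade.simps wick_h.simps hsum_def eq
    by (intro infsum_cong) (simp add: ennreal_mult[symmetric])
next
  case (Suc m)
  show ?case
    by (cases "even l") (simp_all add: cstep_def binsum_def swap_if_def Suc.IH)
qed

lemma wick_seminorm_less_top_iff:
  "hbar > 0 \<Longrightarrow> wick_seminorm hbar p m l R S f < \<infinity> \<longleftrightarrow> hcasc (index_bits m l) (njet (sqrt (2 * hbar)) p f) R S < \<infinity>"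
  by (auto simp: wick_seminorm_def wick_h_eq_hcasc less_top)

lemma wick_seminorm_less_iff:
  assumes "hbar > 0" "0 < e"
  shows "wick_seminorm hbar p m l R S f < ennreal e \<longleftrightarrow>
    hcasc (index_bits m l) (njet (sqrt (2 * hbar)) p f) R S < ennreal (e ^ (2 ^ (m + 1)))"
proof (cases "wick_h hbar p f m l R S")
  case top
  then show ?thesis using assms by (simp add: wick_seminorm_def wick_h_eq_hcasc)
next
  case (real r)
  define d :: nat where "d = 2 ^ (m + 1)"
  have d: "d > 0" by (simp add: d_def)
  have "root d r < e \<longleftrightarrow> r < e ^ d"
  proof -
    have "root d r < e \<longleftrightarrow> root d r < root d (e ^ d)"
      using assms d by (simp add: real_root_power_cancel)
    then show ?thesis using d by simp
  qed
  then show ?thesis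
    using real assms wick_h_eq_hcasc[OF assms(1), of p f m l R S]
    by (simp add: wick_seminorm_def d_def ennreal_less_iff)
qed

lemma wick_tilde_iff:
  assumes "hbar > 0"
  shows "f \<in> wick_tilde hbar p \<longleftrightarrow> smooth f \<and> njet (sqrt (2 * hbar)) p f \<in> wick_arrays"
proof -
  have "(\<forall>m l R S. l < 2 ^ m \<longrightarrow> hcasc (index_bits m l) a R S < \<infinity>) \<longleftrightarrow> a \<in> wick_arrays" for a :: "'a midx2 \<Rightarrow> complex"
  proof
    assume *: "\<forall>m l R S. l < 2 ^ m \<longrightarrow> hcasc (index_bits m l) a R S < \<infinity>"
    have "hcasc bs a R S < \<infinity>" for bs R S
    proof -
      obtain l where "l < 2 ^ length bs" "index_bits (length bs) l = bs" using index_bits_surj by blast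
      with * show ?thesis by metis
    qed
    then show "a \<in> wick_arrays" by (simp add: wick_arrays_def)
  qed (simp add: wick_arrays_def)
  then show ?thesis
    unfolding wick_tilde_def by (simp only: wick_seminorm_less_top_iff[OF assms] mem_Collect_eq)
qed

lemma wick_space_ent:
  assumes "hbar > 0" "a \<in> wick_arrays"
  shows "ent (sqrt (2 * hbar)) p a \<in> wick_space hbar p"
  using assms wick_arrays_entire[OF assms(2)]
  by (simp add: wick_space_def wick_tilde_iff njet_ent smooth_ent real_analytic_ent)

lemma wick_space_eq:
  assumes "hbar > 0"
  shows "wick_space hbar p = ent (sqrt (2 * hbar)) p ` wick_arrays"
proof safe
  fix f assume f: "f \<in> wick_space hbar p"
  then have n: "njet (sqrt (2 * hbar)) p f \<in> wick_arrays" "smooth f" "real_analytic f"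
    using assms by (auto simp: wick_space_def wick_tilde_iff)
  then have "f = ent (sqrt (2 * hbar)) p (njet (sqrt (2 * hbar)) p f)"
    using assms by (intro real_analytic_eq_ent wick_arrays_entire) auto
  then show "f \<in> ent (sqrt (2 * hbar)) p ` wick_arrays" using n by blast
qed (use wick_space_ent assms in blast)

locale wick =
  fixes hbar :: real and p :: "complex ^ 'n::finite"
  assumes hbar: "hbar > 0"
begin

abbreviation E :: "('n midx2 \<Rightarrow> complex) \<Rightarrow> complex ^ 'n \<Rightarrow> complex" where
  "E \<equiv> ent (sqrt (2 * hbar)) p"

lemma s_pos: "sqrt (2 * hbar) > 0"
  using hbar by simp

lemma E_inj: "a \<in> wick_arrays \<Longrightarrow> b \<in> wick_arrays \<Longrightarrow> E a = E b \<Longrightarrow> a = b"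
  by (intro ent_inj[OF _ _ s_pos] wick_arrays_entire)

lemma wick_space_cases:
  assumes "f \<in> wick_space hbar p"
  obtains a where "a \<in> wick_arrays" "f = E a"
  using assms wick_space_eq[OF hbar] by auto

lemma E_in: "a \<in> wick_arrays \<Longrightarrow> E a \<in> wick_space hbar p"
  by (rule wick_space_ent[OF hbar])

section \<open>Balls, the topology and convergence\<close>

definition array_ball :: "bool list \<Rightarrow> nat ^ 'n \<Rightarrow> nat ^ 'n \<Rightarrow> real \<Rightarrow> ('n midx2 \<Rightarrow> complex) \<Rightarrow> ('n midx2 \<Rightarrow> complex) set" where
  "array_ball bs R S e a = {b \<in> wick_arrays. hcasc bs (\<lambda>T. b T - a T) R S < ennreal (e ^ (2 ^ (length bs + 1)))}"

lemma seminorm_ball: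
  assumes "a \<in> wick_arrays" "0 < e"
  shows "{g \<in> wick_space hbar p. wick_seminorm hbar p m l R S (\<lambda>z. g z - E a z) < ennreal e}
     = E ` array_ball (index_bits m l) R S e a"
proof -
  have "wick_seminorm hbar p m l R S (\<lambda>z. E b z - E a z) < ennreal e \<longleftrightarrow> b \<in> array_ball (index_bits m l) R S e a"
    if "b \<in> wick_arrays" for b
  proof -
    have "(\<lambda>z. E b z - E a z) = E (\<lambda>T. b T - a T)"
      by (simp add: ent_def fun_eq_iff cent_diff wick_arrays_entire that assms)
    moreover have "njet (sqrt (2 * hbar)) p (E (\<lambda>T. b T - a T)) = (\<lambda>T. b T - a T)"
      by (intro njet_ent s_pos wick_arrays_entire wick_arrays_diff that assms)
    ultimately show ?thesis
      using that by (simp add: wick_seminorm_less_iff[OF hbar assms(2)] array_ball_def)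
  qed
  then show ?thesis
    unfolding wick_space_eq[OF hbar] using assms by (auto simp: array_ball_def)
qed

definition subbase :: "(complex ^ 'n \<Rightarrow> complex) set set" where
  "subbase = {E ` array_ball bs R S e a | bs R S e a. a \<in> wick_arrays \<and> 0 < e}"

lemma wick_topology_eq: "wick_topology hbar p = topology_generated_by subbase"
proof -
  have "{{g \<in> wick_space hbar p. wick_seminorm hbar p m l R S (\<lambda>z. g z - f z) < ennreal e} | f m l R S e.
        f \<in> wick_space hbar p \<and> l < 2 ^ m \<and> 0 < e} = subbase"
  proof (intro set_eqI iffI)
    fix X assume "X \<in> {{g \<in> wick_space hbar p. wick_seminorm hbar p m l R S (\<lambda>z. g z - f z) < ennreal e} | f m l R S e.
        f \<in> wick_space hbar p \<and> l < 2 ^ m \<and> 0 < e}"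
    then obtain f m l R S e where X: "X = {g \<in> wick_space hbar p. wick_seminorm hbar p m l R S (\<lambda>z. g z - f z) < ennreal e}"
      "f \<in> wick_space hbar p" "0 < e" by blast
    then obtain a where "a \<in> wick_arrays" "f = E a" by (elim wick_space_cases)
    then show "X \<in> subbase" using X seminorm_ball unfolding subbase_def by blast
  next
    fix X assume "X \<in> subbase"
    then obtain bs R S e a where X: "X = E ` array_ball bs R S e a" "a \<in> wick_arrays" "0 < e"
      unfolding subbase_def by blast
    obtain l where l: "l < 2 ^ length bs" "index_bits (length bs) l = bs" using index_bits_surj by blast
    have "X = {g \<in> wick_space hbar p. wick_seminorm hbar p (length bs) l R S (\<lambda>z. g z - E a z) < ennreal e}"
      using seminorm_ball[OF X(2,3), of "length bs" l R S] l X(1) by simp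
    then show "X \<in> {{g \<in> wick_space hbar p. wick_seminorm hbar p m l R S (\<lambda>z. g z - f z) < ennreal e} | f m l R S e.
        f \<in> wick_space hbar p \<and> l < 2 ^ m \<and> 0 < e}"
      using l(1) X(3) E_in[OF X(2)] by blast
  qed
  then show ?thesis by (simp add: wick_topology_def)
qed

lemma array_ball_center: "a \<in> wick_arrays \<Longrightarrow> 0 < e \<Longrightarrow> a \<in> array_ball bs R S e a"
  by (simp add: array_ball_def hcasc_0)

lemma topspace_wick: "topspace (wick_topology hbar p) = wick_space hbar p"
proof -
  have "\<Union> subbase = wick_space hbar p"
  proof
    show "\<Union> subbase \<subseteq> wick_space hbar p"
      unfolding subbase_def wick_space_eq[OF hbar] array_ball_def by blast
    show "wick_space hbar p \<subseteq> \<Union> subbase"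
    proof
      fix f assume "f \<in> wick_space hbar p"
      then obtain a where a: "a \<in> wick_arrays" "f = E a" by (elim wick_space_cases)
      have "E ` array_ball [] 0 0 1 a \<in> subbase" unfolding subbase_def using a by (blast intro: zero_less_one)
      moreover have "f \<in> E ` array_ball [] 0 0 1 a" using a array_ball_center by simp
      ultimately show "f \<in> \<Union> subbase" by blast
    qed
  qed
  then show ?thesis by (simp add: wick_topology_eq topology_generated_by_topspace)
qed

lemma openin_ball: "a \<in> wick_arrays \<Longrightarrow> 0 < e \<Longrightarrow> openin (wick_topology hbar p) (E ` array_ball bs R S e a)"
  unfolding wick_topology_eq by (rule topology_generated_by_Basis) (unfold subbase_def, blast)

lemma array_ball_inner:
  assumes a: "a \<in> array_ball bs R S e c" and e: "0 < e"
  obtains \<delta> where "0 < \<delta>" "array_ball bs R S \<delta> a \<subseteq> array_ball bs R S e c"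
proof -
  define d :: nat where "d = 2 ^ (length bs + 1)"
  have d: "d > 0" by (simp add: d_def)
  have less: "hcasc bs (\<lambda>T. a T - c T) R S < ennreal (e ^ d)" using a by (simp add: array_ball_def d_def)
  then obtain h where h: "hcasc bs (\<lambda>T. a T - c T) R S = ennreal h" "0 \<le> h"
    by (cases "hcasc bs (\<lambda>T. a T - c T) R S") auto
  have he: "h < e ^ d" using less h by (simp add: ennreal_less_iff)
  \<comment> \<open>Any value strictly between the functional of \<open>a - c\<close> and its bound
    would do. Its root \<open>e'\<close> is a radius below \<open>e\<close> within which
    \<open>a\<close> still lies around \<open>c\<close>, and \<open>e - e'\<close> remains for the
    triangle inequality.\<close>
  define r where "r = (h + e ^ d) / 2"
  have r: "h < r" "r < e ^ d" "0 < r" using he h by (auto simp: r_def)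
  define e' where "e' = root d r"
  have e': "e' ^ d = r" "0 < e'" using r d by (auto simp: e'_def real_root_pow_pos2)
  have "e' < e" using r e' e by (metis less_eq_real_def power_less_imp_less_base)
  show ?thesis
  proof (rule that[of "e - e'"])
    show "0 < e - e'" using \<open>e' < e\<close> by simp
    show "array_ball bs R S (e - e') a \<subseteq> array_ball bs R S e c"
    proof
      fix b assume b: "b \<in> array_ball bs R S (e - e') a"
      have "hcasc bs (\<lambda>T. (b T - a T) + (a T - c T)) R S < ennreal (((e - e') + e') ^ (2 ^ (length bs + 1)))"
      proof (rule hcasc_triangle)
        show "hcasc bs (\<lambda>T. a T - c T) R S < ennreal (e' ^ (2 ^ (length bs + 1)))"
          using h r e' by (simp add: d_def[symmetric] ennreal_less_iff del: power_Suc)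
           (simp add: d_def ennreal_less_iff)
      qed (use b \<open>e' < e\<close> e' in \<open>auto simp: array_ball_def\<close>)
      then show "b \<in> array_ball bs R S e c" using b by (simp add: array_ball_def)
    qed
  qed
qed

lemma limitin_wickI:
  assumes a: "a \<in> wick_arrays" and b: "\<And>i. b i \<in> wick_arrays"
    and lim: "\<And>bs R S. ((\<lambda>i. hcasc bs (\<lambda>T. b i T - a T) R S) \<longlongrightarrow> 0) G"
  shows "limitin (wick_topology hbar p) (\<lambda>i. E (b i)) (E a) G"
  unfolding limitin_def topspace_wick
proof (intro conjI allI impI)
  show "E a \<in> wick_space hbar p" by (rule E_in[OF a])
  fix U assume U: "openin (wick_topology hbar p) U \<and> E a \<in> U"
  then have "generate_topology_on subbase U"
    by (simp add: wick_topology_eq openin_topology_generated_by_iff)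
  \<comment> \<open>The implication passes to finite intersections and to unions, so only subbasic
    sets call for an estimate.\<close>
  then have "E a \<in> U \<longrightarrow> eventually (\<lambda>i. E (b i) \<in> U) G"
  proof induction
    case (UN K)
    then show ?case by (blast intro: eventually_mono)
  next
    case (Basis X)
    show ?case
    proof
      assume aX: "E a \<in> X"
      obtain bs R S e c where X: "X = E ` array_ball bs R S e c" "c \<in> wick_arrays" "0 < e"
        using Basis unfolding subbase_def by blast
      have "a \<in> array_ball bs R S e c"
        using aX E_inj[OF a] by (auto simp: X array_ball_def)
      then obtain \<delta> where \<delta>: "0 < \<delta>" "array_ball bs R S \<delta> a \<subseteq> array_ball bs R S e c"
        using array_ball_inner X(3) by blast
      have "eventually (\<lambda>i. hcasc bs (\<lambda>T. b i T - a T) R S < ennreal (\<delta> ^ (2 ^ (length bs + 1)))) G"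
        using \<delta>(1) by (intro order_tendstoD(2)[OF lim]) auto
      then show "eventually (\<lambda>i. E (b i) \<in> X) G"
      proof eventually_elim
        case (elim i)
        then have "b i \<in> array_ball bs R S \<delta> a" using b by (simp add: array_ball_def)
        then show ?case using \<delta> X by blast
      qed
    qed
  qed (auto intro: eventually_conj)
  then show "eventually (\<lambda>i. E (b i) \<in> U) G" using U by blast
qed

text \<open>At level 0 the functional at index \<open>(R, S)\<close> dominates the coefficient
  there, so two arrays differing in that coefficient have disjoint balls of half the distance. Hence
  the description in \<open>wick_star\<close> has a definite value.\<close>

lemma limitin_wick_unique:
  assumes "limitin (wick_topology hbar p) \<sigma> h G" "limitin (wick_topology hbar p) \<sigma> h' G" "G \<noteq> bot"
  shows "h = h'"
proof -
  have "h \<in> wick_space hbar p" "h' \<in> wick_space hbar p"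
    using assms by (auto simp: limitin_def topspace_wick)
  then obtain a a' where a: "a \<in> wick_arrays" "h = E a" "a' \<in> wick_arrays" "h' = E a'"
    by (metis wick_space_cases)
  have "a T = a' T" for T
  proof (rule ccontr)
    assume ne: "a T \<noteq> a' T"
    obtain R S where T: "T = (R, S)" by (cases T)
    define e where "e = dist (a T) (a' T) / 2"
    have e: "e > 0" using ne by (simp add: e_def)
    have ev: "eventually (\<lambda>i. \<sigma> i \<in> E ` array_ball [] R S e c) G"
      if "limitin (wick_topology hbar p) \<sigma> (E c) G" "c \<in> wick_arrays" for c
      using that openin_ball[OF that(2) e, of "[]" R S] array_ball_center[OF that(2) e, of "[]" R S]
      unfolding limitin_def by blast
    have "eventually (\<lambda>i. \<sigma> i \<in> E ` array_ball [] R S e a \<and> \<sigma> i \<in> E ` array_ball [] R S e a') G"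
      using assms a by (intro eventually_conj ev) auto
    then obtain i where i: "\<sigma> i \<in> E ` array_ball [] R S e a" "\<sigma> i \<in> E ` array_ball [] R S e a'"
      using assms(3) eventually_happens' by blast
    then obtain b b' where b: "b \<in> array_ball [] R S e a" "b' \<in> array_ball [] R S e a'" "E b = E b'"
      unfolding image_iff by metis
    then have "b = b'" by (intro E_inj) (auto simp: array_ball_def)
    have close: "dist (b T) (c T) < e" if "b \<in> array_ball [] R S e c" for b c
    proof -
      have "hsum UNIV (\<lambda>T. b T - c T) R S < ennreal (e\<^sup>2)"
        using that by (simp add: array_ball_def power2_eq_square)
      then have "ennreal ((cmod (b T - c T))\<^sup>2) < ennreal (e\<^sup>2)"
        unfolding T by (rule le_less_trans[OF square_le_hsum])
      then have "(cmod (b T - c T))\<^sup>2 < e\<^sup>2" by (simp add: ennreal_less_iff)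
      then show ?thesis using e by (simp add: dist_norm power2_less_imp_less)
    qed
    have "dist (a T) (a' T) < e + e"
      using close[OF b(1)] close[OF b(2)] \<open>b = b'\<close> dist_triangle3[of "a T" "a' T" "b T"]
      by (simp add: dist_commute)
    then show False by (simp add: e_def)
  qed
  then have "a = a'" by blast
  then show ?thesis by (simp add: a)
qed

lemma wick_star_E:
  assumes a: "a \<in> wick_arrays" and b: "b \<in> wick_arrays"
  shows "wick_star hbar p (E a) (E b) = E (star_array UNIV a b)"
proof -
  have ent: "entire_array a" "entire_array b" by (intro wick_arrays_entire a b)+
  have st: "star_array F a b = (\<lambda>T. \<Sum>N\<in>F. star_term a b N T)" if "finite F" for F
    using that by (simp add: star_array_def fun_eq_iff)
  \<comment> \<open>For infinite \<open>F\<close> the sum is 0 by convention, which also belongs to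
    the algebra; the limit criterion asks for membership at every index.\<close>
  have fin: "(\<lambda>T. \<Sum>N\<in>F. star_term a b N T) \<in> wick_arrays" for F
    by (cases "finite F") (use wick_arrays_star[OF a b] st wick_arrays_0 in \<open>auto simp flip: st\<close>)
  have part: "(\<lambda>z. \<Sum>N\<in>F. of_real ((2 * hbar) ^ mabs N / mfact N) * dz_multi N (E a) z * dzbar_multi N (E b) z)
      = E (\<lambda>T. \<Sum>N\<in>F. star_term a b N T)" for F
  proof
    fix z
    define s where "s = sqrt (2 * hbar)"
    have "s * s = 2 * hbar" "s > 0" using hbar by (auto simp: s_def)
    then have ss: "complex_of_real ((2 * hbar) ^ mabs N / mfact N) * (of_real (1 / s) ^ mabs N * x) * (of_real (1 / s) ^ mabs N * y)
        = of_real (1 / mfact N) * (x * y)" for N :: "nat ^ 'n" and x y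
    proof -
      have "(2 * hbar) ^ mabs N * ((1 / s) ^ mabs N * (1 / s) ^ mabs N) = 1"
        using \<open>s * s = 2 * hbar\<close>[symmetric] \<open>s > 0\<close> by (simp add: power_mult_distrib[symmetric])
      then have "complex_of_real ((2 * hbar) ^ mabs N) * (of_real (1 / s) ^ mabs N * of_real (1 / s) ^ mabs N) = 1"
        by (simp only: of_real_mult[symmetric] of_real_power[symmetric] of_real_1)
      then have "complex_of_real ((2 * hbar) ^ mabs N) * (of_real (1 / s) ^ mabs N * of_real (1 / s) ^ mabs N) * (x * y / of_nat (mfact N)) = x * y / of_nat (mfact N)"
        by simp
      then show ?thesis by (simp add: mult_ac)
    qed
    have "of_real ((2 * hbar) ^ mabs N / mfact N) * dz_multi N (E a) z * dzbar_multi N (E b) z = E (star_term a b N) z" for N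
      unfolding dz_multi_ent[OF ent(1)] dzbar_multi_ent[OF ent(2)] ent_def s_def[symmetric] entire_array_star_term(2)[OF ent]
        cent_cmult[OF entire_array_shift[OF ent(1)]] cent_cmult[OF entire_array_shift[OF ent(2)]]
      by (rule ss)
    then show "(\<Sum>N\<in>F. of_real ((2 * hbar) ^ mabs N / mfact N) * dz_multi N (E a) z * dzbar_multi N (E b) z)
      = E (\<lambda>T. \<Sum>N\<in>F. star_term a b N T) z"
      by (simp add: ent_def cent_sum entire_array_star_term(1)[OF ent])
  qed
  have "limitin (wick_topology hbar p) (\<lambda>F. E (\<lambda>T. \<Sum>N\<in>F. star_term a b N T)) (E (star_array UNIV a b)) (finite_subsets_at_top UNIV)"
  proof (rule limitin_wickI[OF wick_arrays_star[OF a b] fin])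
    fix bs R S
    have "hcasc bs (\<lambda>T. (\<Sum>N\<in>F. star_term a b N T) - star_array UNIV a b T) R S = hcasc bs (star_array (UNIV - F) a b) R S"
      if "finite F" for F
    proof -
      have "(\<lambda>T. (\<Sum>N\<in>F. star_term a b N T) - star_array UNIV a b T) = (\<lambda>T. (- 1) * star_array (UNIV - F) a b T)"
        by (simp add: star_array_split[OF a b that, symmetric])
      then show ?thesis by (simp only: hcasc_cmult) simp
    qed
    \<comment> \<open>Partial sums are related to tails for finite \<open>F\<close>, and these are
      eventually all sets along the filter.\<close>
    then show "((\<lambda>F. hcasc bs (\<lambda>T. (\<Sum>N\<in>F. star_term a b N T) - star_array UNIV a b T) R S) \<longlongrightarrow> 0) (finite_subsets_at_top UNIV)"
      by (intro Lim_transform_eventually[OF hcasc_star_tail_tendsto[OF a b, of bs R S]])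
         (auto simp: eventually_finite_subsets_at_top intro!: exI[of _ "{}"])
  qed
  then show ?thesis
    unfolding wick_star_def part
    by (intro the_equality) (auto intro: limitin_wick_unique)
qed

text \<open>The bound is not homogeneous, so it is applied to a normalised argument, where it reads
  \<open>C + 1\<close>. Linearity and the homogeneity of \<open>hcasc bs\<close> carry this back to
  small arguments, whatever the degree of \<open>hcasc bs'\<close>.\<close>

lemma continuous_map_array_map:
  assumes maps: "\<And>a. a \<in> wick_arrays \<Longrightarrow> L a \<in> wick_arrays"
    and diff: "\<And>a b. a \<in> wick_arrays \<Longrightarrow> b \<in> wick_arrays \<Longrightarrow> L (\<lambda>T. a T - b T) = (\<lambda>T. L a T - L b T)"
    and scale: "\<And>a c. a \<in> wick_arrays \<Longrightarrow> L (\<lambda>T. c * a T) = (\<lambda>T. c * L a T)"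
    and bound: "\<And>bs R S. \<exists>C bs'. C < \<infinity> \<and> (\<forall>a\<in>wick_arrays. hcasc bs (L a) R S \<le> C + hcasc bs' a R S)"
    and \<Phi>: "\<And>a. a \<in> wick_arrays \<Longrightarrow> \<Phi> (E a) = E (L a)"
  shows "continuous_map (wick_topology hbar p) (wick_topology hbar p) \<Phi>"
proof -
  have "continuous_map (wick_topology hbar p) (topology_generated_by subbase) \<Phi>"
  proof (rule iffD2[OF continuous_on_generated_topo_iff], intro conjI allI impI)
    show "\<Phi> ` topspace (wick_topology hbar p) \<subseteq> \<Union> subbase"
      using maps \<Phi> E_in topspace_wick
      by (auto simp: topology_generated_by_topspace wick_topology_eq[symmetric] elim!: wick_space_cases
          simp flip: topology_generated_by_topspace)
    fix U assume "U \<in> subbase"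
    then obtain bs R S e c where U: "U = E ` array_ball bs R S e c" "c \<in> wick_arrays" "0 < e"
      unfolding subbase_def by blast
    show "openin (wick_topology hbar p) (\<Phi> -` U \<inter> topspace (wick_topology hbar p))"
    proof (subst openin_subopen, intro ballI)
      fix f assume f: "f \<in> \<Phi> -` U \<inter> topspace (wick_topology hbar p)"
      then obtain a where a: "a \<in> wick_arrays" "f = E a" by (auto simp: topspace_wick elim: wick_space_cases)
      have "E (L a) \<in> U" using f a \<Phi> by auto
      then have "L a \<in> array_ball bs R S e c"
        using E_inj[OF maps[OF a(1)]] by (auto simp: U array_ball_def)
      then obtain \<delta> where \<delta>: "0 < \<delta>" "array_ball bs R S \<delta> (L a) \<subseteq> array_ball bs R S e c"
        using array_ball_inner U(3) by blast
      obtain C bs' where C: "C < \<infinity>" "\<And>a. a \<in> wick_arrays \<Longrightarrow> hcasc bs (L a) R S \<le> C + hcasc bs' a R S"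
        using bound by blast
      obtain C' where C': "C = ennreal C'" "0 \<le> C'" using C(1) by (cases C) auto
      \<comment> \<open>Chosen so that \<eta> to the power \<open>d\<close> times
        \<open>C' + 1\<close> stays below \<delta> to the power \<open>d\<close>: as
        \<open>C' + 2\<close> exceeds 1, its \<open>d\<close>-th power is at least
        \<open>C' + 2\<close>, hence greater than \<open>C' + 1\<close>.\<close>
      define \<eta> where "\<eta> = \<delta> / (C' + 2)"
      define d :: nat where "d = 2 ^ (length bs + 1)"
      have \<eta>: "0 < \<eta>" using \<delta> C' by (simp add: \<eta>_def)
      have small: "\<eta> ^ d * (C' + 1) < \<delta> ^ d"
      proof -
        have "C' + 2 \<le> (C' + 2) ^ d" using C' by (intro self_le_power) (auto simp: d_def)
        then have "C' + 1 < (C' + 2) ^ d" by linarith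
        then have "\<eta> ^ d * (C' + 1) < \<eta> ^ d * (C' + 2) ^ d" using \<eta> by (intro mult_strict_left_mono) auto
        also have "\<dots> = \<delta> ^ d" using C' by (simp add: \<eta>_def power_mult_distrib[symmetric])
        finally show ?thesis .
      qed
      have sub: "E ` array_ball bs' R S \<eta> a \<subseteq> \<Phi> -` U \<inter> topspace (wick_topology hbar p)"
      proof
        fix g assume "g \<in> E ` array_ball bs' R S \<eta> a"
        then obtain b where b: "b \<in> array_ball bs' R S \<eta> a" "g = E b" by blast
        then have bw: "b \<in> wick_arrays" by (simp add: array_ball_def)
        define x where "x = (\<lambda>T. b T - a T)"
        have x: "x \<in> wick_arrays" unfolding x_def by (intro wick_arrays_diff bw a)
        \<comment> \<open>Normalised so that \<open>hcasc bs'\<close> is at most 1.\<close>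
        define y where "y = (\<lambda>T. of_real (1 / \<eta>) * x T)"
        have y: "y \<in> wick_arrays" unfolding y_def by (intro wick_arrays_cmult x)
        have "hcasc bs' y R S = ennreal (1 / \<eta>) ^ (2 ^ (length bs' + 1)) * hcasc bs' x R S"
          unfolding y_def hcasc_cmult using \<eta> by (simp add: norm_divide)
        also have "\<dots> \<le> ennreal (1 / \<eta>) ^ (2 ^ (length bs' + 1)) * ennreal (\<eta> ^ (2 ^ (length bs' + 1)))"
          using b by (intro mult_left_mono) (auto simp: array_ball_def x_def)
        also have "\<dots> = 1"
          using \<eta> by (simp add: ennreal_power ennreal_mult[symmetric] power_mult_distrib[symmetric])
        finally have "hcasc bs (L y) R S \<le> C + 1" using C(2)[OF y] by (meson add_left_mono order_trans)
        moreover have "x = (\<lambda>T. of_real \<eta> * y T)" using \<eta> by (simp add: y_def)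
        then have "L x = (\<lambda>T. of_real \<eta> * L y T)" using scale[OF y] by simp
        then have "hcasc bs (L x) R S = ennreal \<eta> ^ d * hcasc bs (L y) R S"
          unfolding d_def using \<eta> by (simp only: hcasc_cmult norm_of_real) simp
        ultimately have "hcasc bs (L x) R S \<le> ennreal \<eta> ^ d * (C + 1)" by (simp add: mult_left_mono)
        also have "\<dots> = ennreal (\<eta> ^ d * (C' + 1))"
          using C' \<eta> by (simp add: ennreal_mult ennreal_power)
        also have "\<dots> < ennreal (\<delta> ^ d)" using small \<eta> C' by (simp add: ennreal_less_iff)
        finally have "hcasc bs (\<lambda>T. L b T - L a T) R S < ennreal (\<delta> ^ d)"
          using diff[OF bw a(1)] by (simp add: x_def)
        then have "L b \<in> array_ball bs R S e c"
          using \<delta>(2) maps[OF bw] by (auto simp: array_ball_def d_def)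
        then show "g \<in> \<Phi> -` U \<inter> topspace (wick_topology hbar p)"
          using \<Phi>[OF bw] b E_in[OF bw] by (auto simp: U topspace_wick)
      qed
      have "f \<in> E ` array_ball bs' R S \<eta> a"
        unfolding a(2) by (rule imageI, rule array_ball_center[OF a(1) \<eta>])
      then show "\<exists>T. openin (wick_topology hbar p) T \<and> f \<in> T \<and> T \<subseteq> \<Phi> -` U \<inter> topspace (wick_topology hbar p)"
        using sub openin_ball[OF a(1) \<eta>] by (intro exI[of _ "E ` array_ball bs' R S \<eta> a"] conjI)
    qed
  qed
  then show ?thesis by (simp add: wick_topology_eq)
qed

section \<open>Translations\<close>

abbreviation tr :: "complex ^ 'n \<Rightarrow> ('n midx2 \<Rightarrow> complex) \<Rightarrow> 'n midx2 \<Rightarrow> complex" where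
  "tr \<equiv> trans_array (sqrt (2 * hbar))"

lemma tr_wick: "a \<in> wick_arrays \<Longrightarrow> tr w a \<in> wick_arrays"
  unfolding trans_array_eq_star[OF hbar, of a w p] by (intro wick_arrays_star u_array_wick)

lemma pull_back_E: "a \<in> wick_arrays \<Longrightarrow> pull_back w (E a) = E (tr w a)"
  by (rule pull_back_ent[OF wick_arrays_entire])

text \<open>In the outer product the left factor \<open>star_array UNIV U a\<close> enters through
  its conjugate. The array \<open>a\<close> is therefore controlled three levels further in: one for
  each product and one for the conjugation. \<open>U\<close> and \<open>V\<close> are fixed and
  contribute to the constant.\<close>

lemma tr_bound: "\<exists>C bs'. C < \<infinity> \<and> (\<forall>a\<in>wick_arrays. hcasc bs (tr w a) R S \<le> C + hcasc bs' a R S)"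
proof -
  define U V where "U = u_array hbar p w" and "V = u_array hbar p (- w)"
  define bs1 where "bs1 = bs @ [True]"
  obtain C where C: "C < \<infinity>" "\<And>a. hcasc bs1 (conj_array a) R S \<le> C + hcasc (bs1 @ [True]) a R S"
    using hcasc_conj_array[of bs1 R S] by blast
  define bs2 where "bs2 = bs1 @ [True]"
  define K where "K = C + hcasc (bs2 @ [True]) (conj_array U) R S + hcasc (bs @ [False]) V R S"
  have "K < \<infinity>"
    using C(1) wick_arraysD[OF wick_arrays_conj[OF u_array_wick[of hbar p w]], of "bs2 @ [True]" R S]
      wick_arraysD[OF u_array_wick[of hbar p "- w"], of "bs @ [False]" R S]
    by (simp add: K_def U_def V_def)
  moreover have "hcasc bs (tr w a) R S \<le> K + hcasc (bs2 @ [False]) a R S" if "a \<in> wick_arrays" for a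
  proof -
    have "hcasc bs (tr w a) R S \<le> hcasc bs1 (conj_array (star_array UNIV U a)) R S + hcasc (bs @ [False]) V R S"
      unfolding trans_array_eq_star[OF hbar that, of w p] U_def V_def bs1_def by (rule hcasc_star_array)
    also have "\<dots> \<le> (C + hcasc bs2 (star_array UNIV U a) R S) + hcasc (bs @ [False]) V R S"
      unfolding bs2_def by (intro add_right_mono C(2))
    also have "\<dots> \<le> (C + (hcasc (bs2 @ [True]) (conj_array U) R S + hcasc (bs2 @ [False]) a R S)) + hcasc (bs @ [False]) V R S"
      by (intro add_right_mono add_left_mono hcasc_star_array)
    finally show ?thesis by (simp add: K_def add_ac)
  qed
  ultimately show ?thesis by blast
qed

lemma continuous_pull_back: "continuous_map (wick_topology hbar p) (wick_topology hbar p) (pull_back w)"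
  by (rule continuous_map_array_map[of "tr w"])
     (use tr_wick tr_bound pull_back_E in \<open>auto simp: trans_array_diff trans_array_cmult wick_arrays_entire\<close>)

lemma pull_back_in: "f \<in> wick_space hbar p \<Longrightarrow> pull_back w f \<in> wick_space hbar p"
  by (elim wick_space_cases) (auto simp: pull_back_E intro: E_in tr_wick)

text \<open>The star series has constant coefficients, and derivatives commute with translations, so
  both sides are the same series evaluated at the translated point.\<close>

lemma pull_back_star:
  assumes "f \<in> wick_space hbar p" "g \<in> wick_space hbar p"
  shows "pull_back w (wick_star hbar p f g) = wick_star hbar p (pull_back w f) (pull_back w g)"
proof -
  obtain a b where a: "a \<in> wick_arrays" "f = E a" and b: "b \<in> wick_arrays" "g = E b"
    using assms by (metis wick_space_cases)
  have "cent (tr w (star_array UNIV a b)) \<xi> = cent (star_array UNIV (tr w a) (tr w b)) \<xi>" for \<xi>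
  proof -
    have "((\<lambda>N. of_real (1 / mfact N) * (cent (\<lambda>T. tr w a (T + (N, 0))) \<xi> * cent (\<lambda>T. tr w b (T + (0, N))) \<xi>))
      has_sum cent (star_array UNIV (tr w a) (tr w b)) \<xi>) UNIV"
      by (intro cent_star_has_sum tr_wick a b)
    then have "((\<lambda>N. of_real (1 / mfact N) * (cent (\<lambda>T. a (T + (N, 0))) (dbl (sqrt (2 * hbar)) w + \<xi>) * cent (\<lambda>T. b (T + (0, N))) (dbl (sqrt (2 * hbar)) w + \<xi>)))
      has_sum cent (star_array UNIV (tr w a) (tr w b)) \<xi>) UNIV"
      unfolding shift_trans_array
      by (simp only: cent_trans_array[OF entire_array_shift[OF wick_arrays_entire[OF a(1)]]]
          cent_trans_array[OF entire_array_shift[OF wick_arrays_entire[OF b(1)]]])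
    then have "cent (star_array UNIV (tr w a) (tr w b)) \<xi> = cent (star_array UNIV a b) (dbl (sqrt (2 * hbar)) w + \<xi>)"
      using cent_star_has_sum[OF a(1) b(1)] by (rule has_sum_unique)
    then show ?thesis
      by (simp only: cent_trans_array[OF wick_arrays_entire[OF wick_arrays_star[OF a(1) b(1)]]])
  qed
  then have "E (tr w (star_array UNIV a b)) = E (star_array UNIV (tr w a) (tr w b))"
    by (simp add: ent_def fun_eq_iff)
  then show ?thesis
    by (simp add: a b wick_star_E pull_back_E wick_arrays_star tr_wick)
qed

lemma star_automorphism_pull_back: "wick_star_automorphism hbar p (pull_back w)"
  unfolding wick_star_automorphism_def
proof (intro conjI ballI allI)
  show "bij_betw (pull_back w) (wick_space hbar p) (wick_space hbar p)"
    by (rule bij_betwI[where g = "pull_back (- w)"]) (auto simp: pull_back_in, auto simp: pull_back_def add.assoc)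
qed (auto intro: pull_back_star, auto simp: pull_back_def)

section \<open>The unitaries and the inner form of the translations\<close>

lemma u_trans_E: "u_trans hbar w = E (u_array hbar p w)"
  by (rule ent_u_array[OF hbar, symmetric])

lemma u_star_u_inverse: "wick_star hbar p (u_trans hbar w) (u_trans hbar (- w)) = (\<lambda>z. 1)"
proof -
  have "cent (star_array UNIV (u_array hbar p w) (u_array hbar p (- w))) (\<zeta>, \<omega>) = 1" for \<zeta> \<omega>
  proof -
    have "cent (star_array UNIV (u_array hbar p w) (u_array hbar p (- w))) (\<zeta>, \<omega>)
        = cent (u_array hbar p w) ((\<zeta>, \<omega>) + ((\<chi> k. - (- w) $ k / of_real (sqrt (2 * hbar))), 0)) * cent (u_array hbar p (- w)) (\<zeta>, \<omega>)"
      unfolding u_array_def[of hbar p "- w"] by (rule cent_star_exp_array_right[OF u_array_wick])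
    also have "\<dots> = 1"
      unfolding add_Pair by (simp only: add_0_right) (rule u_array_product[OF hbar], simp)
    finally show ?thesis .
  qed
  then show ?thesis
    by (simp add: u_trans_E wick_star_E u_array_wick ent_def dbl_def fun_eq_iff)
qed

lemma cnj_u_trans: "(\<lambda>z. cnj (u_trans hbar w z)) = u_trans hbar (- w)"
  by (auto simp: u_trans_def exp_cnj fun_eq_iff sum_negf mult.commute)

lemma u_trans_in: "u_trans hbar w \<in> wick_space hbar p"
  unfolding u_trans_E by (intro E_in u_array_wick)

lemma is_inverse_u: "wick_is_inverse hbar p (u_trans hbar w) (u_trans hbar (- w))"
  unfolding wick_is_inverse_def
  using u_trans_in u_star_u_inverse[of w] u_star_u_inverse[of "- w"] by simp

lemma unitary_u: "wick_unitary hbar p (u_trans hbar w)"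
  unfolding wick_unitary_def cnj_u_trans by (rule is_inverse_u)

text \<open>Left multiplication by \<open>u_w\<close> shifts the second variable and multiplies by a
  function without zeros, so it is injective: evaluation at the point shifted back recovers the
  right factor.\<close>

lemma inverse_u_unique:
  assumes "wick_is_inverse hbar p (u_trans hbar w) v"
  shows "v = u_trans hbar (- w)"
proof -
  obtain b where b: "b \<in> wick_arrays" "v = E b"
    using assms unfolding wick_is_inverse_def by (auto elim: wick_space_cases)
  define V where "V = u_array hbar p (- w)"
  have V: "V \<in> wick_arrays" unfolding V_def by (rule u_array_wick)
  define U where "U = u_array hbar p w"
  define \<alpha> :: "complex ^ 'n" where "\<alpha> = (\<chi> k. cnj (w $ k) / of_real (sqrt (2 * hbar)))"
  have st: "cent (star_array UNIV U c) \<xi> = cent U \<xi> * cent c (\<xi> + (0, \<alpha>))" if "c \<in> wick_arrays" for c \<xi>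
    unfolding U_def u_array_def \<alpha>_def by (rule cent_star_exp_array_left[OF that])
  have "E (star_array UNIV U b) = E (star_array UNIV U V)"
  proof -
    have "wick_star hbar p (u_trans hbar w) v = wick_star hbar p (u_trans hbar w) (u_trans hbar (- w))"
      using assms is_inverse_u unfolding wick_is_inverse_def by simp
    then show ?thesis
      unfolding u_trans_E b by (simp only: wick_star_E u_array_wick b V U_def V_def)
  qed
  then have eq: "star_array UNIV U b = star_array UNIV U V"
    by (intro E_inj wick_arrays_star b V) (auto simp: U_def u_array_wick)
  have "cent b \<xi> = cent V \<xi>" for \<xi>
  proof -
    have "cent U (\<xi> - (0, \<alpha>)) * cent b ((\<xi> - (0, \<alpha>)) + (0, \<alpha>)) = cent U (\<xi> - (0, \<alpha>)) * cent V ((\<xi> - (0, \<alpha>)) + (0, \<alpha>))"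
      using eq by (simp only: st[OF b(1), symmetric] st[OF V, symmetric])
    moreover have "cent U (\<xi> - (0, \<alpha>)) \<noteq> 0"
      by (simp add: U_def u_array_def cent_exp_array)
    ultimately show ?thesis by simp
  qed
  then have "E b = E V" by (simp add: ent_def fun_eq_iff)
  then show ?thesis by (simp add: b u_trans_E V_def)
qed

lemma wick_inverse_u: "wick_inverse hbar p (u_trans hbar w) = u_trans hbar (- w)"
  unfolding wick_inverse_def by (rule the_equality) (auto intro: is_inverse_u inverse_u_unique)

lemma pull_back_eq_Ad:
  assumes "f \<in> wick_space hbar p"
  shows "pull_back w f = Ad_Wick hbar p (u_trans hbar w) f"
proof -
  obtain a where a: "a \<in> wick_arrays" "f = E a" using assms by (elim wick_space_cases)
  have "Ad_Wick hbar p (u_trans hbar w) f = E (star_array UNIV (star_array UNIV (u_array hbar p w) a) (u_array hbar p (- w)))"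
    unfolding Ad_Wick_def wick_inverse_u unfolding u_trans_E a(2)
    by (simp only: wick_star_E u_array_wick a(1) wick_arrays_star)
  also have "\<dots> = pull_back w f"
    by (simp only: trans_array_eq_star[OF hbar a(1), symmetric] a(2) pull_back_E[OF a(1)])
  finally show ?thesis ..
qed

end

theorem proposition5p3:
  fixes hbar :: real and p :: "complex ^ 'n"
  assumes "hbar > 0"
  shows "(\<forall>f\<in>wick_space hbar p. pull_back 0 f = f) \<and>
         (\<forall>v w. \<forall>f\<in>wick_space hbar p. pull_back (v + w) f = pull_back v (pull_back w f)) \<and>
         (\<forall>w. pull_back w ` wick_space hbar p \<subseteq> wick_space hbar p \<and>
              continuous_map (wick_topology hbar p) (wick_topology hbar p) (pull_back w) \<and>
              wick_star_automorphism hbar p (pull_back w) \<and>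
              wick_unitary hbar p (u_trans hbar w) \<and>
              (\<forall>f\<in>wick_space hbar p. pull_back w f = Ad_Wick hbar p (u_trans hbar w) f))"
proof -
  interpret wick hbar p by unfold_locales (rule assms)
  show ?thesis
  proof (intro conjI allI ballI)
    show "pull_back w ` wick_space hbar p \<subseteq> wick_space hbar p" for w
      using pull_back_in by blast
  qed (auto simp: pull_back_def[of 0] intro: continuous_pull_back star_automorphism_pull_back unitary_u pull_back_eq_Ad,
       simp add: pull_back_def add.assoc)
qed

end
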